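(* For every $n\ge5$ the operator $\Phi_n$, which assigns to each continuous transitive piecewise monotone interval map $f\in\mathcal T_n$ of modality $n$ the unique constant slope map $\Phi_n(f)\colon[0,1]\to[0,1]$ with slope $\exp(h(f))$ to which $f$ is conjugate via an increasing homeomorphism, is discontinuous (with respect to the uniform metrics).
   Context: Let $I$ be a compact non-degenerate interval. A continuous map $f\colon I\to I$ is piecewise monotone if $I$ can be divided into finitely many intervals on each of which $f$ is (non-strictly) monotone; its laps are the maximal intervals of monotonicity. Transitive means that some point has a dense trajectory. $\mathcal T_n$ is the space of all continuous transitive piecewise monotone maps $f\colon I\to I$ of modality $n$, i.e. with exactly $n+1$ laps, with the metric $\operatorname{dist}(f,g)=\sup_{x\in I}|f(x)-g(x)|$. A map of $[0,1]$ has constant slope $\beta$ if it is piecewise affine with finitely many pieces and $|g'(x)|=\beta$ wherever $g$ is differentiable. Every $f\in\mathcal T_n$ has positive topological entropy $h(f)$ and is conjugate via an increasing homeomorphism $I\to[0,1]$ to exactly one map of constant slope $\exp(h(f))$; this map is $\Phi_n(f)$. Thus $\Phi_n$ is a map from $\mathcal T_n$ to the space of constant slope maps of $[0,1]$ of modality $n$, the latter with the metric $\sup_{x\in[0,1]}|g_1(x)-g_2(x)|$. *)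

theory Defs
  imports "HOL-Analysis.Analysis" "HOL-Library.Disjoint_Sets"
begin

text \<open>
  Maps of an interval \<open>I\<close> are functions \<open>real \<Rightarrow> real\<close> lying in \<open>I \<rightarrow>\<^sub>E I\<close>: they are normalised to
  \<open>undefined\<close> outside \<open>I\<close>, so that equality as functions is equality on \<open>I\<close>.
\<close>

definition monotone_piece :: "(real \<Rightarrow> real) \<Rightarrow> real set \<Rightarrow> bool" where
  "monotone_piece f J \<longleftrightarrow> mono_on J f \<or> antimono_on J f"

definition piecewise_monotone_on :: "real set \<Rightarrow> (real \<Rightarrow> real) \<Rightarrow> bool" where
  "piecewise_monotone_on I f \<longleftrightarrow>
     (\<exists>P. finite P \<and> partition_on I P \<and> (\<forall>J\<in>P. is_interval J \<and> monotone_piece f J))"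

definition laps :: "real set \<Rightarrow> (real \<Rightarrow> real) \<Rightarrow> real set set" where
  "laps I f = {J. J \<subseteq> I \<and> is_interval J \<and> monotone_piece f J \<and>
     (\<forall>K. J \<subseteq> K \<and> K \<subseteq> I \<and> is_interval K \<and> monotone_piece f K \<longrightarrow> K = J)}"

definition has_modality :: "real set \<Rightarrow> (real \<Rightarrow> real) \<Rightarrow> nat \<Rightarrow> bool" where
  "has_modality I f n \<longleftrightarrow> finite (laps I f) \<and> card (laps I f) = n + 1"

definition transitive_on :: "'a::topological_space set \<Rightarrow> ('a \<Rightarrow> 'a) \<Rightarrow> bool" where
  "transitive_on X f \<longleftrightarrow> (\<exists>x\<in>X. X \<subseteq> closure (range (\<lambda>k. (f ^^ k) x)))"

text \<open>
  Topological entropy, in the Bowen--Dinaburg form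
  \<open>h(f) = sup\<^sub>\<epsilon> limsup\<^sub>n (1/n) log s(n, \<epsilon>)\<close>, where \<open>s(n, \<epsilon>)\<close> is the largest cardinality of an
  \<open>(n, \<epsilon>)\<close>-separated subset of the compact space \<open>X\<close>. The supremum over \<open>\<epsilon> > 0\<close> is the limit as
  \<open>\<epsilon>\<close> tends to \<open>0\<close>, the growth rate being decreasing in \<open>\<epsilon>\<close>.
\<close>

definition separated :: "('a::metric_space \<Rightarrow> 'a) \<Rightarrow> nat \<Rightarrow> real \<Rightarrow> 'a set \<Rightarrow> bool" where
  "separated f n \<epsilon> E \<longleftrightarrow>
     (\<forall>x\<in>E. \<forall>y\<in>E. x \<noteq> y \<longrightarrow> (\<exists>k<n. dist ((f ^^ k) x) ((f ^^ k) y) > \<epsilon>))"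

definition log_separation :: "'a::metric_space set \<Rightarrow> ('a \<Rightarrow> 'a) \<Rightarrow> nat \<Rightarrow> real \<Rightarrow> ereal" where
  "log_separation X f n \<epsilon> =
     (SUP E\<in>{E. E \<subseteq> X \<and> finite E \<and> E \<noteq> {} \<and> separated f n \<epsilon> E}. ereal (ln (real (card E))))"

definition topological_entropy :: "'a::metric_space set \<Rightarrow> ('a \<Rightarrow> 'a) \<Rightarrow> ereal" where
  "topological_entropy X f =
     (SUP \<epsilon>\<in>{0<..}. limsup (\<lambda>n. log_separation X f n \<epsilon> / ereal (real n)))"

definition transitive_maps :: "real \<Rightarrow> real \<Rightarrow> nat \<Rightarrow> (real \<Rightarrow> real) set" where
  "transitive_maps a b n =
     {f \<in> {a..b} \<rightarrow>\<^sub>E {a..b}. continuous_on {a..b} f \<and> piecewise_monotone_on {a..b} f \<and>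
        transitive_on {a..b} f \<and> has_modality {a..b} f n}"

definition piecewise_affine_on :: "real set \<Rightarrow> (real \<Rightarrow> real) \<Rightarrow> bool" where
  "piecewise_affine_on I g \<longleftrightarrow>
     (\<exists>P. finite P \<and> partition_on I P \<and>
        (\<forall>J\<in>P. is_interval J \<and> (\<exists>c d. \<forall>x\<in>J. g x = c * x + d)))"

text \<open>Derivatives are taken within \<open>{0..1}\<close>, hence one-sided at the two end points.\<close>

definition constant_slope :: "real \<Rightarrow> (real \<Rightarrow> real) \<Rightarrow> bool" where
  "constant_slope \<beta> g \<longleftrightarrow>
     g \<in> {0..1} \<rightarrow>\<^sub>E {0..1} \<and> continuous_on {0..1} g \<and> piecewise_affine_on {0..1} g \<and>
     (\<forall>x\<in>{0..1}. \<forall>D. (g has_real_derivative D) (at x within {0..1}) \<longrightarrow> \<bar>D\<bar> = \<beta>)"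

definition constant_slope_maps :: "nat \<Rightarrow> (real \<Rightarrow> real) set" where
  "constant_slope_maps n = {g. (\<exists>\<beta>. constant_slope \<beta> g) \<and> has_modality {0..1} g n}"

definition increasingly_conjugate ::
    "real set \<Rightarrow> (real \<Rightarrow> real) \<Rightarrow> real set \<Rightarrow> (real \<Rightarrow> real) \<Rightarrow> bool" where
  "increasingly_conjugate I f J g \<longleftrightarrow>
     (\<exists>\<phi> \<psi>. homeomorphism I J \<phi> \<psi> \<and> strict_mono_on I \<phi> \<and> (\<forall>x\<in>I. \<phi> (f x) = g (\<phi> x)))"

text \<open>
  The operator does not depend on the modality other than through its domain. The entropy of a
  piecewise monotone map is finite, so the conversion of it to a real number loses nothing.
\<close>

definition Phi :: "real \<Rightarrow> real \<Rightarrow> (real \<Rightarrow> real) \<Rightarrow> (real \<Rightarrow> real)" where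
  "Phi a b f =
     (THE g. constant_slope (exp (real_of_ereal (topological_entropy {a..b} f))) g \<and>
             increasingly_conjugate {a..b} f {0..1} g)"

definition transitive_space :: "real \<Rightarrow> real \<Rightarrow> nat \<Rightarrow> (real \<Rightarrow> real) metric" where
  "transitive_space a b n =
     submetric (cfunspace (top_of_set {a..b}) euclidean_metric) (transitive_maps a b n)"

definition constant_slope_space :: "nat \<Rightarrow> (real \<Rightarrow> real) metric" where
  "constant_slope_space n =
     submetric (cfunspace (top_of_set {0..1}) euclidean_metric) (constant_slope_maps n)"

lemma mspace_cfunspace_interval:
  fixes a b :: real
  assumes "f \<in> extensional {a..b}" "continuous_on {a..b} f"
  shows "f \<in> mspace (cfunspace (top_of_set {a..b}) (euclidean_metric :: real metric))"
proof -
  have "bounded (f ` {a..b})"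
    using assms(2) compact_continuous_image compact_imp_bounded by blast
  then show ?thesis
    using assms by auto
qed

lemma mspace_transitive_space: "mspace (transitive_space a b n) = transitive_maps a b n"
proof -
  have "transitive_maps a b n \<subseteq> mspace (cfunspace (top_of_set {a..b}) euclidean_metric)"
    by (intro subsetI mspace_cfunspace_interval) (auto simp: transitive_maps_def PiE_def)
  then show ?thesis
    unfolding transitive_space_def mspace_submetric by blast
qed

lemma mspace_constant_slope_space: "mspace (constant_slope_space n) = constant_slope_maps n"
proof -
  have "constant_slope_maps n \<subseteq> mspace (cfunspace (top_of_set {0..1}) euclidean_metric)"
    by (intro subsetI mspace_cfunspace_interval)
       (auto simp: constant_slope_maps_def constant_slope_def PiE_def)
  then show ?thesis
    unfolding constant_slope_space_def mspace_submetric by blast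
qed

lemma mdist_cfunspace_interval:
  fixes a b :: real and f g :: "real \<Rightarrow> real"
  assumes "a \<le> b"
    and "f \<in> mspace (cfunspace (top_of_set {a..b}) euclidean_metric)"
    and "g \<in> mspace (cfunspace (top_of_set {a..b}) euclidean_metric)"
  shows "mdist (cfunspace (top_of_set {a..b}) euclidean_metric) f g = (SUP x\<in>{a..b}. \<bar>f x - g x\<bar>)"
proof -
  have "f \<in> Metric_space.fspace UNIV dist {a..b}" "g \<in> Metric_space.fspace UNIV dist {a..b}"
    using assms(2,3) cfunspace_subset_funspace[of "top_of_set {a..b}" "euclidean_metric :: real metric"]
    by auto
  then show ?thesis
    using assms(1) by (simp add: mdist_cfunspace_eq_mdist_funspace Met_TC.fdist_def dist_real_def)
qed

lemma mdist_transitive_space: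
  assumes "a \<le> b" "f \<in> transitive_maps a b n" "g \<in> transitive_maps a b n"
  shows "mdist (transitive_space a b n) f g = (SUP x\<in>{a..b}. \<bar>f x - g x\<bar>)"
  using assms mspace_transitive_space[of a b n] mdist_cfunspace_interval[of a b f g]
  unfolding transitive_space_def mspace_submetric mdist_submetric by blast

lemma mdist_constant_slope_space:
  assumes "f \<in> constant_slope_maps n" "g \<in> constant_slope_maps n"
  shows "mdist (constant_slope_space n) f g = (SUP x\<in>{0..1}. \<bar>f x - g x\<bar>)"
  using assms mspace_constant_slope_space[of n] mdist_cfunspace_interval[of 0 1 f g]
  unfolding constant_slope_space_def mspace_submetric mdist_submetric by auto

text \<open>
  The negation of \<^const>\<open>continuous_map\<close> would also hold for an \<open>F\<close> with values outside the
  target space; for maps into the target space the two notions coincide.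
\<close>

definition discontinuous_map :: "'a metric \<Rightarrow> 'b metric \<Rightarrow> ('a \<Rightarrow> 'b) \<Rightarrow> bool" where
  "discontinuous_map m1 m2 F \<longleftrightarrow>
     (\<exists>f\<in>mspace m1. \<exists>\<epsilon>>0. \<forall>\<delta>>0. \<exists>g\<in>mspace m1. mdist m1 f g < \<delta> \<and> mdist m2 (F f) (F g) \<ge> \<epsilon>)"

lemma discontinuous_map_iff_not_continuous_map:
  assumes "F ` mspace m1 \<subseteq> mspace m2"
  shows "discontinuous_map m1 m2 F \<longleftrightarrow> \<not> continuous_map (mtopology_of m1) (mtopology_of m2) F"
proof -
  have "continuous_map (mtopology_of m1) (mtopology_of m2) F \<longleftrightarrow> F ` mspace m1 \<subseteq> mspace m2 \<and>
      (\<forall>a\<in>mspace m1. \<forall>\<epsilon>>0. \<exists>\<delta>>0. \<forall>x. x \<in> mspace m1 \<and> mdist m1 a x < \<delta> \<longrightarrow> mdist m2 (F a) (F x) < \<epsilon>)"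
    unfolding mtopology_of_def
    by (rule Metric_space.metric_continuous_map) (rule Metric_space_mspace_mdist)+
  then show ?thesis
    using assms unfolding discontinuous_map_def by (meson not_le)
qed

end

theory Submission
  imports Defs
begin

text \<open>
  Entropy can jump up in the limit of nearby transitive maps of the same modality. Take \<open>f\<close> of modality
  \<open>n\<close>, Markov over a lattice, whose increments over lattice cells are at most twice the
  cell length, sometimes less; its constant slope model then has slope less than 2. Two turning points
  of \<open>f\<close> form an orbit of period two. Blowing them up to small intervals, each folded two-to-one over
  the other, gives maps arbitrarily close to \<open>f\<close> with slope at least 2; one of the two folds
  overshoots by \<open>\<eta>\<close>, so that the pair of intervals is not invariant and the map is still transitive.
  Two constant slope maps of modality \<open>n\<close>, one with a fixed slope less than 2 and the other with slope at
  least 2, have a distance bounded from below.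

  For a Markov map in which every interval eventually covers every cell, a positive eigenvector of
  the transition matrix gives the lengths of the cells of the constant slope model, whose slope is
  the eigenvalue \<open>\<beta>\<close>. Counting cells of iterated refinements bounds the entropy by \<open>ln \<beta>\<close>, horseshoes
  give the opposite bound, and uniqueness of the eigenvector identifies the model with \<open>\<Phi>\<^sub>n\<close>.
\<close>

section \<open>Positive eigenvectors\<close>

text \<open>The value 2 separates the slopes because two intervals folded two-to-one over each other
  give the second iterate four full branches, hence slope at least 2 however small the intervals
  are. The base map expands by 2 at most, and only by 1 on some cells, so its own
  \<open>\<beta>\<close> is below 2. Modality survives the blow-up because each small interval
  carries a single fold, which takes the place of one turning point. The obstacle is to have
  transitivity and a finite Markov partition at once: the leak out of the small intervals starts an
  orbit that recedes by the factor \<open>s\<close> in each step and must end on the lattice. The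
  condition n >= 5 comes from the base map, which for \<open>E = 1\<close> has exactly five interior
  turning points, two of them forming the cycle. Higher modality is filled up by unit laps with
  values next to the repelling fixed point, where small intervals are sure to grow. Slope 1 does no
  harm to expansion: such pieces are mapped into pieces of slope at least 2, so two steps double
  lengths as long as no partition point intervenes.\<close>

lemma compact_unit_functions:
  "compact {w :: 'a \<Rightarrow> real. \<forall>x. w x \<in> (if x \<in> S then {0..1} else {0})}" (is "compact ?K")
proof -
  \<comment> \<open>Vectors on \<open>S\<close> are functions on the whole type that are pinned to 0
    elsewhere, so the cube is a full product of compact sets and Tychonoff applies.\<close>
  have eq: "?K = PiE UNIV (\<lambda>x. if x \<in> S then {0..1} else {0})"
    by (auto simp: PiE_def Pi_def)
  have "compactin (product_topology (\<lambda>_. euclidean) UNIV) ?K"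
    unfolding eq compactin_PiE by (auto simp: )
  then show ?thesis
    by (simp add: euclidean_product_topology)
qed

text \<open>A zero spreads along every edge, since a nonnegative successor is bounded by its row
  sum, and irreducibility carries it to all of \<open>S\<close>. This is the strong minimum
  principle behind both comparisons below.\<close>

lemma perron_subinvariant_pos:
  fixes w :: "'a \<Rightarrow> real"
  assumes "finite S" "R \<subseteq> S \<times> S" and irr: "\<And>x y. x \<in> S \<Longrightarrow> y \<in> S \<Longrightarrow> (x, y) \<in> R\<^sup>*"
    and nn: "\<And>x. x \<in> S \<Longrightarrow> 0 \<le> w x"
    and sub: "\<And>x. x \<in> S \<Longrightarrow> (\<Sum>y\<in>R``{x}. w y) \<le> c * w x"
    and x: "x \<in> S" "w x = 0" and y: "y \<in> S"
  shows "w y = 0"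
proof -
  have "(x, y) \<in> R\<^sup>*" using irr x y by blast
  then show ?thesis
  proof (induction rule: rtrancl_induct)
    case (step u v)
    have fin: "finite (R``{u})" using assms(1,2) by (auto intro: finite_subset[OF _ assms(1)])
    have uv: "u \<in> S" "v \<in> S" "R``{u} \<subseteq> S" using step assms(2) by auto
    have "w v \<le> (\<Sum>y\<in>R``{u}. w y)"
      by (rule member_le_sum) (use step uv fin nn in auto)
    also have "\<dots> \<le> 0" using sub[OF uv(1)] step by simp
    finally show ?case using nn[OF uv(2)] by simp
  qed (use x in simp)
qed

text \<open>Touch \<open>w\<close> from below by the largest multiple \<open>t * u\<close>. The
  difference is nonnegative, subinvariant and zero somewhere, hence zero. For
  \<open>\<mu> = \<beta>\<close> this is the uniqueness of the positive eigenvector up to a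
  factor.\<close>

lemma perron_compare_upper:
  fixes w u :: "'a \<Rightarrow> real"
  assumes fin: "finite S" and ne: "S \<noteq> {}" and R: "R \<subseteq> S \<times> S"
    and irr: "\<And>x y. x \<in> S \<Longrightarrow> y \<in> S \<Longrightarrow> (x, y) \<in> R\<^sup>*"
    and w: "\<And>x. x \<in> S \<Longrightarrow> 0 < w x" and u: "\<And>x. x \<in> S \<Longrightarrow> 0 < u x"
    and eig: "\<And>x. x \<in> S \<Longrightarrow> (\<Sum>y\<in>R``{x}. w y) = \<beta> * w x"
    and sup: "\<And>x. x \<in> S \<Longrightarrow> \<mu> * u x \<le> (\<Sum>y\<in>R``{x}. u y)" and le: "\<beta> \<le> \<mu>" "0 \<le> \<mu>"
  shows "\<exists>t>0. \<forall>x\<in>S. w x = t * u x \<and> (\<Sum>y\<in>R``{x}. u y) = \<mu> * u x"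
proof -
  define t where "t = Min ((\<lambda>x. w x / u x) ` S)"
  have "t \<in> (\<lambda>x. w x / u x) ` S" unfolding t_def using fin ne by (intro Min_in) auto
  then obtain x0 where x0: "x0 \<in> S" "t = w x0 / u x0" by auto
  have t: "t > 0" using x0 w u by simp
  have ge: "t * u x \<le> w x" if "x \<in> S" for x
  proof -
    have "t \<le> w x / u x" unfolding t_def using fin that by (intro Min_le) auto
    then show ?thesis using u[OF that] by (simp add: field_simps)
  qed
  have sub: "(\<Sum>y\<in>R``{x}. w y - t * u y) \<le> \<mu> * (w x - t * u x)" if "x \<in> S" for x
  proof -
    have "(\<Sum>y\<in>R``{x}. w y - t * u y) = \<beta> * w x - t * (\<Sum>y\<in>R``{x}. u y)"
      by (simp add: sum_subtractf eig[OF that] sum_distrib_left)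
    also have "\<dots> \<le> \<mu> * w x - t * (\<mu> * u x)"
      using sup[OF that] w[OF that] t le by (intro diff_mono mult_right_mono mult_left_mono) auto
    finally show ?thesis by (simp add: algebra_simps)
  qed
  have eq0: "w x0 - t * u x0 = 0" using x0 u[OF x0(1)] by simp
  have z: "w x - t * u x = 0" if "x \<in> S" for x
    by (rule perron_subinvariant_pos[OF fin R irr _ sub x0(1) _ that]) (use ge eq0 in auto)
  have "(\<Sum>y\<in>R``{x}. u y) = \<mu> * u x" if "x \<in> S" for x
  proof -
    have "t * (\<Sum>y\<in>R``{x}. u y) = (\<Sum>y\<in>R``{x}. w y)"
      unfolding sum_distrib_left using R z by (intro sum.cong) (force+)
    also have "\<dots> = t * (\<beta> * u x)" using eig[OF that] z[OF that] by (simp add: algebra_simps)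
    finally have "(\<Sum>y\<in>R``{x}. u y) = \<beta> * u x" using t by simp
    then show ?thesis using sup[OF that] le u[OF that]
      by (smt (verit) mult_right_mono)
  qed
  then show ?thesis using t z by (intro exI[of _ t]) (auto simp: algebra_simps)
qed

text \<open>The same touching argument with the roles exchanged: now a multiple of the eigenvector
  touches \<open>u\<close> from below. It serves to bound the eigenvalue from above by a test
  vector.\<close>

lemma perron_compare_lower:
  fixes w u :: "'a \<Rightarrow> real"
  assumes fin: "finite S" and ne: "S \<noteq> {}" and R: "R \<subseteq> S \<times> S"
    and irr: "\<And>x y. x \<in> S \<Longrightarrow> y \<in> S \<Longrightarrow> (x, y) \<in> R\<^sup>*"
    and w: "\<And>x. x \<in> S \<Longrightarrow> 0 < w x" and u: "\<And>x. x \<in> S \<Longrightarrow> 0 < u x"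
    and eig: "\<And>x. x \<in> S \<Longrightarrow> (\<Sum>y\<in>R``{x}. w y) = \<beta> * w x"
    and sub: "\<And>x. x \<in> S \<Longrightarrow> (\<Sum>y\<in>R``{x}. u y) \<le> \<mu> * u x" and le: "\<mu> \<le> \<beta>" "0 \<le> \<beta>"
  shows "\<forall>x\<in>S. (\<Sum>y\<in>R``{x}. u y) = \<mu> * u x"
proof -
  define t where "t = Min ((\<lambda>x. u x / w x) ` S)"
  have "t \<in> (\<lambda>x. u x / w x) ` S" unfolding t_def using fin ne by (intro Min_in) auto
  then obtain x0 where x0: "x0 \<in> S" "t = u x0 / w x0" by auto
  have t: "t > 0" using x0 w u by simp
  have ge: "t * w x \<le> u x" if "x \<in> S" for x
  proof -
    have "t \<le> u x / w x" unfolding t_def using fin that by (intro Min_le) auto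
    then show ?thesis using w[OF that] by (simp add: field_simps)
  qed
  have sub': "(\<Sum>y\<in>R``{x}. u y - t * w y) \<le> \<beta> * (u x - t * w x)" if "x \<in> S" for x
  proof -
    have "(\<Sum>y\<in>R``{x}. u y - t * w y) = (\<Sum>y\<in>R``{x}. u y) - t * (\<beta> * w x)"
      by (simp add: sum_subtractf eig[OF that] flip: sum_distrib_left)
    also have "\<dots> \<le> \<beta> * u x - t * (\<beta> * w x)"
      using sub[OF that] u[OF that] le by (smt (verit) mult_right_mono)
    finally show ?thesis by (simp add: algebra_simps)
  qed
  have eq0: "u x0 - t * w x0 = 0" using x0 w[OF x0(1)] by simp
  have z: "u x - t * w x = 0" if "x \<in> S" for x
    by (rule perron_subinvariant_pos[OF fin R irr _ sub' x0(1) _ that]) (use ge eq0 in auto)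
  show ?thesis
  proof
    fix x assume x: "x \<in> S"
    have "(\<Sum>y\<in>R``{x}. u y) = (\<Sum>y\<in>R``{x}. t * w y)"
      using R z by (intro sum.cong) (force+)
    also have "\<dots> = t * (\<beta> * w x)" using eig[OF x] by (simp flip: sum_distrib_left)
    also have "\<dots> = \<beta> * u x" using z[OF x] by (simp add: algebra_simps)
    finally show "(\<Sum>y\<in>R``{x}. u y) = \<mu> * u x" using sub[OF x] le u[OF x]
      by (smt (verit) mult_right_mono)
  qed
qed

text \<open>
  The eigenvalue is the least \<open>\<mu>\<close> admitting a subinvariant vector; minimality forces the vector to be
  an eigenvector, since otherwise summing its iterates under the matrix makes all inequalities strict.
\<close>

lemma perron_eigenvector:
  assumes fin: "finite S" and ne: "S \<noteq> {}" and R: "R \<subseteq> S \<times> S"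
    and irr: "\<And>x y. x \<in> S \<Longrightarrow> y \<in> S \<Longrightarrow> (x, y) \<in> R\<^sup>*"
  obtains \<beta> :: real and w :: "'a \<Rightarrow> real" where "\<And>x. x \<in> S \<Longrightarrow> 0 < w x" "sum w S = 1"
    "\<And>x. x \<in> S \<Longrightarrow> (\<Sum>y\<in>R``{x}. w y) = \<beta> * w x"
proof -
  define A where "A = (\<lambda>(w :: 'a \<Rightarrow> real) x. \<Sum>y\<in>R``{x}. w y)"
  have finR: "finite (R``{x})" for x using R by (auto intro: finite_subset[OF _ fin])
  have RS: "R``{x} \<subseteq> S" for x using R by auto
  define K where "K = {w :: 'a \<Rightarrow> real. \<forall>x. w x \<in> (if x \<in> S then {0..1} else {0})}"
  define V where "V = (\<lambda>l. K \<inter> {w. sum w S = 1 \<and> (\<forall>x\<in>S. A w x \<le> l * w x)})"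
  have coord: "continuous_on UNIV (\<lambda>w :: 'a \<Rightarrow> real. w x)" for x
    by (simp add: continuous_on_product_then_coordinatewise)
  have cl: "closed {w. sum w S = 1 \<and> (\<forall>x\<in>S. A w x \<le> l * w x)}" for l
  proof -
    have "{w. sum w S = 1 \<and> (\<forall>x\<in>S. A w x \<le> l * w x)} =
        {w. sum w S = 1} \<inter> (\<Inter>x\<in>S. {w. A w x \<le> l * w x})" by auto
    also have "closed \<dots>"
      unfolding A_def
      by (intro closed_Int closed_INT ballI closed_Collect_eq closed_Collect_le continuous_intros coord)
    finally show ?thesis .
  qed
  define L where "L = {l. V l \<noteq> {}}"
  have posL: "0 \<le> l" if l: "l \<in> L" for l
  proof -
    obtain w where w: "w \<in> V l" using l by (auto simp: L_def)
    then have nn: "0 \<le> w x" for x by (auto simp: V_def K_def dest: spec[of _ x] split: if_splits)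
    have s: "sum w S = 1" using w by (simp add: V_def)
    have "0 \<le> (\<Sum>x\<in>S. A w x)" unfolding A_def by (intro sum_nonneg nn)
    also have "\<dots> \<le> (\<Sum>x\<in>S. l * w x)" using w by (intro sum_mono) (auto simp: V_def)
    also have "\<dots> = l" using s by (simp flip: sum_distrib_left)
    finally show ?thesis .
  qed
  have normalise: "l \<in> L" if u: "\<And>x. x \<in> S \<Longrightarrow> 0 < u x" and le: "\<And>x. x \<in> S \<Longrightarrow> A u x \<le> l * u x" for u l
  proof -
    define w where "w = (\<lambda>x. if x \<in> S then u x / sum u S else 0)"
    have p: "sum u S > 0" using fin ne u by (intro sum_pos) auto
    have "w \<in> K" unfolding K_def w_def
      using p fin member_le_sum[of _ S u] u by (auto simp: divide_simps less_imp_le)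
    moreover have "sum w S = 1" unfolding w_def using p by (simp flip: sum_divide_distrib)
    moreover have "A w x \<le> l * w x" if "x \<in> S" for x
    proof -
      have "A w x = A u x / sum u S"
        unfolding A_def w_def sum_divide_distrib using RS by (intro sum.cong) auto
      also have "\<dots> \<le> l * u x / sum u S" using le[OF that] p by (simp add: divide_right_mono)
      finally show ?thesis using that by (simp add: w_def)
    qed
    ultimately show ?thesis by (auto simp: L_def V_def)
  qed
  have neL: "real (card S) \<in> L"
  proof (rule normalise[of "\<lambda>_. 1"])
    fix x show "A (\<lambda>_. 1) x \<le> real (card S) * 1"
      unfolding A_def using card_mono[OF fin RS[of x]] by simp
  qed simp
  define \<beta> where "\<beta> = Inf L"
  have bdd: "bdd_below L" using posL by (auto simp: bdd_below_def)
  have \<beta>le: "\<beta> \<le> l" if "l \<in> L" for l unfolding \<beta>_def using bdd that by (rule cInf_lower[rotated])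
  \<comment> \<open>The infimum is attained: finitely many of the closed conditions are met by a
    vector for a single \<open>l\<close> below the smallest tolerance, so compactness gives one
    vector for all tolerances \<open>1 / Suc m\<close>.\<close>
  have "K \<inter> (\<Inter>m. {w. sum w S = 1 \<and> (\<forall>x\<in>S. A w x \<le> (\<beta> + 1 / real (Suc m)) * w x)}) \<noteq> {}"
  proof (rule compact_imp_fip_image)
    show "compact K" unfolding K_def by (rule compact_unit_functions)
    show "closed {w. sum w S = 1 \<and> (\<forall>x\<in>S. A w x \<le> (\<beta> + 1 / real (Suc m)) * w x)}" for m
      by (rule cl)
    fix I' :: "nat set" assume "finite I'" "I' \<subseteq> UNIV"
    define m0 where "m0 = Max (insert 0 I')"
    have "\<beta> < \<beta> + 1 / real (Suc m0)" by simp
    then obtain l where l: "l \<in> L" "l < \<beta> + 1 / real (Suc m0)"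
      unfolding \<beta>_def using neL by (metis cInf_lessD empty_iff)
    then obtain w where w: "w \<in> V l" by (auto simp: L_def)
    then have nn: "0 \<le> w x" for x by (auto simp: V_def K_def dest: spec[of _ x] split: if_splits)
    have "A w x \<le> (\<beta> + 1 / real (Suc m)) * w x" if m: "m \<in> I'" and x: "x \<in> S" for m x
    proof -
      have "m \<le> m0" unfolding m0_def using m \<open>finite I'\<close> by simp
      then have "1 / real (Suc m0) \<le> 1 / real (Suc m)" by (simp add: frac_le)
      then have "l \<le> \<beta> + 1 / real (Suc m)" using l by linarith
      then show ?thesis using w x nn[of x] by (auto simp: V_def intro: order_trans mult_right_mono)
    qed
    then show "K \<inter> (\<Inter>m\<in>I'. {w. sum w S = 1 \<and> (\<forall>x\<in>S. A w x \<le> (\<beta> + 1 / real (Suc m)) * w x)}) \<noteq> {}"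
      using w by (auto simp: V_def)
  qed
  then obtain w where wK: "w \<in> K" and s1: "sum w S = 1"
    and wm: "\<And>m x. x \<in> S \<Longrightarrow> A w x \<le> (\<beta> + 1 / real (Suc m)) * w x" by auto
  have nn: "0 \<le> w x" for x using wK by (auto simp: K_def dest: spec[of _ x] split: if_splits)
  have le: "A w x \<le> \<beta> * w x" if "x \<in> S" for x
  proof (rule LIMSEQ_le_const)
    have "(\<lambda>m. (\<beta> + 1 / real (Suc m)) * w x) \<longlonglongrightarrow> (\<beta> + 0) * w x"
      by (intro tendsto_intros) (rule LIMSEQ_inverse_real_of_nat[unfolded inverse_eq_divide])
    then show "(\<lambda>m. (\<beta> + 1 / real (Suc m)) * w x) \<longlonglongrightarrow> \<beta> * w x" by simp
  qed (use wm that in auto)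
  have pos: "0 < w x" if x: "x \<in> S" for x
  proof (rule ccontr)
    assume "\<not> 0 < w x"
    then have "w x = 0" using nn[of x] by simp
    then have "w y = 0" if "y \<in> S" for y
      using perron_subinvariant_pos[OF fin R irr, of w \<beta> x y] nn le x that by (auto simp: A_def)
    then show False using s1 by simp
  qed
  have "A w x = \<beta> * w x" if x0: "x \<in> S" for x
  proof (rule ccontr)
    assume neq: "A w x \<noteq> \<beta> * w x"
    define D where "D = (\<lambda>x. \<beta> * w x - A w x)"
    have D0: "0 \<le> D y" if "y \<in> S" for y using le[OF that] by (simp add: D_def)
    have Dx: "0 < D x" using le[OF x0] neq by (simp add: D_def)
    have ApowD: "(A ^^ k) D y = \<beta> * (A ^^ k) w y - (A ^^ Suc k) w y" if "y \<in> S" for k y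
      using that
    proof (induction k arbitrary: y)
      case (Suc k)
      have "(A ^^ Suc k) D y = (\<Sum>z\<in>R``{y}. \<beta> * (A ^^ k) w z - (A ^^ Suc k) w z)"
        using Suc RS by (auto simp: A_def intro!: sum.cong)
      then show ?case by (simp add: A_def sum_subtractf sum_distrib_left)
    qed (simp add: D_def)
    have Apow0: "0 \<le> (A ^^ k) D y" if "y \<in> S" for k y
      using that
    proof (induction k arbitrary: y)
      case (Suc k)
      then show ?case using RS by (auto simp: A_def intro!: sum_nonneg)
    qed (simp add: D0)
    have Appos: "0 \<le> (A ^^ k) w y" if "y \<in> S" for k y
      using that
    proof (induction k arbitrary: y)
      case (Suc k)
      then show ?case using RS by (auto simp: A_def intro!: sum_nonneg)
    qed (simp add: nn)
    \<comment> \<open>A path of length \<open>k\<close> from \<open>y\<close> to \<open>x\<close>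
      transports the strict defect at \<open>x\<close> into the \<open>k\<close>-th iterate at
      \<open>y\<close>; so every row has some iterate in which it is strict.\<close>
    have reach: "\<exists>k. 0 < (A ^^ k) D y" if "y \<in> S" for y
    proof -
      have "(y, x) \<in> R\<^sup>*" using irr that x0 by blast
      then show ?thesis
      proof (induction rule: converse_rtrancl_induct)
        case base
        show ?case using Dx by (intro exI[of _ 0]) simp
      next
        case (step y z)
        then obtain k where k: "0 < (A ^^ k) D z" by blast
        have "(A ^^ k) D z \<le> (\<Sum>z\<in>R``{y}. (A ^^ k) D z)"
          by (rule member_le_sum) (use step finR in \<open>auto intro!: Apow0 dest: subsetD[OF R]\<close>)
        then have "0 < (A ^^ Suc k) D y" using k by (simp add: A_def)
        then show ?case by blast
      qed
    qed
    then obtain kk where kk: "\<And>y. y \<in> S \<Longrightarrow> 0 < (A ^^ kk y) D y" by metis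
    define N where "N = Max (kk ` S)"
    define u where "u = (\<lambda>y. \<Sum>k\<le>N. (A ^^ k) w y)"
    have u: "0 < u y" if "y \<in> S" for y
    proof -
      have "(A ^^ 0) w y \<le> u y" unfolding u_def
        by (rule member_le_sum) (use Appos that in auto)
      then show ?thesis using pos[OF that] by simp
    qed
    have strict: "A u y < \<beta> * u y" if "y \<in> S" for y
    proof -
      have "A u y = (\<Sum>k\<le>N. (A ^^ Suc k) w y)"
        unfolding u_def A_def by (subst sum.swap) simp
      moreover have "(\<Sum>k\<le>N. (A ^^ k) D y) = \<beta> * u y - (\<Sum>k\<le>N. (A ^^ Suc k) w y)"
        unfolding u_def using that by (simp only: ApowD sum_subtractf sum_distrib_left)
      moreover have "0 < (\<Sum>k\<le>N. (A ^^ k) D y)"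
      proof (rule sum_pos2)
        show "kk y \<in> {..N}" unfolding N_def using fin that by simp
      qed (use kk that Apow0 in auto)
      ultimately show ?thesis by linarith
    qed
    define l where "l = Max ((\<lambda>y. A u y / u y) ` S)"
    have "l \<in> (\<lambda>y. A u y / u y) ` S" unfolding l_def using fin ne by (intro Max_in) auto
    then have "l < \<beta>" using strict u by (auto simp: field_simps)
    moreover have "l \<in> L"
    proof (rule normalise[of u])
      fix y assume y: "y \<in> S"
      have "A u y / u y \<le> l" unfolding l_def using fin y by (intro Max_ge) auto
      then show "A u y \<le> l * u y" using u[OF y] by (simp add: field_simps)
    qed (use u in auto)
    ultimately show False using \<beta>le by fastforce
  qed
  then show ?thesis using that[of w \<beta>] pos s1 by (simp add: A_def)
qed

section \<open>Cells of a finite grid\<close>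

definition nxt :: "real set \<Rightarrow> real \<Rightarrow> real" where
  "nxt P x = Min {q\<in>P. x < q}"

text \<open>Symmetric in the two points because images under \<open>f\<close> may reverse their
  order. Points of \<open>P\<close> themselves are allowed, so a partition point is adjacent to the
  closed cells on both of its sides.\<close>

definition adj :: "real set \<Rightarrow> real \<Rightarrow> real \<Rightarrow> bool" where
  "adj P x y \<longleftrightarrow> (\<forall>q\<in>P. \<not> (x < q \<and> q < y) \<and> \<not> (y < q \<and> q < x))"

lemma adj_refl [simp]: "adj P x x" by (auto simp: adj_def)

lemma adj_sym: "adj P x y \<Longrightarrow> adj P y x" by (auto simp: adj_def)

lemma adj_subinterval: "adj P x y \<Longrightarrow> x \<le> u \<Longrightarrow> u \<le> y \<Longrightarrow> x \<le> v \<Longrightarrow> v \<le> y \<Longrightarrow> adj P u v"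
  unfolding adj_def by (meson le_less_trans less_le_trans)

lemma adj_antimono: "adj Q x y \<Longrightarrow> P \<subseteq> Q \<Longrightarrow> adj P x y"
  by (auto simp: adj_def)

lemma nxt_props:
  assumes "finite P" "q \<in> P" "x < q"
  shows "nxt P x \<in> P" "x < nxt P x" "nxt P x \<le> q"
proof -
  have "nxt P x \<in> {q\<in>P. x < q}" unfolding nxt_def using assms by (intro Min_in) auto
  then show "nxt P x \<in> P" "x < nxt P x" by auto
  show "nxt P x \<le> q" unfolding nxt_def using assms by (intro Min_le) auto
qed

lemma adj_nxt: "finite P \<Longrightarrow> q \<in> P \<Longrightarrow> x < q \<Longrightarrow> adj P x (nxt P x)"
  unfolding adj_def by (metis nxt_props(3) nxt_props(2) leD less_trans)

lemma nxt_eqI: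
  assumes "finite P" "p < q" "q \<in> P" "adj P p q"
  shows "nxt P p = q"
  using nxt_props[OF assms(1,3,2)] assms by (force simp: adj_def)

lemma exists_left_endpoint:
  assumes "finite P" "a \<in> P" "b \<in> P" "a \<le> x" "x < b"
  obtains p where "p \<in> P" "p \<le> x" "x < nxt P p" "p < b"
proof
  define p where "p = Max {p\<in>P. p \<le> x}"
  have "p \<in> {p\<in>P. p \<le> x}" unfolding p_def using assms by (intro Max_in) auto
  then show p: "p \<in> P" "p \<le> x" by auto
  then show "p < b" using assms by simp
  show "x < nxt P p"
  proof (rule ccontr)
    assume "\<not> x < nxt P p"
    moreover have "nxt P p \<in> P" "p < nxt P p" using nxt_props[OF assms(1,3) \<open>p < b\<close>] by auto
    ultimately have "nxt P p \<le> p" unfolding p_def using assms by (intro Max_ge) auto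
    then show False using \<open>p < nxt P p\<close> by simp
  qed
qed

lemma sum_nxt_telescope:
  fixes h :: "real \<Rightarrow> real"
  assumes fin: "finite P"
  shows "x \<in> P \<Longrightarrow> y \<in> P \<Longrightarrow> x \<le> y \<Longrightarrow> (\<Sum>p\<in>{p\<in>P. x \<le> p \<and> p < y}. h (nxt P p) - h p) = h y - h x"
proof (induction "card {p\<in>P. x \<le> p \<and> p < y}" arbitrary: x rule: less_induct)
  case less
  show ?case
  proof (cases "x = y")
    case True
    then have "{p\<in>P. x \<le> p \<and> p < y} = {}" by auto
    then show ?thesis using True by (metis diff_self sum.empty)
  next
    case False
    then have xy: "x < y" using less by simp
    note n = nxt_props[OF fin less.prems(2) xy] and na = adj_nxt[OF fin less.prems(2) xy]
    have ins: "{p\<in>P. x \<le> p \<and> p < y} = insert x {p\<in>P. nxt P x \<le> p \<and> p < y}"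
      using n na less.prems xy by (force simp: adj_def)
    have "card {p\<in>P. nxt P x \<le> p \<and> p < y} < card {p\<in>P. x \<le> p \<and> p < y}"
      unfolding ins using n fin by (subst card_insert_disjoint) auto
    then have "(\<Sum>p\<in>{p\<in>P. nxt P x \<le> p \<and> p < y}. h (nxt P p) - h p) = h y - h (nxt P x)"
      using less n by blast
    then show ?thesis unfolding ins using n fin by (subst sum.insert) auto
  qed
qed

text \<open>Half-open cells are disjoint, as \<open>partition_on\<close> demands; the left end of
  the interval then becomes a singleton class.\<close>

lemma partition_half_open:
  assumes fin: "finite P" and P: "P \<subseteq> {a..b}" "a \<in> P" "b \<in> P"
  shows "partition_on {a..b} (insert {a} ((\<lambda>p. {p<..nxt P p}) ` (P - {b})))"
proof (rule partition_onI)
  have lt: "p < b" if "p \<in> P - {b}" for p using that P by (auto simp: less_le)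
  show "\<Union>(insert {a} ((\<lambda>p. {p<..nxt P p}) ` (P - {b}))) = {a..b}"
  proof (intro equalityI subsetI)
    fix x assume "x \<in> \<Union>(insert {a} ((\<lambda>p. {p<..nxt P p}) ` (P - {b})))"
    then show "x \<in> {a..b}"
      using P nxt_props[OF fin P(3) lt] by (auto simp: subset_iff) (force+)?
  next
    fix x assume x: "x \<in> {a..b}"
    show "x \<in> \<Union>(insert {a} ((\<lambda>p. {p<..nxt P p}) ` (P - {b})))"
    proof (cases "x = a")
      case False
      define p where "p = Max {p\<in>P. p < x}"
      have "p \<in> {p\<in>P. p < x}" unfolding p_def using fin P x False by (intro Max_in) auto
      then have p: "p \<in> P" "p < x" "p < b" using x by auto
      have "x \<le> nxt P p"
      proof (rule ccontr)
        assume "\<not> x \<le> nxt P p"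
        then have "nxt P p \<le> p" unfolding p_def using fin nxt_props[OF fin P(3) p(3)]
          by (intro Max_ge) (auto simp: p_def)
        then show False using nxt_props[OF fin P(3) p(3)] by simp
      qed
      then show ?thesis using p by auto
    qed auto
  qed
  show "disjnt X Y" if XY: "X \<in> insert {a} ((\<lambda>p. {p<..nxt P p}) ` (P - {b}))"
    "Y \<in> insert {a} ((\<lambda>p. {p<..nxt P p}) ` (P - {b}))" "X \<noteq> Y" for X Y
  proof -
    have *: "disjnt {p<..nxt P p} {q<..nxt P q}" if "p \<in> P" "q \<in> P" "p < q" for p q
      using nxt_props(3)[OF fin that(2,3)] by (auto simp: disjnt_def)
    have **: "disjnt {a} {q<..nxt P q}" if "q \<in> P" for q using that P by (auto simp: disjnt_def)
    from XY consider "X = {a}" "Y = {a}" | q where "X = {a}" "Y = {q<..nxt P q}" "q \<in> P"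
      | q where "Y = {a}" "X = {q<..nxt P q}" "q \<in> P"
      | p q where "X = {p<..nxt P p}" "Y = {q<..nxt P q}" "p \<in> P" "q \<in> P" by blast
    then show ?thesis
      using XY(3) * ** by cases (metis disjnt_sym linorder_less_linear)+
  qed
  show "{} \<notin> insert {a} ((\<lambda>p. {p<..nxt P p}) ` (P - {b}))"
    using nxt_props[OF fin P(3) lt] by (auto simp: greaterThanAtMost_empty_iff) (metis DiffI leD lt singletonD)?
qed

lemma connected_image_interval:
  fixes f :: "real \<Rightarrow> real"
  assumes "continuous_on {a..b} f" "connected S" "S \<subseteq> {a..b}" "u \<in> f ` S" "v \<in> f ` S"
  shows "{u..v} \<subseteq> f ` S"
proof -
  have "connected (f ` S)" using assms by (meson connected_continuous_image continuous_on_subset)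
  then have "is_interval (f ` S)" by (simp add: is_interval_connected_1)
  then show ?thesis using assms(4,5) unfolding is_interval_1 by (meson atLeastAtMost_iff subsetI)
qed

section \<open>The semiconjugacy to constant slope\<close>

text \<open>\<open>covers\<close> gives irreducibility of the transition relation, injectivity of
  the semiconjugacy, long horseshoes and transitivity; the exponent may depend on the interval and
  on the target cell. \<open>branch\<close> is what puts the eigenvalue above 1.\<close>

locale markov_map =
  fixes a b :: real and f :: "real \<Rightarrow> real" and P :: "real set"
  assumes ab: "a < b" and fin: "finite P" and P_sub: "P \<subseteq> {a..b}" and aP: "a \<in> P" and bP: "b \<in> P"
    and cont: "continuous_on {a..b} f" and maps: "f ` {a..b} \<subseteq> {a..b}" and inv: "f ` P \<subseteq> P"
    and inj: "\<And>x y. a \<le> x \<Longrightarrow> x < y \<Longrightarrow> y \<le> b \<Longrightarrow> adj P x y \<Longrightarrow> inj_on f {x..y}"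
    and covers: "\<And>x y p q. a \<le> x \<Longrightarrow> x < y \<Longrightarrow> y \<le> b \<Longrightarrow> p \<in> P \<Longrightarrow> q \<in> P \<Longrightarrow> p < q \<Longrightarrow> adj P p q
      \<Longrightarrow> \<exists>m. {p..q} \<subseteq> (f ^^ m) ` {x..y}"
    and branch: "\<exists>p\<in>P. \<exists>q\<in>P. p < q \<and> adj P p q \<and> \<not> adj P (f p) (f q)"
begin

definition S where "S = P - {b}"

text \<open>The transition relation of the cells, which are named by their left end points (hence
  \<open>b\<close> is missing from \<open>S\<close>). The bounds are half-open because
  \<open>p'\<close> is the left end of a covered cell.\<close>

definition R where
  "R = {(p, p'). p \<in> S \<and> p' \<in> P \<and> min (f p) (f (nxt P p)) \<le> p' \<and> p' < max (f p) (f (nxt P p))}"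

lemma S_fin: "finite S" and S_ne: "S \<noteq> {}" and S_P: "p \<in> S \<Longrightarrow> p \<in> P" and S_lt: "p \<in> S \<Longrightarrow> p < b"
  using fin aP ab P_sub by (auto simp: S_def less_le)

lemma S_nxt: assumes "p \<in> S" shows "nxt P p \<in> P" "p < nxt P p" "nxt P p \<le> b" "adj P p (nxt P p)" "a \<le> p"
  using nxt_props[OF fin bP S_lt[OF assms]] adj_nxt[OF fin bP S_lt[OF assms]] P_sub S_P[OF assms] by auto

lemma P_bounds: "p \<in> P \<Longrightarrow> a \<le> p" "p \<in> P \<Longrightarrow> p \<le> b" using P_sub by auto

lemma fP: "p \<in> P \<Longrightarrow> f p \<in> P" using inv by auto

lemma f_in: "a \<le> x \<Longrightarrow> x \<le> b \<Longrightarrow> a \<le> f x" "a \<le> x \<Longrightarrow> x \<le> b \<Longrightarrow> f x \<le> b"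
  using maps by (auto simp: image_subset_iff)

lemma between:
  assumes "a \<le> x" "x \<le> z" "z \<le> y" "y \<le> b" "adj P x y"
  shows "f x \<le> f z \<and> f z \<le> f y \<or> f y \<le> f z \<and> f z \<le> f x"
proof (cases "x < z \<and> z < y")
  case True
  then have "continuous_on {x..y} f" "inj_on f {x..y}"
    using assms cont inj by (auto intro: continuous_on_subset)
  then show ?thesis using continuous_inj_imp_mono[of x z y f] True by force
qed (use assms in force)

lemma between_strict:
  assumes "a \<le> x" "x < z" "z < y" "y \<le> b" "adj P x y"
  shows "f x < f z \<and> f z < f y \<or> f y < f z \<and> f z < f x"
proof -
  have "continuous_on {x..y} f" "inj_on f {x..y}"
    using assms cont inj by (auto intro: continuous_on_subset)
  then show ?thesis using continuous_inj_imp_mono[of x z y f] assms by force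
qed

lemma f_neq: "a \<le> x \<Longrightarrow> x < y \<Longrightarrow> y \<le> b \<Longrightarrow> adj P x y \<Longrightarrow> f x \<noteq> f y"
  using inj_onD[OF inj[of x y], of x y] by auto

lemma R_sub: "R \<subseteq> S \<times> S"
proof -
  have "p' < b" if "p \<in> S" "p' < max (f p) (f (nxt P p))" for p p'
    using that P_bounds(2)[OF fP[OF S_P[OF that(1)]]] P_bounds(2)[OF fP[OF S_nxt(1)[OF that(1)]]] by auto
  then show ?thesis by (force simp: R_def S_def)
qed

text \<open>The covered cells fill the interval between the images of the two end points, so the
  increments telescope. This turns every row sum into an increment of one function; it is applied to
  \<open>q0\<close>, to the identity and to a competing conjugacy.\<close>

lemma R_sum:
  fixes h :: "real \<Rightarrow> real"
  assumes "p \<in> S" "mono_on P h"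
  shows "(\<Sum>p'\<in>R``{p}. h (nxt P p') - h p') = \<bar>h (f (nxt P p)) - h (f p)\<bar>"
proof -
  let ?u = "f p" and ?v = "f (nxt P p)"
  have uv: "?u \<in> P" "?v \<in> P" using assms fP S_P S_nxt(1) by auto
  have *: "R``{p} = {p'\<in>P. min ?u ?v \<le> p' \<and> p' < max ?u ?v}" using assms by (auto simp: R_def)
  have "(\<Sum>p'\<in>R``{p}. h (nxt P p') - h p') = h (max ?u ?v) - h (min ?u ?v)"
    unfolding * using uv by (intro sum_nxt_telescope[OF fin]) (auto simp: min_def max_def)
  also have "\<dots> = \<bar>h ?v - h ?u\<bar>"
    using mono_onD[OF assms(2), of ?u ?v] mono_onD[OF assms(2), of ?v ?u] uv by (auto simp: min_def max_def)
  finally show ?thesis .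
qed

lemma power_in: "a \<le> x \<Longrightarrow> x \<le> b \<Longrightarrow> a \<le> (f ^^ m) x \<and> (f ^^ m) x \<le> b"
  by (induction m) (auto simp: f_in)

text \<open>Pull \<open>y\<close> back one step, \<open>y = f x\<close>. As \<open>y\<close> is
  interior to a cell and \<open>P\<close> is invariant, \<open>x\<close> is not in \<open>P\<close>,
  so \<open>x\<close> is interior to a cell \<open>r\<close> whose image contains \<open>y\<close>
  and therefore the whole cell of \<open>p'\<close>. Strict inequalities for \<open>y\<close> are
  essential here.\<close>

lemma reach_step:
  assumes p: "p \<in> S" and y: "y \<in> (f ^^ m) ` {p..nxt P p}" and p': "p' \<in> S" "p' < y" "y < nxt P p'"
  shows "(p, p') \<in> R\<^sup>*"
  using y p'
proof (induction m arbitrary: y p')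
  case 0
  have "p = p'"
  proof (rule linorder_cases[of p p'])
    assume "p < p'"
    then show ?thesis using 0 nxt_props(3)[OF fin S_P[OF 0(2)], of p] by auto
  next
    assume "p' < p"
    then show ?thesis using 0 nxt_props(3)[OF fin S_P[OF p], of p'] by auto
  qed
  then show ?case by simp
next
  case (Suc m)
  then obtain x where x: "x \<in> (f ^^ m) ` {p..nxt P p}" "y = f x" by auto
  have xab: "a \<le> x" "x \<le> b" using x(1) S_nxt[OF p] power_in by force+
  have adj': "z \<notin> P" if "p' < z" "z < nxt P p'" for z
    using S_nxt(4)[OF Suc(3)] that by (auto simp: adj_def)
  have "x \<notin> P" using fP[of x] adj'[of y] Suc x by auto
  then have "x < b" using xab bP by (cases "x = b") auto
  obtain r where r: "r \<in> P" "r \<le> x" "x < nxt P r" "r < b"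
    using exists_left_endpoint[OF fin aP bP xab(1) \<open>x < b\<close>] .
  have rS: "r \<in> S" using r by (auto simp: S_def)
  have "r < x" using r \<open>x \<notin> P\<close> by (cases "r = x") auto
  have 1: "(p, r) \<in> R\<^sup>*" using Suc.IH[OF x(1) rS \<open>r < x\<close> r(3)] .
  have "f r < y \<and> y < f (nxt P r) \<or> f (nxt P r) < y \<and> y < f r"
    using between_strict[of r x "nxt P r"] S_nxt[OF rS] \<open>r < x\<close> r x by auto
  then have "min (f r) (f (nxt P r)) < y" "y < max (f r) (f (nxt P r))" by auto
  moreover have "min (f r) (f (nxt P r)) \<in> P" using fP r S_nxt[OF rS] by (auto simp: min_def)
  ultimately have "min (f r) (f (nxt P r)) \<le> p'" "p' < max (f r) (f (nxt P r))"
    using adj'[of "min (f r) (f (nxt P r))"] Suc.prems by linarith+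
  then have "(r, p') \<in> R" using rS Suc S_P by (auto simp: R_def)
  then show ?case using 1 by simp
qed

lemma irreducible:
  assumes "p \<in> S" "p' \<in> S" shows "(p, p') \<in> R\<^sup>*"
proof -
  obtain m where m: "{p'..nxt P p'} \<subseteq> (f ^^ m) ` {p..nxt P p}"
    using covers[of p "nxt P p" p' "nxt P p'"] S_nxt[OF assms(1)] S_nxt[OF assms(2)] S_P[OF assms(2)] by auto
  obtain y where y: "p' < y" "y < nxt P p'" using dense S_nxt[OF assms(2)] by blast
  then have "y \<in> (f ^^ m) ` {p..nxt P p}" using m by (auto simp: subset_iff)
  then show ?thesis using reach_step[OF assms(1) _ assms(2)] y by blast
qed

definition eigen :: "real \<times> (real \<Rightarrow> real) \<Rightarrow> bool" where
  "eigen = (\<lambda>(\<beta>, w). (\<forall>p\<in>S. 0 < w p) \<and> sum w S = 1 \<and> (\<forall>p\<in>S. (\<Sum>p'\<in>R``{p}. w p') = \<beta> * w p))"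

definition \<beta> where "\<beta> = fst (SOME bw. eigen bw)"
definition w where "w = snd (SOME bw. eigen bw)"

lemma w_pos: "p \<in> S \<Longrightarrow> 0 < w p" and w_sum: "sum w S = 1"
  and w_eig: "p \<in> S \<Longrightarrow> (\<Sum>p'\<in>R``{p}. w p') = \<beta> * w p"
proof -
  have "\<exists>bw. eigen bw"
  proof (rule perron_eigenvector[OF S_fin S_ne R_sub irreducible])
    fix \<beta>' :: real and w' assume "\<And>p. p \<in> S \<Longrightarrow> 0 < w' p" "sum w' S = 1"
      "\<And>p. p \<in> S \<Longrightarrow> (\<Sum>p'\<in>R``{p}. w' p') = \<beta>' * w' p"
    then have "eigen (\<beta>', w')" by (simp add: eigen_def)
    then show ?thesis by blast
  qed
  then have "eigen (SOME bw. eigen bw)" by (rule someI_ex)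
  then show "p \<in> S \<Longrightarrow> 0 < w p" "sum w S = 1" "p \<in> S \<Longrightarrow> (\<Sum>p'\<in>R``{p}. w p') = \<beta> * w p"
    by (auto simp: eigen_def \<beta>_def w_def case_prod_beta)
qed

text \<open>Every cell covers at least one cell, so the constant vector dominates with factor 1. If
  \<open>\<beta>\<close> were at most 1, the comparison would make every row sum equal to 1, against
  the cell from \<open>branch\<close>, which covers two.\<close>

lemma \<beta>_gt_1: "1 < \<beta>"
proof (rule ccontr)
  assume "\<not> 1 < \<beta>"
  have finR: "finite (R``{p})" for p using R_sub by (auto intro: finite_subset[OF _ S_fin])
  have lo: "min (f p) (f (nxt P p)) \<in> R``{p}" if p: "p \<in> S" for p
  proof -
    have "f p \<noteq> f (nxt P p)" using f_neq[of p "nxt P p"] S_nxt[OF p] by auto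
    then show ?thesis using p fP S_P S_nxt[OF p] by (auto simp: R_def min_def max_def)
  qed
  then have ge: "1 * 1 \<le> (\<Sum>y\<in>R``{p}. 1 :: real)" if "p \<in> S" for p
    using that finR[of p] by (simp add: Suc_le_eq card_gt_0_iff) blast
  obtain t where *: "\<And>p. p \<in> S \<Longrightarrow> (\<Sum>y\<in>R``{p}. 1 :: real) = 1 * 1"
    using perron_compare_upper[OF S_fin S_ne R_sub irreducible w_pos _ w_eig, of "\<lambda>_. 1" 1] ge \<open>\<not> 1 < \<beta>\<close>
    by auto
  obtain p q r where pq: "p \<in> P" "q \<in> P" "p < q" "adj P p q" "r \<in> P"
    "f p < r \<and> r < f q \<or> f q < r \<and> r < f p"
    using branch unfolding adj_def by metis
  have p: "p \<in> S" using pq P_bounds(2) by (force simp: S_def)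
  have q: "nxt P p = q" using nxt_eqI[OF fin] pq by auto
  have "r \<in> R``{p}" "r \<noteq> min (f p) (f (nxt P p))" using pq q p by (auto simp: R_def)
  then have "{r, min (f p) (f (nxt P p))} \<subseteq> R``{p}" "card {r, min (f p) (f (nxt P p))} = 2"
    using lo[OF p] by auto
  then have "2 \<le> card (R``{p})" by (metis card_mono finR)
  then show False using *[OF p] by simp
qed

text \<open>Total weight of the cells to the left: on \<open>P\<close> these are the values that the
  conjugacy has to take.\<close>

definition q0 where "q0 x = (\<Sum>p\<in>{p\<in>P. p < x}. w p)"

lemma q0_a: "q0 a = 0"
proof -
  have "{p\<in>P. p < a} = {}" using P_bounds by force
  then show ?thesis unfolding q0_def by (simp only: sum.empty)
qed

lemma q0_b: "q0 b = 1"
proof -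
  have "{p\<in>P. p < b} = S" using P_bounds by (force simp: S_def)
  then show ?thesis using w_sum by (simp add: q0_def)
qed

lemma q0_nxt: assumes "p \<in> S" shows "q0 (nxt P p) = q0 p + w p"
proof -
  have "{r\<in>P. r < nxt P p} = insert p {r\<in>P. r < p}"
    using S_nxt[OF assms] S_P[OF assms] by (force simp: adj_def)
  then show ?thesis using fin by (simp add: q0_def)
qed

lemma q0_mono: "x \<in> {a..b} \<Longrightarrow> y \<in> {a..b} \<Longrightarrow> x \<le> y \<Longrightarrow> q0 x \<le> q0 y"
  unfolding q0_def using fin w_pos by (intro sum_mono2) (auto simp: S_def less_imp_le)

lemma q0_mono_P: "mono_on P q0"
  using q0_mono P_bounds by (intro mono_onI) auto

lemma q0_image: assumes "p \<in> S" shows "\<bar>q0 (f (nxt P p)) - q0 (f p)\<bar> = \<beta> * w p"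
proof -
  have "\<bar>q0 (f (nxt P p)) - q0 (f p)\<bar> = (\<Sum>p'\<in>R``{p}. q0 (nxt P p') - q0 p')"
    using R_sum[OF assms q0_mono_P] by simp
  also have "\<dots> = (\<Sum>p'\<in>R``{p}. w p')" using R_sub by (intro sum.cong) (auto simp: q0_nxt)
  finally show ?thesis using w_eig[OF assms] by simp
qed

definition left where "left x = Max {p\<in>P. p \<le> x}"

lemma left_props: assumes "a \<le> x" "x \<le> b" shows "left x \<in> P" "left x \<le> x" "a \<le> left x"
proof -
  have "left x \<in> {p\<in>P. p \<le> x}" unfolding left_def using fin aP assms by (intro Max_in) auto
  then show "left x \<in> P" "left x \<le> x" "a \<le> left x" using P_bounds by auto
qed

lemma left_ge: "p \<in> P \<Longrightarrow> p \<le> x \<Longrightarrow> p \<le> left x"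
  unfolding left_def using fin by (intro Max_ge) auto

lemma left_P: "p \<in> P \<Longrightarrow> left p = p"
  using left_ge[of p p] left_props(2)[of p] P_bounds by (simp add: antisym)

lemma left_mono: "a \<le> x \<Longrightarrow> x \<le> y \<Longrightarrow> y \<le> b \<Longrightarrow> left x \<le> left y"
  using left_ge[of "left x" y] left_props[of x] by auto

lemma left_adj: "a \<le> x \<Longrightarrow> x \<le> b \<Longrightarrow> adj P (left x) x"
  using left_ge[of _ x] left_props[of x] by (force simp: adj_def)

text \<open>
  \<open>\<phi>\<close> is the fixed point of the operator \<open>T\<close>, which solves the equation
  \<open>\<bar>\<phi> (f x) - \<phi> (f p)\<bar> = \<beta> * (\<phi> x - \<phi> p)\<close>, where \<open>p\<close> is the left end of the cell of \<open>x\<close>.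
\<close>

definition T :: "(real \<Rightarrow> real) \<Rightarrow> real \<Rightarrow> real" where
  "T h x = q0 (left x) + \<bar>h (f x) - q0 (f (left x))\<bar> / \<beta>"

definition admissible :: "(real \<Rightarrow> real) \<Rightarrow> bool" where
  "admissible h \<longleftrightarrow> mono_on {a..b} h \<and> (\<forall>p\<in>P. h p = q0 p)"

lemma T_P: "admissible h \<Longrightarrow> p \<in> P \<Longrightarrow> T h p = q0 p"
  by (simp add: T_def left_P admissible_def fP)

lemma admissible_mono: "admissible h \<Longrightarrow> a \<le> x \<Longrightarrow> x \<le> y \<Longrightarrow> y \<le> b \<Longrightarrow> h x \<le> h y"
  by (auto simp: admissible_def mono_on_def)

lemma left_cell:
  assumes "a \<le> x" "x < b"
  shows "left x \<in> S" "x < nxt P (left x)"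
proof -
  note l = left_props[OF assms(1) less_imp_le[OF assms(2)]]
  show S: "left x \<in> S" using l assms by (auto simp: S_def)
  show "x < nxt P (left x)"
    using left_ge[OF S_nxt(1)[OF S], of x] S_nxt(2)[OF S] by linarith
qed

lemma T_bounds:
  assumes h: "admissible h" and x: "a \<le> x" "x < b"
  shows "q0 (left x) \<le> T h x" "T h x \<le> q0 (nxt P (left x))"
proof -
  note l = left_cell[OF x] left_props[OF x(1) less_imp_le[OF x(2)]]
  note n = S_nxt[OF l(1)]
  show "q0 (left x) \<le> T h x" using \<beta>_gt_1 by (simp add: T_def)
  have fin: "a \<le> f z" "f z \<le> b" if "z \<in> {left x, x, nxt P (left x)}" for z
    using that f_in l n x by auto
  have eq: "h (f (left x)) = q0 (f (left x))" "h (f (nxt P (left x))) = q0 (f (nxt P (left x)))"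
    using h fP l(3) n(1) by (auto simp: admissible_def)
  have "f (left x) \<le> f x \<and> f x \<le> f (nxt P (left x)) \<or> f (nxt P (left x)) \<le> f x \<and> f x \<le> f (left x)"
    using between[of "left x" x "nxt P (left x)"] l n by auto
  then have "\<bar>h (f x) - q0 (f (left x))\<bar> \<le> \<bar>q0 (f (nxt P (left x))) - q0 (f (left x))\<bar>"
  proof
    assume "f (left x) \<le> f x \<and> f x \<le> f (nxt P (left x))"
    then have "h (f (left x)) \<le> h (f x)" "h (f x) \<le> h (f (nxt P (left x)))"
      using fin by (auto intro!: admissible_mono[OF h])
    then show ?thesis using eq by linarith
  next
    assume "f (nxt P (left x)) \<le> f x \<and> f x \<le> f (left x)"
    then have "h (f x) \<le> h (f (left x))" "h (f (nxt P (left x))) \<le> h (f x)"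
      using fin by (auto intro!: admissible_mono[OF h])
    then show ?thesis using eq by linarith
  qed
  then show "T h x \<le> q0 (nxt P (left x))"
    using q0_image[OF l(1)] q0_nxt[OF l(1)] \<beta>_gt_1 by (simp add: T_def divide_simps algebra_simps)
qed

text \<open>Inside a cell \<open>f\<close> is monotone, so \<open>h (f x)\<close> moves away from
  its value at the left end as \<open>x\<close> grows. Between different cells the order follows
  from \<open>T_bounds\<close>.\<close>

lemma T_admissible: assumes h: "admissible h" shows "admissible (T h)"
  unfolding admissible_def
proof (intro conjI ballI mono_onI)
  fix x y assume xy: "x \<in> {a..b}" "y \<in> {a..b}" "x \<le> y"
  show "T h x \<le> T h y"
  proof (cases "left x = left y")
    case True
    have b: "a \<le> left x" "left x \<le> x" "adj P (left x) y" 
      using left_props[of x] left_adj[of y] xy True by auto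
    have "f (left x) \<le> f x \<and> f x \<le> f y \<or> f y \<le> f x \<and> f x \<le> f (left x)"
      using between[of "left x" x y] b xy by auto
    moreover have "h (f (left x)) = q0 (f (left x))" 
      using h fP left_props xy by (auto simp: admissible_def)
    moreover have m: "h u \<le> h v" if "u \<le> v" "u \<in> f ` {left x, x, y}" "v \<in> f ` {left x, x, y}" for u v
      using that b xy by (intro admissible_mono[OF h]) (auto simp: f_in)
    ultimately have "\<bar>h (f x) - q0 (f (left x))\<bar> \<le> \<bar>h (f y) - q0 (f (left x))\<bar>"
      using m[of "f (left x)" "f x"] m[of "f x" "f y"] m[of "f y" "f x"] m[of "f x" "f (left x)"]
      by (smt (verit) image_eqI insertCI)
    then show ?thesis using True \<beta>_gt_1 by (simp add: T_def divide_right_mono)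
  next
    case False
    then have lt: "left x < left y" using left_mono[of x y] xy by auto
    then have "x < b" using left_props[of y] left_ge[of "left y" x] xy by fastforce
    note l = left_cell[OF _ this]
    have "T h x \<le> q0 (nxt P (left x))" using T_bounds(2)[OF h _ \<open>x < b\<close>] xy by auto
    also have "\<dots> \<le> q0 (left y)"
      using nxt_props(3)[OF fin _ lt] left_props[of y] S_nxt[OF l(1)] xy by (intro q0_mono) auto
    also have "\<dots> \<le> T h y" using \<beta>_gt_1 by (simp add: T_def)
    finally show ?thesis .
  qed
qed (rule T_P[OF h])

definition approx where "approx k = (T ^^ k) (\<lambda>x. q0 (left x))"

lemma approx_admissible: "admissible (approx k)"
proof (induction k)
  case 0
  have "admissible (\<lambda>x. q0 (left x))"
    unfolding admissible_def
  proof (intro conjI mono_onI ballI)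
    fix x y assume "x \<in> {a..b}" "y \<in> {a..b}" "x \<le> y"
    then show "q0 (left x) \<le> q0 (left y)"
      using left_mono[of x y] left_props[of x] left_props[of y] by (intro q0_mono) auto
  qed (simp add: left_P)
  then show ?case by (simp add: approx_def)
next
  case (Suc k)
  then show ?case using T_admissible by (simp add: approx_def)
qed

lemma admissible_range: "admissible h \<Longrightarrow> a \<le> x \<Longrightarrow> x \<le> b \<Longrightarrow> 0 \<le> h x \<and> h x \<le> 1"
  using admissible_mono[of h a x] admissible_mono[of h x b] q0_a q0_b aP bP by (auto simp: admissible_def)

text \<open>\<open>T\<close> contracts uniform distances by the factor \<open>1 / \<beta>\<close>,
  because \<open>h\<close> enters it only through one term divided by \<open>\<beta>\<close>. The
  induction starts since admissible functions take values between 0 and 1.\<close>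

lemma approx_diff: "a \<le> x \<Longrightarrow> x \<le> b \<Longrightarrow> \<bar>approx (Suc k) x - approx k x\<bar> \<le> (1 / \<beta>) ^ k"
proof (induction k arbitrary: x)
  case 0
  then show ?case using admissible_range[OF approx_admissible[of 0] 0] admissible_range[OF approx_admissible[of "Suc 0"] 0]
    by auto
next
  case (Suc k)
  have "\<bar>approx (Suc (Suc k)) x - approx (Suc k) x\<bar> \<le> \<bar>approx (Suc k) (f x) - approx k (f x)\<bar> / \<beta>"
  proof -
    have "\<bar>T u x - T v x\<bar> \<le> \<bar>u (f x) - v (f x)\<bar> / \<beta>" for u v
    proof -
      have "\<bar>T u x - T v x\<bar> = \<bar>\<bar>u (f x) - q0 (f (left x))\<bar> - \<bar>v (f x) - q0 (f (left x))\<bar>\<bar> / \<beta>"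
        using \<beta>_gt_1 by (simp add: T_def flip: diff_divide_distrib)
      also have "\<dots> \<le> \<bar>u (f x) - v (f x)\<bar> / \<beta>" using \<beta>_gt_1 by (intro divide_right_mono) auto
      finally show ?thesis .
    qed
    from this[of "approx (Suc k)" "approx k"] show ?thesis by (simp add: approx_def)
  qed
  also have "\<dots> \<le> (1 / \<beta>) ^ k / \<beta>" using Suc f_in \<beta>_gt_1 by (intro divide_right_mono) auto
  finally show ?case by simp
qed

lemma approx_convergent: assumes "a \<le> x" "x \<le> b" shows "convergent (\<lambda>k. approx k x)"
proof -
  have "summable (\<lambda>k. approx (Suc k) x - approx k x)"
  proof (rule summable_comparison_test)
    show "\<exists>N. \<forall>k\<ge>N. norm (approx (Suc k) x - approx k x) \<le> (1 / \<beta>) ^ k"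
      using approx_diff[OF assms] by auto
    show "summable (\<lambda>k. (1 / \<beta>) ^ k)" using \<beta>_gt_1 by (intro summable_geometric) simp
  qed
  then have "convergent (\<lambda>n. \<Sum>k<n. approx (Suc k) x - approx k x)" by (simp add: summable_iff_convergent)
  then have "convergent (\<lambda>n. approx n x - approx 0 x)"
    using sum_lessThan_telescope[of "\<lambda>k. approx k x"] by simp
  then show ?thesis by (simp add: convergent_diff_const_right_iff)
qed

definition \<phi> where "\<phi> x = lim (\<lambda>k. approx k x)"

lemma approx_tendsto: "a \<le> x \<Longrightarrow> x \<le> b \<Longrightarrow> (\<lambda>k. approx k x) \<longlonglongrightarrow> \<phi> x"
  using approx_convergent by (simp add: \<phi>_def convergent_LIMSEQ_iff)

lemma \<phi>_P: assumes "p \<in> P" shows "\<phi> p = q0 p"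
proof -
  have "(\<lambda>k. approx k p) = (\<lambda>k. q0 p)" using approx_admissible assms by (auto simp: admissible_def)
  then show ?thesis by (simp add: \<phi>_def)
qed

lemma \<phi>_admissible: "admissible \<phi>"
  unfolding admissible_def
proof (intro conjI mono_onI ballI)
  fix x y assume "x \<in> {a..b}" "y \<in> {a..b}" "x \<le> y"
  then show "\<phi> x \<le> \<phi> y"
    using admissible_mono[OF approx_admissible] by (intro LIMSEQ_le[OF approx_tendsto approx_tendsto]) auto
qed (rule \<phi>_P)

lemma \<phi>_fixed: assumes "a \<le> x" "x \<le> b" shows "\<phi> x = T \<phi> x"
proof (rule LIMSEQ_unique)
  show "(\<lambda>k. approx (Suc k) x) \<longlonglongrightarrow> \<phi> x" using approx_tendsto[OF assms] by (rule LIMSEQ_Suc)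
  have "(\<lambda>k. q0 (left x) + \<bar>approx k (f x) - q0 (f (left x))\<bar> / \<beta>) \<longlonglongrightarrow> T \<phi> x"
    unfolding T_def using approx_tendsto f_in assms \<beta>_gt_1 by (intro tendsto_intros) auto
  then show "(\<lambda>k. approx (Suc k) x) \<longlonglongrightarrow> T \<phi> x" by (simp add: approx_def T_def)
qed

lemma \<phi>_mono: "a \<le> x \<Longrightarrow> x \<le> y \<Longrightarrow> y \<le> b \<Longrightarrow> \<phi> x \<le> \<phi> y"
  by (rule admissible_mono[OF \<phi>_admissible])

lemma \<phi>_ends: "\<phi> a = 0" "\<phi> b = 1"
  using \<phi>_P aP bP q0_a q0_b by auto

lemma \<phi>_range: "a \<le> x \<Longrightarrow> x \<le> b \<Longrightarrow> 0 \<le> \<phi> x \<and> \<phi> x \<le> 1"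
  by (rule admissible_range[OF \<phi>_admissible])

text \<open>Subtract the fixed point equations at \<open>x\<close> and \<open>y\<close>. Both refer
  to the same left end \<open>p\<close>, and monotonicity of \<open>f\<close> on the cell puts
  \<open>f x\<close> and \<open>f y\<close> on the same side of \<open>f p\<close>, so the absolute
  values subtract.\<close>

lemma scale_less:
  assumes "a \<le> x" "x < y" "y \<le> b" "adj P x y"
  shows "\<bar>\<phi> (f x) - \<phi> (f y)\<bar> = \<beta> * \<bar>\<phi> x - \<phi> y\<bar>"
proof -
  define p where "p = left x"
  have p: "p \<in> S" "x < nxt P p" "p \<le> x" "a \<le> p" "p \<in> P"
    using left_cell[of x] left_props[of x] assms by (auto simp: p_def)
  have y: "y \<le> nxt P p" using assms(4) p S_nxt[OF p(1)] by (force simp: adj_def)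
  \<comment> \<open>\<open>left\<close> jumps at the right end of the cell, where the fixed point
    equation refers to the next cell; there \<open>q0_image\<close>, that is the eigenvector
    equation, takes its place.\<close>
  have eq: "\<phi> z = q0 p + \<bar>\<phi> (f z) - \<phi> (f p)\<bar> / \<beta>" if z: "z = x \<or> z = y" for z
  proof (cases "z = nxt P p")
    case True
    then have "\<phi> z = q0 p + w p" using \<phi>_P S_nxt(1)[OF p(1)] q0_nxt[OF p(1)] by simp
    also have "w p = \<bar>\<phi> (f z) - \<phi> (f p)\<bar> / \<beta>"
      using q0_image[OF p(1)] \<phi>_P fP p(5) S_nxt(1)[OF p(1)] True \<beta>_gt_1 by simp
    finally show ?thesis .
  next
    case False
    then have "z < nxt P p" "p \<le> z" "a \<le> z" "z \<le> b" using z y p assms by auto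
    moreover from this have "left z \<le> p"
      using left_props[of z] S_nxt(4)[OF p(1)] unfolding adj_def by force
    ultimately have "left z = p" using left_ge[OF p(5)] by force
    then show ?thesis using \<phi>_fixed[of z] \<open>a \<le> z\<close> \<open>z \<le> b\<close> \<phi>_P fP p(5) by (simp add: T_def)
  qed
  have "f p \<le> f x \<and> f x \<le> f y \<or> f y \<le> f x \<and> f x \<le> f p"
    using between[of p x y] adj_subinterval[OF S_nxt(4)[OF p(1)], of p y] p y assms by auto
  then have "\<bar>\<phi> (f x) - \<phi> (f y)\<bar> = \<bar>\<bar>\<phi> (f x) - \<phi> (f p)\<bar> - \<bar>\<phi> (f y) - \<phi> (f p)\<bar>\<bar>"
    using \<phi>_mono[of "f p" "f x"] \<phi>_mono[of "f x" "f y"] \<phi>_mono[of "f y" "f x"] \<phi>_mono[of "f x" "f p"]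
      f_in[of x] f_in[of y] f_in[of p] p assms by auto
  also have "\<dots> = \<beta> * \<bar>\<phi> x - \<phi> y\<bar>"
    using eq[of x] eq[of y] \<beta>_gt_1 by (simp flip: diff_divide_distrib)
  finally show ?thesis .
qed

lemma scale:
  assumes "a \<le> x" "x \<le> b" "a \<le> y" "y \<le> b" "adj P x y"
  shows "\<bar>\<phi> (f x) - \<phi> (f y)\<bar> = \<beta> * \<bar>\<phi> x - \<phi> y\<bar>"
  using scale_less[of x y] scale_less[of y x] assms adj_sym[of P x y]
  by (cases x y rule: linorder_cases) (auto simp: abs_minus_commute)

end

section \<open>Iterated refinements of the partition; the semiconjugacy is a homeomorphism\<close>

context markov_map begin

definition level :: "nat \<Rightarrow> real set" where
  "level n = {x\<in>{a..b}. (f ^^ n) x \<in> P}"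

lemma level_mono_Suc: "level n \<subseteq> level (Suc n)"
  by (auto simp: level_def fP)

lemma P_level: "P \<subseteq> level n"
proof (induction n)
  case 0
  then show ?case using P_sub by (auto simp: level_def)
qed (use level_mono_Suc in blast)

lemma level_Suc: "level (Suc n) = {x\<in>{a..b}. f x \<in> level n}"
  by (auto simp: level_def f_in funpow_swap1)

lemma level_finite: "finite (level n)"
proof (induction n)
  case 0
  then show ?case using fin by (auto simp: level_def)
next
  case (Suc n)
  have "level (Suc n) \<subseteq> insert b (\<Union>p\<in>S. {x\<in>{p..nxt P p}. f x \<in> level n})"
  proof
    fix x assume x: "x \<in> level (Suc n)"
    then have "a \<le> x" "x \<le> b" "f x \<in> level n" by (auto simp: level_Suc)
    then show "x \<in> insert b (\<Union>p\<in>S. {x\<in>{p..nxt P p}. f x \<in> level n})"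
      using left_cell[of x] left_props[of x] by (cases "x = b") (auto intro!: bexI[of _ "left x"])
  qed
  moreover have "finite {x\<in>{p..nxt P p}. f x \<in> level n}" if "p \<in> S" for p
  proof -
    have "inj_on f {p..nxt P p}" using inj S_nxt[OF that] by auto
    then have "finite (f -` level n \<inter> {p..nxt P p})" using Suc by (rule finite_vimage_IntI[rotated])
    moreover have "{x\<in>{p..nxt P p}. f x \<in> level n} = f -` level n \<inter> {p..nxt P p}" by auto
    ultimately show ?thesis by simp
  qed
  ultimately show ?case using S_fin by (meson finite.insertI finite_UN_I finite_subset)
qed

text \<open>A point of \<open>level n\<close> strictly between the images would, by the intermediate
  value theorem, have a preimage strictly between \<open>x\<close> and \<open>y\<close>, and that
  preimage lies in \<open>level (Suc n)\<close>.\<close>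

lemma adj_level_Suc:
  assumes adj: "adj (level (Suc n)) x y" and xy: "a \<le> x" "x \<le> b" "a \<le> y" "y \<le> b"
  shows "adj P x y" "adj (level n) (f x) (f y)"
proof -
  show P: "adj P x y" using adj P_level by (rule adj_antimono)
  have *: False if h: "f u < z \<and> z < f v \<or> f v < z \<and> z < f u" "z \<in> level n" "u < v"
    "adj (level (Suc n)) u v" "a \<le> u" "v \<le> b" for u v z
  proof -
    have c: "continuous_on {u..v} f" using cont h by (auto intro: continuous_on_subset)
    obtain t where t: "u \<le> t" "t \<le> v" "f t = z"
      using h IVT'[of f u z v] IVT2'[of f v z u] c by (metis less_imp_le)
    then have "t \<in> level (Suc n)" using h by (auto simp: level_Suc)
    moreover have "u < t" "t < v" using t h by (auto simp: less_le)
    ultimately show False using h(4) by (auto simp: adj_def)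
  qed
  show "adj (level n) (f x) (f y)"
  proof (cases x y rule: linorder_cases)
    case less
    then show ?thesis using *[of x _ y] adj xy unfolding adj_def[of "level n"] by blast
  next
    case greater
    then show ?thesis using *[of y _ x] adj_sym[OF adj] xy unfolding adj_def[of "level n"] by blast
  qed simp
qed

lemma adj_level_scale:
  assumes "adj (level n) x y" "a \<le> x" "x \<le> b" "a \<le> y" "y \<le> b" "k \<le> n"
  shows "\<bar>\<phi> ((f ^^ k) x) - \<phi> ((f ^^ k) y)\<bar> = \<beta> ^ k * \<bar>\<phi> x - \<phi> y\<bar>"
  using assms
proof (induction k arbitrary: n x y)
  case (Suc k)
  then obtain n' where n: "n = Suc n'" by (cases n) auto
  note a = adj_level_Suc[OF Suc(2)[unfolded n] Suc(3-6)]
  have "\<bar>\<phi> ((f ^^ k) (f x)) - \<phi> ((f ^^ k) (f y))\<bar> = \<beta> ^ k * \<bar>\<phi> (f x) - \<phi> (f y)\<bar>"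
    using Suc.IH[OF a(2)] f_in Suc.prems n by auto
  then show ?case using scale[OF Suc(3-6) a(1)] by (simp add: funpow_swap1)
qed simp

lemma adj_level_small:
  assumes "adj (level n) x y" "a \<le> x" "x \<le> b" "a \<le> y" "y \<le> b"
  shows "\<bar>\<phi> x - \<phi> y\<bar> \<le> 1 / \<beta> ^ n"
proof -
  have "\<beta> ^ n * \<bar>\<phi> x - \<phi> y\<bar> \<le> 1"
    using adj_level_scale[OF assms, of n] \<phi>_range[of "(f ^^ n) x"] \<phi>_range[of "(f ^^ n) y"] power_in assms by auto
  then show ?thesis using \<beta>_gt_1 by (simp add: field_simps)
qed

lemma \<beta>_power_small: assumes "0 < (e :: real)" obtains n where "1 / \<beta> ^ n < e"
proof -
  obtain n where "(1 / \<beta>) ^ n < e" using real_arch_pow_inv[OF assms, of "1 / \<beta>"] \<beta>_gt_1 by auto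
  then show ?thesis using that by (simp add: power_divide)
qed

text \<open>The set \<open>level n\<close> is finite, so all points close enough to \<open>x\<close>
  share a cell of the \<open>n\<close>-th refinement with it, and such cells have
  \<open>\<phi>\<close>-length at most \<open>1 / \<beta> ^ n\<close>.\<close>

lemma \<phi>_continuous: "continuous_on {a..b} \<phi>"
  unfolding continuous_on_iff
proof (intro ballI allI impI)
  fix x e :: real assume x: "x \<in> {a..b}" and "0 < e"
  then obtain n where n: "1 / \<beta> ^ n < e" using \<beta>_power_small by blast
  obtain d where d: "d > 0" "\<And>q. q \<in> level n \<Longrightarrow> q \<noteq> x \<Longrightarrow> d \<le> dist x q"
    using finite_set_avoid[OF level_finite] by metis
  have "dist (\<phi> y) (\<phi> x) < e" if y: "y \<in> {a..b}" "dist y x < d" for y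
  proof -
    have "adj (level n) x y" unfolding adj_def using d(2) y(2) by (force simp: dist_real_def)
    then show ?thesis using adj_level_small[of n x y] x y n by (auto simp: dist_real_def abs_minus_commute)
  qed
  then show "\<exists>d>0. \<forall>y\<in>{a..b}. dist y x < d \<longrightarrow> dist (\<phi> y) (\<phi> x) < e" using d(1) by blast
qed

text \<open>On \<open>J\<close> the distance of \<open>\<phi> (f x)\<close> from
  \<open>\<phi> (f p)\<close>, with \<open>p\<close> the left end of the cell, depends only on
  \<open>p\<close>. So \<open>\<phi> (f x)\<close> takes finitely many values, and it is continuous
  on a connected set.\<close>

lemma constant_image:
  assumes J: "connected J" "J \<subseteq> {a..b}" and c: "\<And>x. x \<in> J \<Longrightarrow> \<phi> x = c"
  shows "\<exists>c'. \<forall>x\<in>f ` J. \<phi> x = c'"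
proof -
  have "continuous_on J (\<lambda>x. \<phi> (f x))"
    using J maps by (intro continuous_on_compose2[OF \<phi>_continuous] continuous_on_subset[OF cont]) auto
  moreover have "finite ((\<lambda>x. \<phi> (f x)) ` J)"
  proof (rule finite_subset)
    let ?r = "\<lambda>p. \<beta> * \<bar>c - \<phi> p\<bar>"
    show "finite ((\<lambda>p. \<phi> (f p) + ?r p) ` P \<union> (\<lambda>p. \<phi> (f p) - ?r p) ` P)" using fin by simp
    show "(\<lambda>x. \<phi> (f x)) ` J \<subseteq> (\<lambda>p. \<phi> (f p) + ?r p) ` P \<union> (\<lambda>p. \<phi> (f p) - ?r p) ` P"
    proof (rule image_subsetI)
      fix x assume x: "x \<in> J"
      then have ab: "a \<le> x" "x \<le> b" using J by auto
      note l = left_props[OF ab]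
      have "\<bar>\<phi> (f x) - \<phi> (f (left x))\<bar> = ?r (left x)"
        using scale[of x "left x"] l ab adj_sym[OF left_adj[OF ab]] c[OF x] by simp
      then have "\<phi> (f x) = \<phi> (f (left x)) + ?r (left x) \<or> \<phi> (f x) = \<phi> (f (left x)) - ?r (left x)"
        by linarith
      then show "\<phi> (f x) \<in> (\<lambda>p. \<phi> (f p) + ?r p) ` P \<union> (\<lambda>p. \<phi> (f p) - ?r p) ` P"
        using l(1) by blast
    qed
  qed
  ultimately have "(\<lambda>x. \<phi> (f x)) constant_on J" using J(1) by (intro continuous_finite_range_constant)
  then show ?thesis by (auto simp: constant_on_def)
qed

text \<open>A flat interval of \<open>\<phi>\<close> would have flat images only. By
  \<open>covers\<close> one of these contains a whole cell, over which \<open>\<phi>\<close>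
  increases by the positive weight \<open>w p\<close>.\<close>

lemma \<phi>_strict: assumes "a \<le> x" "x < y" "y \<le> b" shows "\<phi> x < \<phi> y"
proof (rule ccontr)
  assume "\<not> \<phi> x < \<phi> y"
  then have "\<phi> z = \<phi> x" if "z \<in> {x..y}" for z
    using \<phi>_mono[of x z] \<phi>_mono[of z y] assms that by auto
  then have 0: "\<exists>c. \<forall>z\<in>{x..y}. \<phi> z = c" by blast
  have *: "connected ((f ^^ m) ` {x..y}) \<and> (\<exists>c. \<forall>z\<in>(f ^^ m) ` {x..y}. \<phi> z = c)" for m
  proof (induction m)
    case (Suc m)
    let ?J = "(f ^^ m) ` {x..y}"
    have J: "?J \<subseteq> {a..b}" using power_in[of _ m] assms by auto
    have eq: "(f ^^ Suc m) ` {x..y} = f ` ?J" by (simp add: image_comp)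
    obtain c where "\<And>z. z \<in> ?J \<Longrightarrow> \<phi> z = c" using Suc by blast
    then show ?case unfolding eq
      using Suc J constant_image[of ?J c] connected_continuous_image[OF continuous_on_subset[OF cont J]] by blast
  qed (use 0 in auto)
  obtain p where p: "p \<in> S" using S_ne by auto
  obtain m where "{p..nxt P p} \<subseteq> (f ^^ m) ` {x..y}"
    using covers[OF assms S_P[OF p] S_nxt(1,2,4)[OF p]] by auto
  then have "p \<in> (f ^^ m) ` {x..y}" "nxt P p \<in> (f ^^ m) ` {x..y}" using S_nxt(2)[OF p] by auto
  then have "\<phi> p = \<phi> (nxt P p)" using *[of m] by metis
  then show False using \<phi>_P S_P[OF p] S_nxt(1)[OF p] q0_nxt[OF p] w_pos[OF p] by simp
qed

lemma \<phi>_strict_mono: "strict_mono_on {a..b} \<phi>"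
  using \<phi>_strict by (auto intro!: strict_mono_onI)

lemma \<phi>_image: "\<phi> ` {a..b} = {0..1}"
proof
  show "{0..1} \<subseteq> \<phi> ` {a..b}"
    using connected_image_interval[OF \<phi>_continuous, of "{a..b}" 0 1] \<phi>_ends ab by force
qed (use \<phi>_range in auto)

end

section \<open>The constant slope model and its uniqueness\<close>

lemma interval_interior_point:
  fixes J :: "real set"
  assumes J: "is_interval J" "J \<subseteq> {u..v}" and t: "t \<in> J" "t \<noteq> Inf J" "t \<noteq> Sup J"
  obtains y z where "y < t" "t < z" "{y..z} \<subseteq> J"
proof -
  have bdd: "bdd_below J" "bdd_above J" using J(2) by (meson bdd_below_Icc bdd_above_Icc bdd_below_mono bdd_above_mono)+
  have "Inf J < t" "t < Sup J" using t bdd cInf_lower[of t J] cSup_upper[of t J] by auto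
  then obtain y z where "y \<in> J" "y < t" "z \<in> J" "t < z"
    using cInf_lessD[of J t] less_cSupE[of t J] t(1) by (metis empty_iff)
  moreover from this have "{y..z} \<subseteq> J" using J(1) unfolding is_interval_1 by (meson atLeastAtMost_iff subsetI)
  ultimately show ?thesis using that by blast
qed

text \<open>Away from the finitely many ends of affine pieces \<open>g\<close> is differentiable,
  and its derivative is \<open>\<sigma> * \<beta>\<close> by monotonicity. Hence
  \<open>\<sigma> * g x - \<beta> * x\<close> is continuous with zero derivative off a finite
  set.\<close>

lemma constant_slope_monotone:
  assumes g: "constant_slope \<beta> g" and uv: "0 \<le> u" "u \<le> v" "v \<le> 1"
    and \<sigma>: "\<sigma> = 1 \<or> \<sigma> = - 1" and mono: "mono_on {u..v} (\<lambda>x. \<sigma> * g x)"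
  shows "\<sigma> * (g v - g u) = \<beta> * (v - u)"
proof -
  obtain Pa where Pa: "finite Pa" "partition_on {0..1} Pa" "\<And>J. J \<in> Pa \<Longrightarrow> is_interval J"
    "\<And>J. J \<in> Pa \<Longrightarrow> \<exists>c d. \<forall>x\<in>J. g x = c * x + d"
    using g unfolding constant_slope_def piecewise_affine_on_def by blast
  define K where "K = {u, v} \<union> Inf ` Pa \<union> Sup ` Pa"
  let ?h = "\<lambda>x. \<sigma> * g x - \<beta> * x"
  have "?h v = ?h u"
  proof (rule has_derivative_zero_unique_strong_interval[of K u v ?h "?h u" v])
    show "finite K" using Pa(1) by (simp add: K_def)
    have "continuous_on {u..v} g"
      by (rule continuous_on_subset[of "{0..1}"]) (use g uv in \<open>auto simp: constant_slope_def\<close>)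
    then show "continuous_on {u..v} ?h" by (intro continuous_intros)
    show "(?h has_derivative (\<lambda>h. 0)) (at x within {u..v})" if x: "x \<in> {u..v} - K" for x
    proof -
      have "x \<in> {0..1}" using x uv by auto
      then obtain J where J: "J \<in> Pa" "x \<in> J" using Pa(2) unfolding partition_on_def by blast
      have J01: "J \<subseteq> {0..1}" "x \<noteq> Inf J" "x \<noteq> Sup J"
        using partition_onD1[OF Pa(2)] x J by (auto simp: K_def)
      obtain y z where yz: "y < x" "x < z" "{y..z} \<subseteq> J"
        using interval_interior_point[OF Pa(3)[OF J(1)] J01(1) J(2) J01(2,3)] .
      obtain c d where cd: "\<And>s. s \<in> J \<Longrightarrow> g s = c * s + d" using Pa(4)[OF J(1)] by blast
      have D: "(g has_real_derivative c) (at x)"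
      proof (rule has_field_derivative_transform_within_open[of "\<lambda>s. c * s + d"])
        show "((\<lambda>s. c * s + d) has_real_derivative c) (at x)" by (auto intro!: derivative_eq_intros)
        show "open {y<..<z}" "x \<in> {y<..<z}" using yz by auto
        show "c * s + d = g s" if "s \<in> {y<..<z}" for s using cd[of s] that yz by (auto simp: subset_iff)
      qed
      then have "\<bar>c\<bar> = \<beta>" using g \<open>x \<in> {0..1}\<close> has_field_derivative_at_within[OF D]
        unfolding constant_slope_def by blast
      moreover have "0 \<le> \<sigma> * c"
      proof (rule mono_on_imp_deriv_nonneg[OF mono])
        show "((\<lambda>x. \<sigma> * g x) has_real_derivative \<sigma> * c) (at x)" using D by (rule DERIV_cmult)
        show "x \<in> interior {u..v}" using x by (auto simp: K_def interior_atLeastAtMost_real)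
      qed
      ultimately have "\<sigma> * c = \<beta>" using \<sigma> by auto
      then have "(?h has_real_derivative 0) (at x within {u..v})"
        using has_field_derivative_at_within[OF D] by (auto intro!: derivative_eq_intros)
      then show ?thesis by (simp add: has_field_derivative_def lambda_zero)
    qed
  qed (use uv in auto)
  then show ?thesis by (simp add: algebra_simps)
qed

lemma constant_slope_inj:
  assumes g: "constant_slope \<beta> g" and uv: "0 \<le> u" "u \<le> v" "v \<le> 1" and inj: "inj_on g {u..v}"
  shows "\<bar>g v - g u\<bar> = \<beta> * (v - u)"
proof -
  have "continuous_on {u..v} g"
    by (rule continuous_on_subset[of "{0..1}"]) (use g uv in \<open>auto simp: constant_slope_def\<close>)
  then have "strict_mono_on {u..v} g \<or> strict_antimono_on {u..v} g"
    using inj injective_eq_monotone_map[of "{u..v}" g] is_interval_cc by blast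
  then show ?thesis
  proof
    assume m: "strict_mono_on {u..v} g"
    then have m': "mono_on {u..v} g" by (rule strict_mono_on_imp_mono_on)
    then have "1 * (g v - g u) = \<beta> * (v - u)" 
      by (intro constant_slope_monotone[OF g uv]) auto
    moreover have "g u \<le> g v" using m' uv by (auto simp: mono_on_def)
    ultimately show ?thesis by simp
  next
    assume m: "strict_antimono_on {u..v} g"
    have le: "g y \<le> g x" if "x \<in> {u..v}" "y \<in> {u..v}" "x \<le> y" for x y
      using m that by (cases "x = y") (auto simp: monotone_on_def less_le)
    then have "- 1 * (g v - g u) = \<beta> * (v - u)" 
      by (intro constant_slope_monotone[OF g uv]) (auto simp: mono_on_def)
    moreover have "g v \<le> g u" using le uv by auto
    ultimately show ?thesis by simp
  qed
qed

text \<open>A multiple of an isometry cannot fold: the distances of \<open>h s\<close> from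
  \<open>h u\<close> and from \<open>h v\<close> add up to the distance of these two, which fixes
  the position of \<open>h s\<close>.\<close>

lemma expanding_isometry_affine:
  fixes h :: "real \<Rightarrow> real"
  assumes "u < v" "0 \<le> \<beta>"
    and h: "\<And>s t. s \<in> {u..v} \<Longrightarrow> t \<in> {u..v} \<Longrightarrow> \<bar>h s - h t\<bar> = \<beta> * \<bar>s - t\<bar>"
  shows "\<exists>c. \<bar>c\<bar> = \<beta> \<and> (\<forall>s\<in>{u..v}. h s = h u + c * (s - u))"
proof -
  define c where "c = (if h u \<le> h v then \<beta> else - \<beta>)"
  have "h s = h u + c * (s - u)" if s: "s \<in> {u..v}" for s
  proof -
    have 1: "\<bar>h s - h u\<bar> = \<beta> * (s - u)" using h[of s u] s by auto
    have 2: "\<bar>h v - h u\<bar> = \<beta> * (v - u)" using h[of v u] s by auto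
    have 3: "\<bar>h v - h s\<bar> = \<beta> * (v - u) - \<beta> * (s - u)" using h[of v s] s by (auto simp: algebra_simps)
    have 4: "0 \<le> \<beta> * (s - u)" using s assms by auto
    show ?thesis using 1 2 3 4 unfolding c_def by (cases "h u \<le> h v") auto
  qed
  moreover have "\<bar>c\<bar> = \<beta>" using assms(2) by (simp add: c_def)
  ultimately show ?thesis by blast
qed

context markov_map begin

definition \<psi> where "\<psi> = inv_into {a..b} \<phi>"

lemma \<phi>_inj: "inj_on \<phi> {a..b}"
  by (rule strict_mono_on_imp_inj_on[OF \<phi>_strict_mono])

lemma \<psi>_\<phi>: "a \<le> x \<Longrightarrow> x \<le> b \<Longrightarrow> \<psi> (\<phi> x) = x"
  unfolding \<psi>_def by (rule inv_into_f_f[OF \<phi>_inj]) simp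

lemma \<phi>_\<psi>: "0 \<le> t \<Longrightarrow> t \<le> 1 \<Longrightarrow> \<phi> (\<psi> t) = t"
  unfolding \<psi>_def by (rule f_inv_into_f) (simp add: \<phi>_image)

lemma \<psi>_in: "0 \<le> t \<Longrightarrow> t \<le> 1 \<Longrightarrow> a \<le> \<psi> t \<and> \<psi> t \<le> b"
  using inv_into_into[of t \<phi> "{a..b}"] unfolding \<phi>_image \<psi>_def by simp

lemma \<psi>_continuous: "continuous_on {0..1} \<psi>"
proof -
  have "\<forall>x\<in>{a..b}. \<psi> (\<phi> x) = x" by (simp add: \<psi>_\<phi>)
  from continuous_on_inv[OF \<phi>_continuous compact_Icc this] show ?thesis unfolding \<phi>_image .
qed

lemma conjugacy: "homeomorphism {a..b} {0..1} \<phi> \<psi>"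
proof (rule homeomorphismI[OF \<phi>_continuous \<psi>_continuous])
  show "\<phi> ` {a..b} \<subseteq> {0..1}" by (simp add: \<phi>_image)
  show "\<psi> ` {0..1} \<subseteq> {a..b}" by (simp add: image_subset_iff \<psi>_in)
qed (simp_all add: \<psi>_\<phi> \<phi>_\<psi>)

lemma \<phi>_less_iff: "a \<le> x \<Longrightarrow> x \<le> b \<Longrightarrow> a \<le> y \<Longrightarrow> y \<le> b \<Longrightarrow> \<phi> x < \<phi> y \<longleftrightarrow> x < y"
  using \<phi>_strict[of x y] \<phi>_mono[of y x] by linarith

lemma adj_\<phi>: "Q \<subseteq> {a..b} \<Longrightarrow> a \<le> x \<Longrightarrow> x \<le> b \<Longrightarrow> a \<le> y \<Longrightarrow> y \<le> b \<Longrightarrow> adj (\<phi> ` Q) (\<phi> x) (\<phi> y) \<longleftrightarrow> adj Q x y"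
proof -
  assume Q: "Q \<subseteq> {a..b}" and xy: "a \<le> x" "x \<le> b" "a \<le> y" "y \<le> b"
  have "\<phi> x < \<phi> q \<longleftrightarrow> x < q" "\<phi> q < \<phi> x \<longleftrightarrow> q < x" "\<phi> y < \<phi> q \<longleftrightarrow> y < q" "\<phi> q < \<phi> y \<longleftrightarrow> q < y"
    if "q \<in> Q" for q using \<phi>_less_iff xy subsetD[OF Q that] by auto
  then show "adj (\<phi> ` Q) (\<phi> x) (\<phi> y) \<longleftrightarrow> adj Q x y" unfolding adj_def by simp
qed

definition g where "g t = (if t \<in> {0..1} then \<phi> (f (\<psi> t)) else undefined)"

lemma g_\<phi>: "a \<le> x \<Longrightarrow> x \<le> b \<Longrightarrow> g (\<phi> x) = \<phi> (f x)"
  using \<phi>_range[of x] \<psi>_\<phi>[of x] by (simp add: g_def)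

lemma g_scale:
  assumes "0 \<le> s" "s \<le> 1" "0 \<le> t" "t \<le> 1" "adj (\<phi> ` P) s t"
  shows "\<bar>g s - g t\<bar> = \<beta> * \<bar>s - t\<bar>"
proof -
  have eq: "\<phi> (\<psi> s) = s" "\<phi> (\<psi> t) = t" using \<phi>_\<psi> assms by auto
  have i: "a \<le> \<psi> s" "\<psi> s \<le> b" "a \<le> \<psi> t" "\<psi> t \<le> b" using \<psi>_in assms by auto
  have "adj P (\<psi> s) (\<psi> t)" using adj_\<phi>[OF P_sub i] assms(5) unfolding eq by blast
  then have "\<bar>\<phi> (f (\<psi> s)) - \<phi> (f (\<psi> t))\<bar> = \<beta> * \<bar>s - t\<bar>" using scale[OF i] unfolding eq by blast
  then show ?thesis using assms by (simp add: g_def)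
qed

lemma \<phi>P: "finite (\<phi> ` P)" "\<phi> ` P \<subseteq> {0..1}" "0 \<in> \<phi> ` P" "1 \<in> \<phi> ` P"
proof -
  show "finite (\<phi> ` P)" using fin by simp
  show "\<phi> ` P \<subseteq> {0..1}" using P_bounds \<phi>_range by auto
  show "0 \<in> \<phi> ` P" "1 \<in> \<phi> ` P" using \<phi>_ends aP bP by (metis imageI)+
qed

lemma g_affine:
  assumes "0 \<le> u" "u < v" "v \<le> 1" "adj (\<phi> ` P) u v"
  shows "\<exists>c. \<bar>c\<bar> = \<beta> \<and> (\<forall>s\<in>{u..v}. g s = g u + c * (s - u))"
proof -
  have *: "\<bar>g s - g t\<bar> = \<beta> * \<bar>s - t\<bar>" if st: "s \<in> {u..v}" "t \<in> {u..v}" for s t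
  proof (rule g_scale)
    show "adj (\<phi> ` P) s t" using adj_subinterval[OF assms(4)] st by simp
  qed (use st assms(1,3) in simp_all)
  have "0 \<le> \<beta>" using \<beta>_gt_1 by simp
  show ?thesis by (rule expanding_isometry_affine[of u v \<beta> g, OF assms(2) \<open>0 \<le> \<beta>\<close> *])
qed

lemma g_continuous: "continuous_on {0..1} g"
proof -
  have 1: "\<psi> ` {0..1} \<subseteq> {a..b}" by (simp add: image_subset_iff \<psi>_in)
  then have 2: "(\<lambda>t. f (\<psi> t)) ` {0..1} \<subseteq> {a..b}" using maps by (simp add: image_subset_iff)
  have "continuous_on {0..1} (\<lambda>t. f (\<psi> t))" by (rule continuous_on_compose2[OF cont \<psi>_continuous 1])
  from continuous_on_compose2[OF \<phi>_continuous this 2] have "continuous_on {0..1} (\<lambda>t. \<phi> (f (\<psi> t)))" .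
  then show ?thesis by (rule continuous_on_eq) (auto simp: g_def)
qed

lemma g_constant_slope: "constant_slope \<beta> g"
  unfolding constant_slope_def
proof (intro conjI ballI allI impI)
  show "g \<in> {0..1} \<rightarrow>\<^sub>E {0..1}"
    using \<phi>_range f_in \<psi>_in by (auto simp: g_def)
  show "continuous_on {0..1} g" by (rule g_continuous)
  have lt: "p < 1" if "p \<in> \<phi> ` P - {1}" for p using that \<phi>P by (auto simp: less_le)
  let ?Q = "insert {0} ((\<lambda>p. {p<..nxt (\<phi> ` P) p}) ` (\<phi> ` P - {1}))"
  have A: "\<forall>J\<in>?Q. is_interval J \<and> (\<exists>c d. \<forall>x\<in>J. g x = c * x + d)"
  proof (rule ballI, rule conjI)
    fix J assume J: "J \<in> ?Q"
    show "is_interval J" using J by (auto simp: is_interval_1)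
    show "\<exists>c d. \<forall>x\<in>J. g x = c * x + d"
    proof (cases "J = {0}")
      case True
      then show ?thesis by (intro exI[of _ 0] exI[of _ "g 0"]) auto
    next
      case False
      then obtain p where p: "p \<in> \<phi> ` P - {1}" "J = {p<..nxt (\<phi> ` P) p}" using J by auto
      note n = nxt_props[OF \<phi>P(1,4) lt[OF p(1)]] adj_nxt[OF \<phi>P(1,4) lt[OF p(1)]]
      have "0 \<le> p" "nxt (\<phi> ` P) p \<le> 1" using n p(1) \<phi>P(2) by auto
      then obtain c where "\<And>s. s \<in> {p..nxt (\<phi> ` P) p} \<Longrightarrow> g s = g p + c * (s - p)"
        using g_affine[of p "nxt (\<phi> ` P) p"] n by metis
      then show ?thesis using p(2) by (intro exI[of _ c] exI[of _ "g p - c * p"]) (auto simp: algebra_simps)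
    qed
  qed
  have B: "finite ?Q" using \<phi>P by simp
  have C: "partition_on {0..1} ?Q" by (rule partition_half_open) (use \<phi>P in auto)
  show "piecewise_affine_on {0..1} g" unfolding piecewise_affine_on_def
    by (rule exI[of _ ?Q], rule conjI[OF B conjI[OF C A]])
  fix x D assume x: "x \<in> {0..1}" and D: "(g has_real_derivative D) (at x within {0..1})"
  \<comment> \<open>A derivative at \<open>x\<close>, wherever it exists, is also the one-sided
    derivative within a closed cell that contains \<open>x\<close>, so break points need no separate
    treatment. At the right end 1 the cell has to be taken on the left.\<close>
  obtain u v where uv: "0 \<le> u" "u < v" "v \<le> 1" "adj (\<phi> ` P) u v" "x \<in> {u..v}"
  proof (cases "x = 1")
    case True
    define u where "u = Max (\<phi> ` P - {1})"
    have "u \<in> \<phi> ` P - {1}" unfolding u_def using \<phi>P by (intro Max_in) auto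
    moreover have "adj (\<phi> ` P) u 1"
    proof -
      have "\<not> (u < q \<and> q < 1) \<and> \<not> (1 < q \<and> q < u)" if q: "q \<in> \<phi> ` P" for q
      proof (cases "q = 1")
        case False
        then have "q \<le> u" unfolding u_def using q \<phi>P(1) by (intro Max_ge) auto
        moreover have "q \<le> 1" using subsetD[OF \<phi>P(2) q] by simp
        ultimately show ?thesis by linarith
      qed simp
      then show ?thesis unfolding adj_def by (rule ballI)
    qed
    moreover from calculation have "0 \<le> u" "u < 1" using \<phi>P(2) lt[of u] by auto
    ultimately show ?thesis using that[of u 1] True by simp
  next
    case False
    then have "x < 1" using x by auto
    have "0 \<le> x" using x by simp
    obtain p where p: "p \<in> \<phi> ` P" "p \<le> x" "x < nxt (\<phi> ` P) p" "p < 1"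
      using exists_left_endpoint[OF \<phi>P(1,3,4) \<open>0 \<le> x\<close> \<open>x < 1\<close>] .
    note n = nxt_props[OF \<phi>P(1,4) p(4)] adj_nxt[OF \<phi>P(1,4) p(4)]
    have "0 \<le> p" "nxt (\<phi> ` P) p \<le> 1" using p(1) n \<phi>P(2) by auto
    then show ?thesis using that[of p "nxt (\<phi> ` P) p"] p n by simp
  qed
  obtain c where c: "\<bar>c\<bar> = \<beta>" "\<And>s. s \<in> {u..v} \<Longrightarrow> g s = g u + c * (s - u)"
    using g_affine[OF uv(1-4)] by blast
  have 1: "(g has_real_derivative D) (at x within {u..v})"
    by (rule has_field_derivative_subset[OF D]) (use uv in auto)
  have 2: "(g has_real_derivative c) (at x within {u..v})"
  proof (rule has_field_derivative_transform_within[of "\<lambda>s. g u + c * (s - u)" _ _ _ 1])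
    show "((\<lambda>s. g u + c * (s - u)) has_real_derivative c) (at x within {u..v})"
      by (auto intro!: derivative_eq_intros)
    show "g u + c * (s - u) = g s" if "s \<in> {u..v}" "dist s x < 1" for s
      using c(2)[OF that(1)] by (rule sym)
  qed (use uv(5) in simp_all)
  have "D = c"
  proof (rule vector_derivative_unique_within_closed_interval[of u v x g D c])
    show "(g has_vector_derivative D) (at x within cbox u v)" "(g has_vector_derivative c) (at x within cbox u v)"
      using 1 2 unfolding has_real_derivative_iff_has_vector_derivative cbox_interval .
  qed (use uv in simp_all)
  then show "\<bar>D\<bar> = \<beta>" using c by simp
qed

lemma g_conjugate: "increasingly_conjugate {a..b} f {0..1} g"
  unfolding increasingly_conjugate_def
proof (rule exI[of _ \<phi>], rule exI[of _ \<psi>], intro conjI ballI)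
  show "\<phi> (f x) = g (\<phi> x)" if "x \<in> {a..b}" for x using g_\<phi>[of x] that by simp
qed (rule conjugacy \<phi>_strict_mono)+

text \<open>Another increasing conjugacy \<open>\<theta>\<close> to slope \<open>\<beta>\<close>
  multiplies lengths in cells by \<open>\<beta>\<close>, so its cell lengths are a positive
  eigenvector; uniqueness and total length 1 determine \<open>\<theta>\<close> on \<open>P\<close>.
  Then \<open>\<theta>\<close> also solves the fixed point equation of \<open>T\<close>, and
  contraction forces \<open>\<theta> = \<phi>\<close>.\<close>

lemma g_unique:
  assumes g': "constant_slope \<beta> g'" and conj: "increasingly_conjugate {a..b} f {0..1} g'"
  shows "g' = g"
proof -
  obtain \<theta> \<xi> where hom: "homeomorphism {a..b} {0..1} \<theta> \<xi>" and sm: "strict_mono_on {a..b} \<theta>"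
    and eq: "\<And>x. a \<le> x \<Longrightarrow> x \<le> b \<Longrightarrow> \<theta> (f x) = g' (\<theta> x)"
    using conj unfolding increasingly_conjugate_def by auto
  have lt: "\<theta> x < \<theta> y" if "a \<le> x" "x < y" "y \<le> b" for x y
    using strict_mono_onD[OF sm, of x y] that by auto
  have le: "\<theta> x \<le> \<theta> y" if "a \<le> x" "x \<le> y" "y \<le> b" for x y
    using lt[of x y] that by (cases "x = y") auto
  have im: "\<theta> ` {a..b} = {0..1}" and \<theta>\<xi>: "\<And>t. t \<in> {0..1} \<Longrightarrow> \<theta> (\<xi> t) = t"
    and \<xi>in: "\<And>t. t \<in> {0..1} \<Longrightarrow> \<xi> t \<in> {a..b}" using hom unfolding homeomorphism_def by auto
  have rng: "0 \<le> \<theta> x \<and> \<theta> x \<le> 1" if "a \<le> x" "x \<le> b" for x using im that by auto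
  have ends: "\<theta> a = 0" "\<theta> b = 1"
  proof -
    have "\<theta> a \<le> \<theta> (\<xi> 0)" "\<theta> (\<xi> 1) \<le> \<theta> b" using \<xi>in[of 0] \<xi>in[of 1] by (auto intro!: le)
    then show "\<theta> a = 0" "\<theta> b = 1" using rng[of a] rng[of b] ab \<theta>\<xi> by auto
  qed
  have sc: "\<bar>\<theta> (f y) - \<theta> (f x)\<bar> = \<beta> * (\<theta> y - \<theta> x)" if xy: "a \<le> x" "x < y" "y \<le> b" "adj P x y" for x y
  proof -
    have "inj_on g' {\<theta> x..\<theta> y}"
    proof (rule inj_onI)
      fix s t assume st: "s \<in> {\<theta> x..\<theta> y}" "t \<in> {\<theta> x..\<theta> y}" "g' s = g' t"
      have *: "\<xi> r \<in> {x..y} \<and> \<theta> (\<xi> r) = r" if "r \<in> {\<theta> x..\<theta> y}" for r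
      proof -
        have "r \<in> {0..1}" using that rng[of x] rng[of y] xy by auto
        then show ?thesis using \<theta>\<xi> \<xi>in[of r] that lt[of "\<xi> r" x] lt[of y "\<xi> r"] xy by force
      qed
      have "\<theta> (f (\<xi> s)) = \<theta> (f (\<xi> t))" using eq[of "\<xi> s"] eq[of "\<xi> t"] *[of s] *[of t] st xy by auto
      moreover have "f (\<xi> s) \<in> {a..b}" "f (\<xi> t) \<in> {a..b}" using f_in *[of s] *[of t] st xy by auto
      ultimately have "f (\<xi> s) = f (\<xi> t)" by (rule inj_onD[OF strict_mono_on_imp_inj_on[OF sm]])
      then have "\<xi> s = \<xi> t" by (rule inj_onD[OF inj[OF xy]]) (use *[of s] *[of t] st in auto)
      then have "\<theta> (\<xi> s) = \<theta> (\<xi> t)" by simp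
      moreover have "\<theta> (\<xi> s) = s" "\<theta> (\<xi> t) = t" using *[of s] *[of t] st by auto
      ultimately show "s = t" by metis
    qed
    then have "\<bar>g' (\<theta> y) - g' (\<theta> x)\<bar> = \<beta> * (\<theta> y - \<theta> x)"
      using constant_slope_inj[OF g', of "\<theta> x" "\<theta> y"] rng[of x] rng[of y] le[of x y] xy by auto
    then show ?thesis using eq xy by auto
  qed
  define w' where "w' p = \<theta> (nxt P p) - \<theta> p" for p
  have \<theta>P: "mono_on P \<theta>" using le P_bounds by (auto intro!: mono_onI)
  have w': "0 < w' p" if "p \<in> S" for p unfolding w'_def using lt S_nxt[OF that] by simp
  have ev: "(\<Sum>p'\<in>R``{p}. w' p') = \<beta> * w' p" if "p \<in> S" for p
    unfolding w'_def using R_sum[OF that \<theta>P] sc[of p "nxt P p"] S_nxt[OF that] by simp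
  obtain t where t: "\<And>p. p \<in> S \<Longrightarrow> w p = t * w' p"
  proof -
    have "\<exists>t>0. \<forall>p\<in>S. w p = t * w' p \<and> (\<Sum>y\<in>R``{p}. w' y) = \<beta> * w' p"
      by (rule perron_compare_upper[OF S_fin S_ne R_sub irreducible w_pos w' w_eig]) (use ev \<beta>_gt_1 in auto)
    then show ?thesis using that by blast
  qed
  have tel: "(\<Sum>p\<in>{p\<in>P. p < x}. w' p) = \<theta> x" if "x \<in> P" for x
  proof -
    have "{p\<in>P. a \<le> p \<and> p < x} = {p\<in>P. p < x}" using P_bounds by auto
    then show ?thesis using sum_nxt_telescope[OF fin aP that, of \<theta>] P_bounds that ends by (simp add: w'_def)
  qed
  have q0\<theta>: "q0 x = t * \<theta> x" if "x \<in> P" for x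
  proof -
    have "q0 x = (\<Sum>p\<in>{p\<in>P. p < x}. t * w' p)" unfolding q0_def
      using that P_bounds(2) by (intro sum.cong) (force simp: S_def intro!: t)+
    then show ?thesis using tel[OF that] by (simp flip: sum_distrib_left)
  qed
  have "t = 1" using q0\<theta>[OF bP] q0_b ends by simp
  then have q0\<theta>: "\<theta> x = q0 x" if "x \<in> P" for x using q0\<theta>[OF that] by simp
  have fixed: "\<theta> x = T \<theta> x" if x: "a \<le> x" "x \<le> b" for x
  proof -
    note l = left_props[OF x]
    have "\<bar>\<theta> (f x) - \<theta> (f (left x))\<bar> = \<beta> * (\<theta> x - \<theta> (left x))"
      using sc[of "left x" x] left_adj[OF x] l x by (cases "left x = x") auto
    then show ?thesis using q0\<theta>[OF l(1)] q0\<theta>[OF fP[OF l(1)]] \<beta>_gt_1 by (simp add: T_def)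
  qed
  have bound: "\<bar>\<theta> x - \<phi> x\<bar> \<le> 1 / \<beta> ^ n" if "a \<le> x" "x \<le> b" for x n
    using that
  proof (induction n arbitrary: x)
    case 0
    then show ?case using rng[of x] \<phi>_range[of x] by auto
  next
    case (Suc n)
    have "\<bar>\<theta> x - \<phi> x\<bar> = \<bar>\<bar>\<theta> (f x) - q0 (f (left x))\<bar> - \<bar>\<phi> (f x) - q0 (f (left x))\<bar>\<bar> / \<beta>"
      using fixed[OF Suc(2,3)] \<phi>_fixed[OF Suc(2,3)] \<beta>_gt_1 by (simp add: T_def flip: diff_divide_distrib)
    also have "\<dots> \<le> \<bar>\<theta> (f x) - \<phi> (f x)\<bar> / \<beta>" using \<beta>_gt_1 by (intro divide_right_mono) auto
    also have "\<dots> \<le> (1 / \<beta> ^ n) / \<beta>" using Suc f_in \<beta>_gt_1 by (intro divide_right_mono) auto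
    finally show ?case by (simp add: mult.commute)
  qed
  have \<theta>\<phi>: "\<theta> x = \<phi> x" if "a \<le> x" "x \<le> b" for x
  proof (rule ccontr)
    assume "\<theta> x \<noteq> \<phi> x"
    then obtain n where "1 / \<beta> ^ n < \<bar>\<theta> x - \<phi> x\<bar>" using \<beta>_power_small[of "\<bar>\<theta> x - \<phi> x\<bar>"] by auto
    then show False using bound[OF that, of n] by simp
  qed
  show ?thesis
  proof
    fix t show "g' t = g t"
    proof (cases "t \<in> {0..1}")
      case True
      then have "g' (\<phi> (\<psi> t)) = \<phi> (f (\<psi> t))" using eq[of "\<psi> t"] \<psi>_in[of t] \<theta>\<phi> f_in by auto
      then show ?thesis using True \<phi>_\<psi> by (simp add: g_def)
    next
      case False
      then show ?thesis using g' unfolding constant_slope_def g_def by (metis PiE_arb)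
    qed
  qed
qed

end

section \<open>Topological entropy\<close>

text \<open>Rounding down to multiples of \<open>d\<close> is injective on a set with gaps at least
  \<open>d\<close>.\<close>

lemma card_le_gap:
  fixes A :: "real set"
  assumes fin: "finite A" and A: "A \<subseteq> {0..1}" and d: "0 < d"
    and gap: "\<And>x y. x \<in> A \<Longrightarrow> y \<in> A \<Longrightarrow> x < y \<Longrightarrow> d \<le> y - x"
  shows "real (card A) \<le> 1 / d + 1"
proof -
  have "inj_on (\<lambda>x. nat \<lfloor>x / d\<rfloor>) A"
  proof (rule linorder_inj_onI)
    fix x y assume xy: "x < y" "x \<in> A" "y \<in> A"
    have "x / d + d / d \<le> y / d" unfolding add_divide_distrib[symmetric]
      using gap[OF xy(2,3,1)] d by (intro divide_right_mono) auto
    then have "x / d + 1 \<le> y / d" using d by simp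
    then have "\<lfloor>x / d\<rfloor> < \<lfloor>y / d\<rfloor>" by linarith
    moreover have "0 \<le> \<lfloor>x / d\<rfloor>" using A xy d by auto
    ultimately show "nat \<lfloor>x / d\<rfloor> \<noteq> nat \<lfloor>y / d\<rfloor>" by linarith
  qed auto
  moreover have "(\<lambda>x. nat \<lfloor>x / d\<rfloor>) ` A \<subseteq> {..nat \<lfloor>1 / d\<rfloor>}"
  proof (rule image_subsetI)
    fix x assume "x \<in> A"
    then have "x / d \<le> 1 / d" using A d by (intro divide_right_mono) auto
    then show "nat \<lfloor>x / d\<rfloor> \<in> {..nat \<lfloor>1 / d\<rfloor>}" by (simp add: nat_mono floor_mono)
  qed
  ultimately have "card A \<le> card {..nat \<lfloor>1 / d\<rfloor>}" by (intro card_inj_on_le) auto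
  then have "real (card A) \<le> real (nat \<lfloor>1 / d\<rfloor>) + 1" by simp
  moreover have "real (nat \<lfloor>1 / d\<rfloor>) \<le> 1 / d" using d by simp
  ultimately show ?thesis by linarith
qed

text \<open>Every itinerary is realised, built from its last symbol backwards: the point that
  follows the tail lies in the set of its first symbol and has a preimage under
  \<open>h ^^ m\<close> in \<open>K i\<close>.\<close>

lemma horseshoe_orbits:
  fixes h :: "'a \<Rightarrow> 'a"
  assumes ne: "\<And>i. i \<in> A \<Longrightarrow> K i \<noteq> {}"
    and cov: "\<And>i j. i \<in> A \<Longrightarrow> j \<in> A \<Longrightarrow> K j \<subseteq> (h ^^ m) ` K i"
  shows "ws \<noteq> [] \<Longrightarrow> set ws \<subseteq> A \<Longrightarrow> \<exists>x\<in>K (hd ws). \<forall>j<length ws. (h ^^ (m * j)) x \<in> K (ws ! j)"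
proof (induction ws)
  case (Cons i ws)
  show ?case
  proof (cases "ws = []")
    case True
    then show ?thesis using ne[of i] Cons by auto
  next
    case False
    then obtain y where y: "y \<in> K (hd ws)" "\<And>j. j < length ws \<Longrightarrow> (h ^^ (m * j)) y \<in> K (ws ! j)"
      using Cons by auto
    have "hd ws \<in> A" using False Cons(3) by (cases ws) auto
    then obtain x where x: "x \<in> K i" "y = (h ^^ m) x" using cov[of i "hd ws"] y(1) Cons(3) by auto
    have "(h ^^ (m * j)) x \<in> K ((i # ws) ! j)" if "j < length (i # ws)" for j
    proof (cases j)
      case (Suc k)
      have "(h ^^ (m * k + m)) x = (h ^^ (m * k)) y" by (simp add: x(2) funpow_add)
      then have "(h ^^ (m * j)) x = (h ^^ (m * k)) y" using Suc by (simp add: add.commute)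
      then show ?thesis using y(2)[of k] Suc that by simp
    qed (use x in simp)
    then show ?thesis using x by auto
  qed
qed simp

text \<open>Different itineraries of length \<open>n\<close> are separated at a time that is a
  multiple of \<open>m\<close>, which gives \<open>card A ^ n\<close> separated points for
  \<open>m * n\<close> steps.\<close>

lemma horseshoe_entropy:
  fixes h :: "'a::metric_space \<Rightarrow> 'a"
  assumes A: "finite A" "A \<noteq> {}" and m: "0 < m" and KX: "\<And>i. i \<in> A \<Longrightarrow> K i \<subseteq> X"
    and ne: "\<And>i. i \<in> A \<Longrightarrow> K i \<noteq> {}"
    and cov: "\<And>i j. i \<in> A \<Longrightarrow> j \<in> A \<Longrightarrow> K j \<subseteq> (h ^^ m) ` K i"
    and \<epsilon>: "0 < \<epsilon>" and sep: "\<And>i j x y. i \<in> A \<Longrightarrow> j \<in> A \<Longrightarrow> i \<noteq> j \<Longrightarrow> x \<in> K i \<Longrightarrow> y \<in> K j \<Longrightarrow> \<epsilon> < dist x y"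
  shows "ereal (ln (real (card A)) / real m) \<le> topological_entropy X h"
proof -
  have large: "ereal (real n * ln (real (card A))) \<le> log_separation X h (m * n) \<epsilon>" if n: "0 < n" for n
  proof -
    define W where "W = {ws. set ws \<subseteq> A \<and> length ws = n}"
    have "\<forall>ws\<in>W. \<exists>x. x \<in> X \<and> (\<forall>j<n. (h ^^ (m * j)) x \<in> K (ws ! j))"
    proof
      fix ws assume ws: "ws \<in> W"
      then have "ws \<noteq> []" "set ws \<subseteq> A" "length ws = n" using n by (auto simp: W_def)
      moreover from this have "hd ws \<in> A" by (cases ws) auto
      ultimately show "\<exists>x. x \<in> X \<and> (\<forall>j<n. (h ^^ (m * j)) x \<in> K (ws ! j))"
        using horseshoe_orbits[of A K m h ws, OF ne cov] KX by blast
    qed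
    then obtain x where x: "\<And>ws. ws \<in> W \<Longrightarrow> x ws \<in> X"
      "\<And>ws j. ws \<in> W \<Longrightarrow> j < n \<Longrightarrow> (h ^^ (m * j)) (x ws) \<in> K (ws ! j)" by metis
    have differ: "\<exists>j<n. \<epsilon> < dist ((h ^^ (m * j)) (x u)) ((h ^^ (m * j)) (x v))"
      if uv: "u \<in> W" "v \<in> W" "u \<noteq> v" for u v
    proof -
      obtain j where j: "j < n" "u ! j \<noteq> v ! j" using uv by (auto simp: W_def list_eq_iff_nth_eq)
      then have "u ! j \<in> A" "v ! j \<in> A" using uv by (auto simp: W_def)
      then show ?thesis using sep[OF _ _ j(2) x(2)[OF uv(1) j(1)] x(2)[OF uv(2) j(1)]] j by blast
    qed
    have inj: "inj_on x W"
    proof (rule inj_onI, rule ccontr)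
      fix u v assume "u \<in> W" "v \<in> W" "x u = x v" "u \<noteq> v"
      then show False using differ[of u v] \<epsilon> by auto
    qed
    have "card W = card A ^ n" unfolding W_def using card_lists_length_eq[OF A(1)] by simp
    then have c: "card (x ` W) = card A ^ n" using card_image[OF inj] by simp
    have "separated h (m * n) \<epsilon> (x ` W)"
      unfolding separated_def
    proof (intro ballI impI)
      fix s t assume "s \<in> x ` W" "t \<in> x ` W" "s \<noteq> t"
      then obtain u v where "u \<in> W" "v \<in> W" "s = x u" "t = x v" "u \<noteq> v" by auto
      then obtain j where "j < n" "\<epsilon> < dist ((h ^^ (m * j)) s) ((h ^^ (m * j)) t)" using differ by blast
      then show "\<exists>k<m * n. \<epsilon> < dist ((h ^^ k) s) ((h ^^ k) t)" using m by (intro exI[of _ "m * j"]) simp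
    qed
    moreover have "finite W" unfolding W_def using finite_lists_length_eq[OF A(1)] by simp
    moreover have "W \<noteq> {}" using \<open>card W = card A ^ n\<close> A by (metis card.empty card_0_eq power_not_zero)
    moreover have "ln (real (card (x ` W))) = real n * ln (real (card A))"
      using A by (simp add: c ln_realpow card_gt_0_iff)
    ultimately show ?thesis unfolding log_separation_def using x(1) by (intro SUP_upper2[of "x ` W"]) auto
  qed
  define L where "L = (\<lambda>n. log_separation X h n \<epsilon> / ereal (real n))"
  \<comment> \<open>For a lower bound on a limit superior the multiples of \<open>m\<close> suffice;
    \<open>Suc\<close> keeps the divisor positive.\<close>
  define r where "r = (\<lambda>n :: nat. m * Suc n)"
  have "ereal (ln (real (card A)) / real m) \<le> (L \<circ> r) n" for n
  proof -
    have "ereal (ln (real (card A)) / real m) = ereal (real (Suc n) * ln (real (card A))) / ereal (real (m * Suc n))"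
      using nonzero_mult_divide_mult_cancel_left[of "real (Suc n)" "ln (real (card A))" "real m"]
      using m by (simp only: of_nat_mult mult.commute[of "real m"] ereal_divide) simp
    also have "\<dots> \<le> (L \<circ> r) n" unfolding L_def r_def comp_def using m
      by (intro ereal_divide_right_mono large) (simp_all del: of_nat_mult of_nat_Suc)
    finally show ?thesis .
  qed
  then have "ereal (ln (real (card A)) / real m) \<le> limsup (L \<circ> r)" by (intro le_Limsup) auto
  also have "\<dots> \<le> limsup L" by (rule limsup_subseq_mono) (use m in \<open>auto simp: strict_mono_def r_def\<close>)
  also have "\<dots> \<le> topological_entropy X h" unfolding topological_entropy_def L_def
    using \<epsilon> by (intro SUP_upper) auto
  finally show ?thesis .
qed

context markov_map begin

definition \<mu> where "\<mu> = Min (w ` S)"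

lemma \<mu>_pos: "0 < \<mu>"
  unfolding \<mu>_def using S_fin S_ne w_pos by (subst Min_gr_iff) auto

text \<open>Apply \<open>f\<close> to two neighbouring points: their images are distinct points of
  the previous level, and going back divides the \<open>\<phi>\<close>-distance by
  \<open>\<beta>\<close> exactly. At level 0 the gap is the smallest cell weight.\<close>

lemma level_gap:
  assumes "x \<in> level n" "y \<in> level n" "x < y"
  shows "\<mu> / \<beta> ^ n \<le> \<phi> y - \<phi> x"
  using assms
proof (induction n arbitrary: x y)
  case 0
  then have xy: "x \<in> P" "y \<in> P" by (auto simp: level_def)
  then have x: "x \<in> S" using 0 P_bounds(2)[of y] by (auto simp: S_def)
  have "\<mu> \<le> w x" unfolding \<mu>_def using S_fin x by (intro Min_le) auto
  also have "\<dots> = \<phi> (nxt P x) - \<phi> x" using q0_nxt[OF x] \<phi>_P xy(1) S_nxt(1)[OF x] by simp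
  also have "\<dots> \<le> \<phi> y - \<phi> x"
    using \<phi>_mono[of "nxt P x" y] nxt_props(3)[OF fin xy(2) 0(3)] S_nxt[OF x] P_bounds[OF xy(2)] by simp
  finally show ?case by simp
next
  case (Suc n)
  \<comment> \<open>Stopping at the first point of \<open>P\<close> after \<open>x\<close> keeps the
    pair in one cell, where \<open>f\<close> is injective; points of \<open>P\<close> belong to
    every level, so the induction still applies to the shortened pair.\<close>
  define z where "z = Min (insert y {q\<in>P. x < q})"
  have "z \<in> insert y {q\<in>P. x < q}" unfolding z_def using fin by (intro Min_in) auto
  moreover have zle: "z \<le> q" if "q \<in> insert y {q\<in>P. x < q}" for q
    unfolding z_def using fin that by (intro Min_le) auto
  ultimately have z: "x < z" "z \<le> y" "z \<in> level (Suc n)" using P_level Suc.prems by auto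
  have adj: "adj P x z" unfolding adj_def using zle z by force
  have ab: "a \<le> x" "y \<le> b" using Suc.prems by (auto simp: level_def)
  have lev: "f x \<in> level n" "f z \<in> level n" using Suc.prems z by (auto simp: level_Suc)
  have "f x \<noteq> f z" using f_neq[OF ab(1) z(1) _ adj] z ab by auto
  then have "\<mu> / \<beta> ^ n \<le> \<bar>\<phi> (f z) - \<phi> (f x)\<bar>"
    using Suc.IH[OF lev] Suc.IH[OF lev(2,1)] by (cases "f x < f z") auto
  also have "\<dots> = \<beta> * (\<phi> z - \<phi> x)"
    using scale[of z x] adj_sym[OF adj] z ab \<phi>_strict[of x z] by auto
  finally have "\<mu> / \<beta> ^ Suc n \<le> \<phi> z - \<phi> x" using \<beta>_gt_1 by (simp add: field_simps)
  also have "\<dots> \<le> \<phi> y - \<phi> x" using \<phi>_mono[of z y] z ab by simp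
  finally show ?case .
qed

lemma level_card: "real (card (level n)) \<le> \<beta> ^ n / \<mu> + 1"
proof -
  have sub: "level n \<subseteq> {a..b}" by (auto simp: level_def)
  have "real (card (\<phi> ` level n)) \<le> 1 / (\<mu> / \<beta> ^ n) + 1"
  proof (rule card_le_gap)
    show "\<phi> ` level n \<subseteq> {0..1}" using sub \<phi>_image by blast
    show "0 < \<mu> / \<beta> ^ n" using \<mu>_pos \<beta>_gt_1 by simp
    fix s t assume "s \<in> \<phi> ` level n" "t \<in> \<phi> ` level n" "s < t"
    then obtain x y where xy: "s = \<phi> x" "t = \<phi> y" "x \<in> level n" "y \<in> level n" "\<phi> x < \<phi> y" by auto
    moreover from this have "a \<le> x" "x \<le> b" "a \<le> y" "y \<le> b" using sub by auto
    ultimately have "x < y" using \<phi>_less_iff[of x y] by auto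
    then show "\<mu> / \<beta> ^ n \<le> t - s" using level_gap xy by simp
  qed (use level_finite in simp)
  then show ?thesis using card_image[OF inj_on_subset[OF \<phi>_inj sub]] by simp
qed

text \<open>Two points in one cell of the refinement \<open>n + m\<close> stay within
  \<open>\<phi>\<close>-distance \<open>1 / \<beta> ^ m\<close> during the first \<open>n\<close>
  steps, so a separated set has at most one point per cell.\<close>

lemma separated_card:
  assumes m: "\<And>x y. a \<le> x \<Longrightarrow> x \<le> b \<Longrightarrow> a \<le> y \<Longrightarrow> y \<le> b \<Longrightarrow> \<bar>\<phi> x - \<phi> y\<bar> \<le> 1 / \<beta> ^ m \<Longrightarrow> dist x y \<le> \<epsilon>"
    and E: "E \<subseteq> {a..b}" "separated f n \<epsilon> E"
  shows "card E \<le> card (level (n + m))"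
proof -
  let ?l = "\<lambda>x. Max {q\<in>level (n + m). q \<le> x}"
  have aL: "a \<in> level (n + m)" using P_level aP by auto
  have l: "?l x \<in> level (n + m)" "?l x \<le> x" "\<And>q. q \<in> level (n + m) \<Longrightarrow> q \<le> x \<Longrightarrow> q \<le> ?l x" if "x \<in> {a..b}" for x
  proof -
    have "?l x \<in> {q\<in>level (n + m). q \<le> x}" using level_finite aL that by (intro Max_in) auto
    then show "?l x \<in> level (n + m)" "?l x \<le> x" by auto
    show "q \<le> ?l x" if "q \<in> level (n + m)" "q \<le> x" for q
      using level_finite that by (intro Max_ge) auto
  qed
  have "inj_on ?l E"
  proof (rule inj_onI, rule ccontr)
    fix x y assume xy: "x \<in> E" "y \<in> E" "?l x = ?l y" "x \<noteq> y"
    then have ab: "x \<in> {a..b}" "y \<in> {a..b}" using E by auto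
    have ab': "a \<le> x" "x \<le> b" "a \<le> y" "y \<le> b" using ab by auto
    have "\<not> (x < q \<and> q < y) \<and> \<not> (y < q \<and> q < x)" if "q \<in> level (n + m)" for q
      using l(2)[OF ab(1)] l(2)[OF ab(2)] l(3)[OF ab(1) that] l(3)[OF ab(2) that] xy(3) by linarith
    then have adj: "adj (level (n + m)) x y" by (simp add: adj_def)
    have "dist ((f ^^ k) x) ((f ^^ k) y) \<le> \<epsilon>" if "k < n" for k
    proof (rule m)
      have "\<beta> ^ (n + m) * \<bar>\<phi> x - \<phi> y\<bar> \<le> 1"
        using adj_level_small[OF adj ab'] \<beta>_gt_1 by (simp add: field_simps)
      moreover have "\<beta> ^ (k + m) * \<bar>\<phi> x - \<phi> y\<bar> \<le> \<beta> ^ (n + m) * \<bar>\<phi> x - \<phi> y\<bar>"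
        using \<beta>_gt_1 that by (intro mult_right_mono power_increasing) auto
      ultimately have "\<beta> ^ m * (\<beta> ^ k * \<bar>\<phi> x - \<phi> y\<bar>) \<le> 1" by (simp add: power_add algebra_simps)
      then have "\<beta> ^ k * \<bar>\<phi> x - \<phi> y\<bar> \<le> 1 / \<beta> ^ m" using \<beta>_gt_1 by (simp add: field_simps)
      then show "\<bar>\<phi> ((f ^^ k) x) - \<phi> ((f ^^ k) y)\<bar> \<le> 1 / \<beta> ^ m"
        using adj_level_scale[OF adj ab', of k] that by simp
    qed (use power_in ab' in auto)
    moreover obtain k where "k < n" "\<epsilon> < dist ((f ^^ k) x) ((f ^^ k) y)"
      using E(2) xy unfolding separated_def by blast
    ultimately show False by (meson not_le)
  qed
  moreover have "?l ` E \<subseteq> level (n + m)" using l(1) E(1) by blast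
  ultimately show ?thesis using level_finite by (intro card_inj_on_le)
qed

lemma \<psi>_uniform:
  assumes "0 < \<epsilon>"
  obtains d where "0 < d" "\<And>x y. a \<le> x \<Longrightarrow> x \<le> b \<Longrightarrow> a \<le> y \<Longrightarrow> y \<le> b \<Longrightarrow> \<bar>\<phi> x - \<phi> y\<bar> < d \<Longrightarrow> dist x y < \<epsilon>"
proof -
  have "uniformly_continuous_on {0..1} \<psi>"
    by (rule compact_uniformly_continuous[OF \<psi>_continuous]) simp
  then obtain d where d: "0 < d" "\<And>s t. s \<in> {0..1} \<Longrightarrow> t \<in> {0..1} \<Longrightarrow> dist t s < d \<Longrightarrow> dist (\<psi> t) (\<psi> s) < \<epsilon>"
    unfolding uniformly_continuous_on_def using assms by metis
  have "dist x y < \<epsilon>" if "a \<le> x" "x \<le> b" "a \<le> y" "y \<le> b" "\<bar>\<phi> x - \<phi> y\<bar> < d" for x y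
    using d(2)[of "\<phi> y" "\<phi> x"] \<phi>_range[of x] \<phi>_range[of y] \<psi>_\<phi>[of x] \<psi>_\<phi>[of y] that
    by (simp add: dist_real_def)
  then show ?thesis using that d(1) by blast
qed

lemma entropy_upper: "topological_entropy {a..b} f \<le> ereal (ln \<beta>)"
  unfolding topological_entropy_def
proof (rule SUP_least)
  fix \<epsilon> :: real assume "\<epsilon> \<in> {0<..}"
  then obtain d where d: "0 < d"
    "\<And>x y. a \<le> x \<Longrightarrow> x \<le> b \<Longrightarrow> a \<le> y \<Longrightarrow> y \<le> b \<Longrightarrow> \<bar>\<phi> x - \<phi> y\<bar> < d \<Longrightarrow> dist x y < \<epsilon>"
    using \<psi>_uniform[of \<epsilon>] by auto
  obtain m where m: "1 / \<beta> ^ m < d" using \<beta>_power_small[OF d(1)] .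
  have dist: "dist x y \<le> \<epsilon>" if "a \<le> x" "x \<le> b" "a \<le> y" "y \<le> b" "\<bar>\<phi> x - \<phi> y\<bar> \<le> 1 / \<beta> ^ m" for x y
    using d(2)[of x y] that m by simp
  \<comment> \<open>This absorbs the additive 1 of \<open>level_card\<close>, because powers of
    \<open>\<beta>\<close> are at least 1.\<close>
  define C where "C = 1 / \<mu> + 1"
  have C: "0 < C" using \<mu>_pos by (simp add: C_def add_pos_pos)
  have bound: "log_separation {a..b} f n \<epsilon> \<le> ereal (ln C + real (n + m) * ln \<beta>)" for n
    unfolding log_separation_def
  proof (rule SUP_least)
    fix E assume "E \<in> {E. E \<subseteq> {a..b} \<and> finite E \<and> E \<noteq> {} \<and> separated f n \<epsilon> E}"
    then have E: "E \<subseteq> {a..b}" "finite E" "E \<noteq> {}" "separated f n \<epsilon> E" by auto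
    have "real (card E) \<le> real (card (level (n + m)))"
      using separated_card[OF dist E(1,4)] by simp
    also have "\<dots> \<le> \<beta> ^ (n + m) / \<mu> + 1" by (rule level_card)
    also have "\<dots> \<le> C * \<beta> ^ (n + m)" 
      using one_le_power[of \<beta> "n + m"] \<beta>_gt_1 by (simp add: C_def algebra_simps)
    finally have "ln (real (card E)) \<le> ln (C * \<beta> ^ (n + m))"
      using E C \<beta>_gt_1 by (subst ln_le_cancel_iff) (auto simp: card_gt_0_iff)
    also have "\<dots> = ln C + real (n + m) * ln \<beta>"
      using C \<beta>_gt_1 by (simp add: ln_mult ln_realpow)
    finally show "ereal (ln (real (card E))) \<le> ereal (ln C + real (n + m) * ln \<beta>)" by simp
  qed
  have "limsup (\<lambda>n. log_separation {a..b} f n \<epsilon> / ereal (real n))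
      \<le> limsup (\<lambda>n. ereal ((ln C + real (n + m) * ln \<beta>) / real n))"
  proof (rule Limsup_mono, rule eventually_sequentiallyI[of 1])
    fix n :: nat assume "1 \<le> n"
    then show "log_separation {a..b} f n \<epsilon> / ereal (real n) \<le> ereal ((ln C + real (n + m) * ln \<beta>) / real n)"
      using ereal_divide_right_mono[OF bound[of n], of "ereal (real n)"] by simp
  qed
  also have "\<dots> = ereal (ln \<beta>)"
  proof (rule lim_imp_Limsup)
    have "(\<lambda>n. (ln C + real m * ln \<beta>) * (1 / real n) + ln \<beta>) \<longlonglongrightarrow> (ln C + real m * ln \<beta>) * 0 + ln \<beta>"
      by (intro tendsto_intros lim_1_over_n)
    then have "(\<lambda>n. (ln C + real m * ln \<beta>) * (1 / real n) + ln \<beta>) \<longlonglongrightarrow> ln \<beta>" by simp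
    moreover have "\<forall>\<^sub>F n in sequentially. (ln C + real m * ln \<beta>) * (1 / real n) + ln \<beta> = (ln C + real (n + m) * ln \<beta>) / real n"
      by (rule eventually_sequentiallyI[of 1]) (simp add: field_simps)
    ultimately have "(\<lambda>n. (ln C + real (n + m) * ln \<beta>) / real n) \<longlonglongrightarrow> ln \<beta>"
      by (rule Lim_transform_eventually)
    then show "(\<lambda>n. ereal ((ln C + real (n + m) * ln \<beta>) / real n)) \<longlonglongrightarrow> ereal (ln \<beta>)" by simp
  qed simp
  finally show "limsup (\<lambda>n. log_separation {a..b} f n \<epsilon> / ereal (real n)) \<le> ereal (ln \<beta>)" .
qed

text \<open>Cut at \<open>\<phi>\<close>-distance \<open>2 / \<beta> ^ n\<close> from
  \<open>x\<close>. Each part is longer than a cell of the \<open>n\<close>-th refinement and so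
  contains a point of \<open>level n\<close> inside. Between them there are two consecutive ones,
  and \<open>f ^^ n\<close> sends these to distinct points of \<open>P\<close>.\<close>

lemma long_interval_covers_cell:
  assumes xy: "a \<le> x" "x \<le> y" "y \<le> b" and len: "4 / \<beta> ^ n \<le> \<phi> y - \<phi> x"
  obtains p where "p \<in> S" "{p..nxt P p} \<subseteq> (f ^^ n) ` {x..y}"
proof -
  define d where "d = 1 / \<beta> ^ n"
  have d: "0 < d" "4 * d \<le> \<phi> y - \<phi> x" using \<beta>_gt_1 len by (auto simp: d_def)
  have found: "\<exists>q\<in>level n. u < q \<and> q < v" if uv: "a \<le> u" "u \<le> v" "v \<le> b" "d < \<phi> v - \<phi> u" for u v
  proof (rule ccontr)
    assume "\<not> (\<exists>q\<in>level n. u < q \<and> q < v)"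
    then have "adj (level n) u v" using uv(2) by (force simp: adj_def)
    then show False using adj_level_small[of n u v] uv by (simp add: d_def)
  qed
  define c where "c = \<psi> (\<phi> x + 2 * d)"
  have r: "0 \<le> \<phi> x" "\<phi> y \<le> 1" using \<phi>_range[of x] \<phi>_range[of y] xy by auto
  have c: "\<phi> c = \<phi> x + 2 * d" "a \<le> c" "c \<le> b" unfolding c_def using \<phi>_\<psi> \<psi>_in r d by auto
  have "x < c" using \<phi>_less_iff[of x c] c xy d by simp
  moreover have "c < y" using \<phi>_less_iff[of c y] c xy d by simp
  ultimately obtain z z' where z: "z \<in> level n" "x < z" "z < c" "z' \<in> level n" "c < z'" "z' < y"
    using found[of x c] found[of c y] c xy d by auto
  define z2 where "z2 = nxt (level n) z"
  have zz: "z < z'" using z by simp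
  note n2 = nxt_props[OF level_finite z(4) zz, folded z2_def] adj_nxt[OF level_finite z(4) zz, folded z2_def]
  have ab: "a \<le> z" "z \<le> b" "a \<le> z2" "z2 \<le> b" using z n2 xy by auto
  have "\<bar>\<phi> ((f ^^ n) z) - \<phi> ((f ^^ n) z2)\<bar> = \<beta> ^ n * \<bar>\<phi> z - \<phi> z2\<bar>"
    using adj_level_scale[OF n2(4) ab, of n] by simp
  moreover have "\<phi> z < \<phi> z2" using \<phi>_strict[of z z2] n2 ab by simp
  ultimately have neq: "(f ^^ n) z \<noteq> (f ^^ n) z2" using \<beta>_gt_1 by auto
  have inP: "(f ^^ n) z \<in> P" "(f ^^ n) z2 \<in> P" using z(1) n2(1) by (auto simp: level_def)
  define p where "p = min ((f ^^ n) z) ((f ^^ n) z2)"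
  define q where "q = max ((f ^^ n) z) ((f ^^ n) z2)"
  have pq: "p \<in> P" "q \<in> P" "p < q" using inP neq by (auto simp: p_def q_def min_def max_def)
  have "p \<in> S" using pq P_bounds(2)[of q] by (auto simp: S_def)
  moreover have "{p..nxt P p} \<subseteq> (f ^^ n) ` {x..y}"
  proof -
    have "continuous_on {a..b} (f ^^ n)"
    proof (induction n)
      case (Suc k)
      have "(f ^^ k) ` {a..b} \<subseteq> {a..b}" using power_in[of _ k] by auto
      from continuous_on_compose2[OF cont Suc this] show ?case by (simp add: comp_def)
    qed simp
    moreover have "p \<in> (f ^^ n) ` {x..y}" "q \<in> (f ^^ n) ` {x..y}"
      using z n2 by (auto simp: p_def q_def min_def max_def)
    ultimately have "{p..q} \<subseteq> (f ^^ n) ` {x..y}"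
      using xy by (intro connected_image_interval[of a b "f ^^ n"]) auto
    then show ?thesis using nxt_props(3)[OF fin pq(2,3)] by (meson atLeastatMost_subset_iff order_refl subset_trans)
  qed
  ultimately show ?thesis using that by blast
qed

text \<open>Pack a fixed cell with disjoint intervals of \<open>\<phi>\<close>-length
  \<open>4 / \<beta> ^ n\<close>, separated by gaps of \<open>1 / \<beta> ^ n\<close>. Each covers
  some cell after \<open>n\<close> steps and the fixed cell after at most \<open>L\<close> further
  ones. Those with the same transit time form a horseshoe.\<close>

lemma entropy_lower_approx:
  obtains c L where "0 < c" "\<And>n. 2 / c \<le> \<beta> ^ n \<Longrightarrow> 0 < n \<Longrightarrow>
    ereal (ln (c * \<beta> ^ n) / real (n + L)) \<le> topological_entropy {a..b} f"
proof -
  obtain p where p: "p \<in> S" using S_ne by auto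
  have "\<forall>r\<in>S. \<exists>l. {p..nxt P p} \<subseteq> (f ^^ l) ` {r..nxt P r}"
  proof
    fix r assume r: "r \<in> S"
    show "\<exists>l. {p..nxt P p} \<subseteq> (f ^^ l) ` {r..nxt P r}"
      using covers[of r "nxt P r" p "nxt P p"] S_nxt[OF r] S_nxt[OF p] S_P[OF p] by simp
  qed
  then obtain lt where lt: "\<And>r. r \<in> S \<Longrightarrow> {p..nxt P p} \<subseteq> (f ^^ lt r) ` {r..nxt P r}" by metis
  define L where "L = Max (lt ` S)"
  have L: "lt r \<le> L" if "r \<in> S" for r unfolding L_def using S_fin that by (intro Max_ge) auto
  \<comment> \<open>Spacing of the packed intervals contributes 5, rounding down their number
    another factor 2, and the choice among the \<open>L + 1\<close> transit times the remaining
    factor.\<close>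
  define c where "c = w p / (10 * (real L + 1))"
  have c: "0 < c" using w_pos[OF p] by (simp add: c_def)
  have "ereal (ln (c * \<beta> ^ n) / real (n + L)) \<le> topological_entropy {a..b} f"
    if n: "2 / c \<le> \<beta> ^ n" "0 < n" for n
  proof -
    define d where "d = 1 / \<beta> ^ n"
    have d: "0 < d" using \<beta>_gt_1 by (simp add: d_def)
    define J where "J = nat \<lfloor>w p / (5 * d)\<rfloor>"
    have Jd: "real J * (5 * d) \<le> w p"
    proof -
      have "real J \<le> w p / (5 * d)" unfolding J_def using w_pos[OF p] d by (simp add: less_imp_le)
      then show ?thesis using d by (simp add: pos_le_divide_eq)
    qed
    have big: "2 \<le> c * \<beta> ^ n" using n c by (simp add: field_simps)
    have Jge: "c * \<beta> ^ n * (real L + 1) \<le> real J"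
    proof -
      have 1: "c * (real L + 1) = w p / 10" by (simp add: c_def divide_simps)
      have 2: "c * \<beta> ^ n * (real L + 1) = c * (real L + 1) * \<beta> ^ n" by (simp only: mult_ac)
      have 3: "w p / (10 * d) = w p / 10 * \<beta> ^ n" by (simp add: d_def)
      have "c * \<beta> ^ n * (real L + 1) = w p / (10 * d)" unfolding 2 1 3 ..
      moreover have "2 * 1 \<le> c * \<beta> ^ n * (real L + 1)" using big by (intro mult_mono) auto
      moreover have "w p / (5 * d) = 2 * (w p / (10 * d))" by simp
      moreover have "w p / (5 * d) - 1 \<le> real J" unfolding J_def by linarith
      ultimately show ?thesis by linarith
    qed
    define s where "s j = \<psi> (\<phi> p + 5 * d * real j)" for j
    define t where "t j = \<psi> (\<phi> p + 5 * d * real j + 4 * d)" for j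
    have top: "\<phi> p + w p \<le> 1" "0 \<le> \<phi> p" "\<phi> (nxt P p) = \<phi> p + w p"
    proof -
      show e: "\<phi> (nxt P p) = \<phi> p + w p" using q0_nxt[OF p] \<phi>_P S_P[OF p] S_nxt(1)[OF p] by simp
      show "\<phi> p + w p \<le> 1" "0 \<le> \<phi> p" using \<phi>_range[of "nxt P p"] \<phi>_range[of p] S_nxt[OF p] e by auto
    qed
    have bd: "5 * d * real j + 5 * d \<le> w p" if "j < J" for j
    proof -
      have "(real j + 1) * (5 * d) \<le> real J * (5 * d)" using that d by (intro mult_right_mono) auto
      then show ?thesis using Jd by (simp add: algebra_simps)
    qed
    have st: "\<phi> (s j) = \<phi> p + 5 * d * real j" "\<phi> (t j) = \<phi> p + 5 * d * real j + 4 * d"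
      "p \<le> s j" "s j \<le> t j" "t j \<le> nxt P p" if j: "j < J" for j
    proof -
      have n: "0 \<le> 5 * d * real j" using d by simp
      have r1: "0 \<le> \<phi> p + 5 * d * real j" "\<phi> p + 5 * d * real j \<le> 1" using bd[OF j] top d n by linarith+
      have r2: "0 \<le> \<phi> p + 5 * d * real j + 4 * d" "\<phi> p + 5 * d * real j + 4 * d \<le> 1" using bd[OF j] top d n by linarith+
      show e: "\<phi> (s j) = \<phi> p + 5 * d * real j" "\<phi> (t j) = \<phi> p + 5 * d * real j + 4 * d"
        unfolding s_def t_def using \<phi>_\<psi> r1 r2 by auto
      have i: "a \<le> s j" "s j \<le> b" "a \<le> t j" "t j \<le> b" unfolding s_def t_def using \<psi>_in r1 r2 by auto
      have pb: "a \<le> p" "p \<le> b" "a \<le> nxt P p" "nxt P p \<le> b" using S_nxt[OF p] by auto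
      show "p \<le> s j" using \<phi>_less_iff[of "s j" p] i pb e n by linarith
      show "s j \<le> t j" using \<phi>_less_iff[of "t j" "s j"] i e d by linarith
      show "t j \<le> nxt P p" using \<phi>_less_iff[of "nxt P p" "t j"] i pb e top bd[OF j] d by linarith
    qed
    have ab: "a \<le> s j" "t j \<le> b" if "j < J" for j using st[OF that] S_nxt[OF p] by auto
    have "\<exists>l\<le>L. {p..nxt P p} \<subseteq> (f ^^ (n + l)) ` {s j..t j}" if j: "j < J" for j
    proof -
      have "4 / \<beta> ^ n \<le> \<phi> (t j) - \<phi> (s j)" using st[OF j] by (simp add: d_def)
      then obtain r where r: "r \<in> S" "{r..nxt P r} \<subseteq> (f ^^ n) ` {s j..t j}"
        using long_interval_covers_cell[of "s j" "t j" n] ab[OF j] st[OF j] by metis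
      have "{p..nxt P p} \<subseteq> (f ^^ lt r) ` ((f ^^ n) ` {s j..t j})" using lt[OF r(1)] r(2) by blast
      also have "\<dots> = (f ^^ (n + lt r)) ` {s j..t j}"
        unfolding image_comp funpow_add[symmetric] by (simp add: add.commute)
      finally show ?thesis using L[OF r(1)] by blast
    qed
    then obtain tm where tm: "\<And>j. j < J \<Longrightarrow> tm j \<le> L" "\<And>j. j < J \<Longrightarrow> {p..nxt P p} \<subseteq> (f ^^ (n + tm j)) ` {s j..t j}"
      by metis
    define B where "B l = {j. j < J \<and> tm j = l}" for l
    \<comment> \<open>Pigeonhole over the transit times \<open>0, ..., L\<close>: a horseshoe
      requires the same number of steps for all its branches.\<close>
    have "\<exists>l\<le>L. c * \<beta> ^ n \<le> real (card (B l))"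
    proof (rule ccontr)
      assume "\<not> ?thesis"
      then have lt: "real (card (B l)) < c * \<beta> ^ n" if "l \<le> L" for l using that by force
      have "{..<J} = (\<Union>l\<in>{..L}. B l)" using tm(1) by (auto simp: B_def)
      then have "J \<le> (\<Sum>l\<in>{..L}. card (B l))" by (metis card_UN_le card_lessThan finite_atMost)
      then have "real J \<le> (\<Sum>l\<in>{..L}. real (card (B l)))" by (metis of_nat_le_iff of_nat_sum)
      also have "\<dots> < (\<Sum>l\<in>{..L}. c * \<beta> ^ n)" by (rule sum_strict_mono) (use lt in auto)
      also have "\<dots> = c * \<beta> ^ n * (real L + 1)" by simp
      finally show False using Jge by simp
    qed
    then obtain l where l: "l \<le> L" "c * \<beta> ^ n \<le> real (card (B l))" by blast
    have Bfin: "finite (B l)" by (auto simp: B_def)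
    have card2: "2 \<le> real (card (B l))" using l(2) big by linarith
    have Bne: "B l \<noteq> {}" using card2 by auto
    have BJ: "j < J" "tm j = l" if "j \<in> B l" for j using that by (auto simp: B_def)
    have "uniformly_continuous_on {a..b} \<phi>"
      by (rule compact_uniformly_continuous[OF \<phi>_continuous]) simp
    then obtain e where e: "0 < e" "\<And>x y. x \<in> {a..b} \<Longrightarrow> y \<in> {a..b} \<Longrightarrow> dist y x < e \<Longrightarrow> dist (\<phi> y) (\<phi> x) < d"
      unfolding uniformly_continuous_on_def using d by metis
    have "ereal (ln (real (card (B l))) / real (n + l)) \<le> topological_entropy {a..b} f"
    proof (rule horseshoe_entropy[where K = "\<lambda>j. {s j..t j}" and \<epsilon> = "e / 2"])
      fix i assume i: "i \<in> B l"
      show "{s i..t i} \<subseteq> {a..b}" using ab[OF BJ(1)[OF i]] by auto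
      show "{s i..t i} \<noteq> {}" using st(4)[OF BJ(1)[OF i]] by auto
      fix j assume j: "j \<in> B l"
      have "{s j..t j} \<subseteq> {p..nxt P p}" using st[OF BJ(1)[OF j]] by auto
      then show "{s j..t j} \<subseteq> (f ^^ (n + l)) ` {s i..t i}" using tm(2)[OF BJ(1)[OF i]] BJ(2)[OF i] by blast
    next
      fix i j x y assume ij: "i \<in> B l" "j \<in> B l" "i \<noteq> j" "x \<in> {s i..t i}" "y \<in> {s j..t j}"
      have sep: "d \<le> \<phi> v - \<phi> u" if "i' < j'" "i' < J" "j' < J" "u \<in> {s i'..t i'}" "v \<in> {s j'..t j'}" for i' j' u v
      proof -
        have 1: "\<phi> u \<le> \<phi> (t i')" "\<phi> (s j') \<le> \<phi> v" 
          using that ab[OF that(2)] ab[OF that(3)] by (auto intro!: \<phi>_mono)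
        have "5 * d * (real i' + 1) \<le> 5 * d * real j'" using that d by (intro mult_left_mono) auto
        then show ?thesis using 1 st[OF that(2)] st[OF that(3)] by (simp add: algebra_simps)
      qed
      have xy: "x \<in> {a..b}" "y \<in> {a..b}" using ij ab[OF BJ(1)[OF ij(1)]] ab[OF BJ(1)[OF ij(2)]] by auto
      have "d \<le> dist (\<phi> y) (\<phi> x)"
        using sep[of i j x y] sep[of j i y x] ij BJ(1)[OF ij(1)] BJ(1)[OF ij(2)]
        by (cases i j rule: linorder_cases) (auto simp: dist_real_def)
      then have "e \<le> dist y x" using e(2)[OF xy] by linarith
      then show "e / 2 < dist x y" using e(1) by (simp add: dist_commute)
    qed (use Bfin Bne n e in auto)
    moreover have "ln (c * \<beta> ^ n) / real (n + L) \<le> ln (real (card (B l))) / real (n + l)"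
    proof (rule frac_le)
      show "ln (c * \<beta> ^ n) \<le> ln (real (card (B l)))"
        using big l(2) by (subst ln_le_cancel_iff) linarith+
      show "0 \<le> ln (real (card (B l)))" using card2 by (intro ln_ge_zero) linarith
    qed (use n l in auto)
    ultimately show ?thesis by (meson ereal_less_eq(3) order_trans)
  qed
  then show ?thesis using that c by blast
qed

lemma entropy_lower: "ereal (ln \<beta>) \<le> topological_entropy {a..b} f"
proof (rule entropy_lower_approx)
  fix c :: real and L :: nat
  assume c: "0 < c" and *: "\<And>n. 2 / c \<le> \<beta> ^ n \<Longrightarrow> 0 < n \<Longrightarrow>
    ereal (ln (c * \<beta> ^ n) / real (n + L)) \<le> topological_entropy {a..b} f"
  obtain n0 where n0: "2 / c < \<beta> ^ n0" using real_arch_pow[OF \<beta>_gt_1] by blast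
  show ?thesis
  proof (rule tendsto_upperbound)
    have "(\<lambda>n. ((ln c - real L * ln \<beta>) * (1 / real (n + L)) + ln \<beta>)) \<longlonglongrightarrow> (ln c - real L * ln \<beta>) * 0 + ln \<beta>"
      by (intro tendsto_intros LIMSEQ_ignore_initial_segment[OF lim_1_over_n])
    then have "(\<lambda>n. ((ln c - real L * ln \<beta>) * (1 / real (n + L)) + ln \<beta>)) \<longlonglongrightarrow> ln \<beta>" by simp
    moreover have "\<forall>\<^sub>F n in sequentially. (ln c - real L * ln \<beta>) * (1 / real (n + L)) + ln \<beta> = ln (c * \<beta> ^ n) / real (n + L)"
    proof (rule eventually_sequentiallyI[of 1])
      fix n :: nat assume "1 \<le> n"
      then show "(ln c - real L * ln \<beta>) * (1 / real (n + L)) + ln \<beta> = ln (c * \<beta> ^ n) / real (n + L)"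
        using c \<beta>_gt_1 by (simp add: ln_mult ln_realpow field_simps)
    qed
    ultimately have "(\<lambda>n. ln (c * \<beta> ^ n) / real (n + L)) \<longlonglongrightarrow> ln \<beta>" by (rule Lim_transform_eventually)
    then show "(\<lambda>n. ereal (ln (c * \<beta> ^ n) / real (n + L))) \<longlonglongrightarrow> ereal (ln \<beta>)" by simp
    show "\<forall>\<^sub>F n in sequentially. ereal (ln (c * \<beta> ^ n) / real (n + L)) \<le> topological_entropy {a..b} f"
    proof (rule eventually_sequentiallyI[of "Suc n0"])
      fix n assume "Suc n0 \<le> n"
      then have "\<beta> ^ n0 \<le> \<beta> ^ n" "0 < n" using \<beta>_gt_1 by (auto intro!: power_increasing)
      then show "ereal (ln (c * \<beta> ^ n) / real (n + L)) \<le> topological_entropy {a..b} f"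
        using * n0 by simp
    qed
  qed simp
qed

lemma entropy: "topological_entropy {a..b} f = ereal (ln \<beta>)"
  using entropy_upper entropy_lower by (rule antisym)

lemma Phi_eq: "Phi a b f = g"
proof -
  have e: "exp (real_of_ereal (topological_entropy {a..b} f)) = \<beta>"
    using entropy \<beta>_gt_1 by simp
  show ?thesis unfolding Phi_def e
  proof (rule the_equality)
    show "constant_slope \<beta> g \<and> increasingly_conjugate {a..b} f {0..1} g"
      using g_constant_slope g_conjugate by (rule conjI)
  qed (elim conjE, rule g_unique)
qed

section \<open>Transitivity, piecewise monotonicity and an upper bound for the eigenvalue\<close>

lemma open_hits:
  assumes xy: "a \<le> x" "x < y" "y \<le> b" and V: "open V" "V \<inter> {a..b} \<noteq> {}"
  shows "\<exists>z m. x \<le> z \<and> z \<le> y \<and> (f ^^ m) z \<in> V"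
proof -
  obtain v where v: "v \<in> V" "a \<le> v" "v \<le> b" using V by auto
  obtain p where p: "p \<in> S" "p \<le> v" "v \<le> nxt P p"
  proof (cases "v < b")
    case True
    then show ?thesis using that[of "left v"] left_cell[of v] left_props[of v] v by simp
  next
    case False
    define p where "p = Max S"
    have p: "p \<in> S" unfolding p_def using S_fin S_ne by (rule Max_in)
    have "nxt P p = b"
    proof (rule ccontr)
      assume "nxt P p \<noteq> b"
      then have "nxt P p \<le> p" unfolding p_def using S_fin S_nxt(1)[OF p] by (intro Max_ge) (auto simp: S_def p_def)
      then show False using S_nxt(2)[OF p] by simp
    qed
    then show ?thesis using that[of p] p False v S_lt[OF p] by simp
  qed
  obtain m where "{p..nxt P p} \<subseteq> (f ^^ m) ` {x..y}"
    using covers[OF xy S_P[OF p(1)] S_nxt(1,2,4)[OF p(1)]] by blast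
  then have "v \<in> (f ^^ m) ` {x..y}" using p by auto
  then show ?thesis using v(1) by auto
qed

lemma power_continuous: "continuous_on {a..b} (f ^^ m)"
proof (induction m)
  case (Suc k)
  have "(f ^^ k) ` {a..b} \<subseteq> {a..b}" using power_in[of _ k] by auto
  from continuous_on_compose2[OF cont Suc this] show ?case by (simp add: comp_def)
qed simp

text \<open>Baire category: for each rational open interval that meets \<open>{a..b}\<close>, the
  points whose orbit visits it form a relatively open set, dense by \<open>open_hits\<close>. A
  point common to all these sets has a dense orbit.\<close>

lemma transitive: "transitive_on {a..b} f"
proof -
  define D where "D V = (\<Union>m. {x\<in>{a..b}. (f ^^ m) x \<in> V})" for V :: "real set"
  define G where "G = D ` ((\<lambda>(u, v). {real_of_rat u<..<real_of_rat v}) ` UNIV \<inter> {V. V \<inter> {a..b} \<noteq> {}})"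
  have "{a..b} \<subseteq> closure (\<Inter>G)"
  proof (rule Baire)
    show "countable G" unfolding G_def by (intro countable_image countable_Int1) auto
    fix A assume "A \<in> G"
    then obtain V where "A = D V" "V \<in> range (\<lambda>(u, v). {real_of_rat u<..<real_of_rat v})" "V \<inter> {a..b} \<noteq> {}"
      unfolding G_def by blast
    then have V: "A = D V" "open V" "V \<inter> {a..b} \<noteq> {}" by auto
    have "openin (top_of_set {a..b}) {x\<in>{a..b}. (f ^^ m) x \<in> V}" for m
      using continuous_openin_preimage_gen[OF power_continuous V(2), of m] by (simp add: vimage_def Int_def)
    then have o: "openin (top_of_set {a..b}) A" unfolding V D_def by blast
    have "{a..b} \<subseteq> closure A"
    proof
      fix x assume x: "x \<in> {a..b}"
      show "x \<in> closure A"
        unfolding closure_approachable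
      proof (intro allI impI)
        fix e :: real assume "0 < e"
        define u v where "u = max a (x - e / 2)" and "v = min b (x + e / 2)"
        have "a \<le> u" "u < v" "v \<le> b" using x ab \<open>0 < e\<close> by (auto simp: u_def v_def)
        then obtain z m where z: "u \<le> z" "z \<le> v" "(f ^^ m) z \<in> V" using open_hits V(2,3) by blast
        then have "z \<in> A" unfolding V D_def by (auto simp: u_def v_def)
        moreover have "dist z x < e" using z \<open>0 < e\<close> by (auto simp: u_def v_def dist_real_def)
        ultimately show "\<exists>y\<in>A. dist y x < e" by blast
      qed
    qed
    then show "openin (top_of_set {a..b}) A \<and> {a..b} \<subseteq> closure A" using o by blast
  qed simp
  then have "\<Inter>G \<noteq> {}" using ab by auto
  then obtain x where x: "x \<in> \<Inter>G" by blast
  obtain u v where uv: "a < real_of_rat u" "real_of_rat u < b" "real_of_rat u < real_of_rat v"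
    "real_of_rat v < b"
    using of_rat_dense[OF ab] of_rat_dense[of _ b] by metis
  have hit: "\<exists>m. x \<in> {a..b} \<and> (f ^^ m) x \<in> {real_of_rat u<..<real_of_rat v}"
    if "{real_of_rat u<..<real_of_rat v} \<inter> {a..b} \<noteq> {}" for u v
  proof -
    have "D {real_of_rat u<..<real_of_rat v} \<in> G" unfolding G_def using that by auto
    then have "x \<in> D {real_of_rat u<..<real_of_rat v}" using x by blast
    then show ?thesis by (auto simp: D_def)
  qed
  have "(real_of_rat u + real_of_rat v) / 2 \<in> {real_of_rat u<..<real_of_rat v} \<inter> {a..b}" using uv by auto
  then have xab: "x \<in> {a..b}" using hit by blast
  have "{a..b} \<subseteq> closure (range (\<lambda>k. (f ^^ k) x))"
  proof
    fix y assume y: "y \<in> {a..b}"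
    show "y \<in> closure (range (\<lambda>k. (f ^^ k) x))"
      unfolding closure_approachable
    proof (intro allI impI)
      fix e :: real assume e: "0 < e"
      obtain u where u: "y - e < real_of_rat u" "real_of_rat u < y" using of_rat_dense[of "y - e" y] e by auto
      obtain v where v: "y < real_of_rat v" "real_of_rat v < y + e" using of_rat_dense[of y "y + e"] e by auto
      have "y \<in> {real_of_rat u<..<real_of_rat v} \<inter> {a..b}" using u v y by auto
      then obtain m where "(f ^^ m) x \<in> {real_of_rat u<..<real_of_rat v}" using hit by blast
      then have "dist ((f ^^ m) x) y < e" using u v by (auto simp: dist_real_def)
      then show "\<exists>z\<in>range (\<lambda>k. (f ^^ k) x). dist z y < e" by blast
    qed
  qed
  then show ?thesis unfolding transitive_on_def using xab by blast
qed

lemma piecewise_monotone: "piecewise_monotone_on {a..b} f"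
  unfolding piecewise_monotone_on_def
proof (rule exI[of _ "insert {a} ((\<lambda>p. {p<..nxt P p}) ` (P - {b}))"], intro conjI ballI)
  show "finite (insert {a} ((\<lambda>p. {p<..nxt P p}) ` (P - {b})))" using fin by simp
  show "partition_on {a..b} (insert {a} ((\<lambda>p. {p<..nxt P p}) ` (P - {b})))"
    by (rule partition_half_open[OF fin P_sub aP bP])
  fix J assume J: "J \<in> insert {a} ((\<lambda>p. {p<..nxt P p}) ` (P - {b}))"
  then show "is_interval J" by (auto simp: is_interval_1)
  show "monotone_piece f J"
  proof (cases "J = {a}")
    case True
    then show ?thesis by (auto simp: monotone_piece_def mono_on_def)
  next
    case False
    then obtain p where p: "p \<in> S" "J = {p<..nxt P p}" using J by (auto simp: S_def)
    let ?I = "{p..nxt P p}"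
    have "continuous_on ?I f" "inj_on f ?I"
      using S_nxt[OF p(1)] cont inj by (auto intro: continuous_on_subset)
    then have "strict_mono_on ?I f \<or> strict_antimono_on ?I f"
      using injective_eq_monotone_map[of ?I f] is_interval_cc by blast
    then have "mono_on ?I f \<or> antimono_on ?I f"
    proof
      assume s: "strict_antimono_on ?I f"
      have "antimono_on ?I f"
      proof (rule monotone_onI)
        fix x y assume "x \<in> ?I" "y \<in> ?I" "x \<le> y"
        then show "f y \<le> f x" using s by (cases "x = y") (auto simp: monotone_on_def less_le)
      qed
      then show ?thesis ..
    qed (auto intro: strict_mono_on_imp_mono_on)
    moreover have "J \<subseteq> ?I" using p by auto
    ultimately show ?thesis unfolding monotone_piece_def by (meson monotone_on_subset)
  qed
qed

text \<open>The vector of cell lengths is subinvariant with factor \<open>c\<close>. If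
  \<open>\<beta>\<close> were at least \<open>c\<close>, \<open>perron_compare_lower\<close> would
  force equality in all rows, against the single strict one.\<close>

lemma \<beta>_less:
  assumes le: "\<And>p q. p \<in> P \<Longrightarrow> q \<in> P \<Longrightarrow> p < q \<Longrightarrow> adj P p q \<Longrightarrow> \<bar>f q - f p\<bar> \<le> c * (q - p)"
    and lt: "p0 \<in> P" "q0' \<in> P" "p0 < q0'" "adj P p0 q0'" "\<bar>f q0' - f p0\<bar> < c * (q0' - p0)"
  shows "\<beta> < c"
proof (rule ccontr)
  assume "\<not> \<beta> < c"
  have id: "mono_on P (\<lambda>x. x)" by (auto intro: mono_onI)
  have sum: "(\<Sum>p'\<in>R``{p}. nxt P p' - p') = \<bar>f (nxt P p) - f p\<bar>" if "p \<in> S" for p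
    using R_sum[OF that id] .
  have p0: "p0 \<in> S" "nxt P p0 = q0'" using lt P_bounds(2)[of q0'] nxt_eqI[OF fin] by (auto simp: S_def)
  have "\<forall>p\<in>S. (\<Sum>p'\<in>R``{p}. nxt P p' - p') = c * (nxt P p - p)"
  proof (rule perron_compare_lower[OF S_fin S_ne R_sub irreducible w_pos _ w_eig])
    show "(\<Sum>p'\<in>R``{p}. nxt P p' - p') \<le> c * (nxt P p - p)" if "p \<in> S" for p
      unfolding sum[OF that] using S_nxt[OF that] S_P[OF that] by (intro le) auto
  qed (use S_nxt \<open>\<not> \<beta> < c\<close> \<beta>_gt_1 in auto)
  then show False using sum[OF p0(1)] p0 lt(5) by auto
qed

end

section \<open>Counting laps by turning points\<close>

lemma monotone_piece_subset: "monotone_piece f J \<Longrightarrow> K \<subseteq> J \<Longrightarrow> monotone_piece f K"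
  unfolding monotone_piece_def by (meson monotone_on_subset)

text \<open>No monotone interval has a turning point in its interior, so the maximal ones are the
  closed intervals between neighbours of \<open>T\<close>, which overlap in the turning points. Both
  end points are counted in \<open>T\<close>, whence \<open>n + 2\<close> points for
  \<open>n + 1\<close> laps.\<close>

lemma has_modality_turning:
  assumes ab: "a < b" and fin: "finite T" and T: "T \<subseteq> {a..b}" "a \<in> T" "b \<in> T" and card: "card T = n + 2"
    and mon: "\<And>x y. a \<le> x \<Longrightarrow> x < y \<Longrightarrow> y \<le> b \<Longrightarrow> adj T x y \<Longrightarrow> monotone_piece f {x..y}"
    and turn: "\<And>x t y. a \<le> x \<Longrightarrow> x < t \<Longrightarrow> t < y \<Longrightarrow> y \<le> b \<Longrightarrow> t \<in> T \<Longrightarrow> \<not> monotone_piece f {x..y}"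
  shows "has_modality {a..b} f n"
proof -
  have Tb: "a \<le> t" "t \<le> b" if "t \<in> T" for t using T that by auto
  have lt: "p < b" if "p \<in> T - {b}" for p using Tb(2)[of p] that by auto
  note nx = nxt_props[OF fin T(3) lt] adj_nxt[OF fin T(3) lt]
  have piece: "monotone_piece f {p..nxt T p}" "{p..nxt T p} \<subseteq> {a..b}" if "p \<in> T - {b}" for p
    using mon[of p "nxt T p"] nx[OF that] Tb that by auto
  have "laps {a..b} f = (\<lambda>p. {p..nxt T p}) ` (T - {b})"
  proof (intro equalityI subsetI)
    fix J assume "J \<in> laps {a..b} f"
    then have J: "J \<subseteq> {a..b}" "is_interval J" "monotone_piece f J"
      and max: "\<And>K. J \<subseteq> K \<Longrightarrow> K \<subseteq> {a..b} \<Longrightarrow> is_interval K \<Longrightarrow> monotone_piece f K \<Longrightarrow> K = J"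
      by (auto simp: laps_def)
    have sub: "{x..y} \<subseteq> J" if "x \<in> J" "y \<in> J" for x y
      using J(2) that unfolding is_interval_1 by (meson atLeastAtMost_iff subsetI)
    define p where "p = Max {t\<in>T - {b}. \<forall>y\<in>J. t \<le> y}"
    have "p \<in> {t\<in>T - {b}. \<forall>y\<in>J. t \<le> y}" unfolding p_def
    proof (rule Max_in)
      have "a \<in> {t\<in>T - {b}. \<forall>y\<in>J. t \<le> y}" using T ab J(1) by auto
      then show "{t\<in>T - {b}. \<forall>y\<in>J. t \<le> y} \<noteq> {}" by blast
    qed (use fin in simp)
    then have p: "p \<in> T - {b}" "\<And>y. y \<in> J \<Longrightarrow> p \<le> y" by auto
    have "y \<le> nxt T p" if y: "y \<in> J" for y
    proof (rule ccontr)
      assume less: "\<not> y \<le> nxt T p"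
      have "\<not> (\<forall>y\<in>J. nxt T p \<le> y)"
      proof
        assume "\<forall>y\<in>J. nxt T p \<le> y"
        moreover have "nxt T p \<in> T - {b}" using nx(1)[OF p(1)] less y J(1) by auto
        ultimately have "nxt T p \<le> p" unfolding p_def using fin by (intro Max_ge) auto
        then show False using nx(2)[OF p(1)] by simp
      qed
      then obtain x where x: "x \<in> J" "x < nxt T p" by force
      have "\<not> monotone_piece f {x..y}"
        using turn[of x "nxt T p" y] x y subsetD[OF J(1) x(1)] subsetD[OF J(1) y] less nx(1)[OF p(1)] by auto
      then show False using monotone_piece_subset[OF J(3) sub[OF x(1) y]] by simp
    qed
    then have "J \<subseteq> {p..nxt T p}" using p by auto
    then have "{p..nxt T p} = J" using piece[OF p(1)] by (intro max) auto
    then show "J \<in> (\<lambda>p. {p..nxt T p}) ` (T - {b})" using p(1) by blast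
  next
    fix J assume "J \<in> (\<lambda>p. {p..nxt T p}) ` (T - {b})"
    then obtain p where p: "p \<in> T - {b}" "J = {p..nxt T p}" by blast
    note n = nx[OF p(1)]
    have "K = J" if K: "J \<subseteq> K" "K \<subseteq> {a..b}" "is_interval K" "monotone_piece f K" for K
    proof (rule ccontr)
      assume "K \<noteq> J"
      then obtain y where y: "y \<in> K" "y \<notin> J" using K(1) by blast
      have sub: "{u..v} \<subseteq> K" if "u \<in> K" "v \<in> K" for u v
        using K(3) that unfolding is_interval_1 by (meson atLeastAtMost_iff subsetI)
      have pn: "p \<in> K" "nxt T p \<in> K" using K(1) p n by auto
      consider "y < p" | "nxt T p < y" using y p by force
      then show False
      proof cases
        case 1
        then have "\<not> monotone_piece f {y..nxt T p}" using turn[of y p "nxt T p"] p n subsetD[OF K(2) y(1)] subsetD[OF K(2) pn(2)] by auto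
        then show False using monotone_piece_subset[OF K(4) sub[OF y(1) pn(2)]] by simp
      next
        case 2
        then have "\<not> monotone_piece f {p..y}" using turn[of p "nxt T p" y] n subsetD[OF K(2) y(1)] subsetD[OF K(2) pn(1)] by auto
        then show False using monotone_piece_subset[OF K(4) sub[OF pn(1) y(1)]] by simp
      qed
    qed
    then show "J \<in> laps {a..b} f" using piece[OF p(1)] p(2) by (auto simp: laps_def)
  qed
  moreover have "inj_on (\<lambda>p. {p..nxt T p}) (T - {b})"
  proof (rule inj_onI)
    fix p q assume pq: "p \<in> T - {b}" "q \<in> T - {b}" "{p..nxt T p} = {q..nxt T q}"
    then have "p \<in> {q..nxt T q}" "q \<in> {p..nxt T p}" using nx(2)[OF pq(1)] nx(2)[OF pq(2)] by auto
    then show "p = q" by auto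
  qed
  ultimately show ?thesis using card fin T(3) unfolding has_modality_def by (simp add: card_image)
qed

lemma inj_imp_monotone_piece:
  assumes "continuous_on {x..y} f" "inj_on f {x..y}"
  shows "monotone_piece f {x..y}"
proof -
  have "strict_mono_on {x..y} f \<or> strict_antimono_on {x..y} f"
    using assms injective_eq_monotone_map[of "{x..y}" f] is_interval_cc by blast
  then show ?thesis
  proof
    assume s: "strict_antimono_on {x..y} f"
    have "antimono_on {x..y} f"
    proof (rule monotone_onI)
      fix u v assume "u \<in> {x..y}" "v \<in> {x..y}" "u \<le> v"
      then show "f v \<le> f u" using s by (cases "u = v") (auto simp: monotone_on_def less_le)
    qed
    then show ?thesis by (simp add: monotone_piece_def)
  qed (auto simp: monotone_piece_def intro: strict_mono_on_imp_mono_on)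
qed

section \<open>Laps\<close>

text \<open>\<open>T\<close> consists of the turning points and both end points, \<open>P\<close> is
  the finer Markov partition. Injectivity between neighbours of \<open>T\<close>, across points of
  \<open>P\<close>, is what identifies the laps.\<close>

locale lap_map =
  fixes a b :: real and f :: "real \<Rightarrow> real" and P T :: "real set"
  assumes ab: "a < b" and fin: "finite P" and P_sub: "P \<subseteq> {a..b}" and T_sub: "T \<subseteq> P" and aT: "a \<in> T" and bT: "b \<in> T"
    and cont: "continuous_on {a..b} f" and maps: "f ` {a..b} \<subseteq> {a..b}" and inv: "f ` P \<subseteq> P"
    and inj: "\<And>x y. a \<le> x \<Longrightarrow> x < y \<Longrightarrow> y \<le> b \<Longrightarrow> adj T x y \<Longrightarrow> inj_on f {x..y}"
    and turn: "\<And>x t y. a \<le> x \<Longrightarrow> x < t \<Longrightarrow> t < y \<Longrightarrow> y \<le> b \<Longrightarrow> t \<in> T \<Longrightarrow> \<not> monotone_piece f {x..y}"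
    and covers: "\<And>x y p q. a \<le> x \<Longrightarrow> x < y \<Longrightarrow> y \<le> b \<Longrightarrow> p \<in> P \<Longrightarrow> q \<in> P \<Longrightarrow> p < q \<Longrightarrow> adj P p q
      \<Longrightarrow> \<exists>m. {p..q} \<subseteq> (f ^^ m) ` {x..y}"
    and branch: "\<exists>p\<in>P. \<exists>q\<in>P. p < q \<and> adj P p q \<and> \<not> adj P (f p) (f q)"

sublocale lap_map \<subseteq> markov_map a b f P
proof
  show "inj_on f {x..y}" if "a \<le> x" "x < y" "y \<le> b" "adj P x y" for x y
    using inj that adj_antimono[OF that(4) T_sub] by blast
qed (use ab fin P_sub T_sub aT bT cont maps inv covers branch in auto)

context lap_map begin

lemma T_fin: "finite T" and T_ab: "T \<subseteq> {a..b}"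
  using T_sub fin P_sub by (auto intro: finite_subset)

lemma modality:
  assumes "card T = n + 2" shows "has_modality {a..b} f n"
proof (rule has_modality_turning[OF ab T_fin T_ab aT bT assms _ turn])
  fix x y assume "a \<le> x" "x < y" "y \<le> b" "adj T x y"
  then show "monotone_piece f {x..y}"
    using inj[of x y] by (intro inj_imp_monotone_piece continuous_on_subset[OF cont]) auto
qed

lemma transitive_map:
  assumes "card T = n + 2" "f \<in> extensional {a..b}" shows "f \<in> transitive_maps a b n"
  unfolding transitive_maps_def
  using assms maps cont piecewise_monotone transitive modality[OF assms(1)] by (auto simp: PiE_def)

lemma \<phi>_interval: assumes "a \<le> x" "x \<le> y" "y \<le> b" shows "\<phi> ` {x..y} = {\<phi> x..\<phi> y}"
proof
  have c: "continuous_on {x..y} \<phi>" by (rule continuous_on_subset[OF \<phi>_continuous]) (use assms in auto)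
  show "{\<phi> x..\<phi> y} \<subseteq> \<phi> ` {x..y}"
    by (rule connected_image_interval[OF c]) (use assms in auto)
qed (use \<phi>_mono assms in auto)

lemma g_monotone_piece:
  assumes "J \<subseteq> {a..b}" shows "monotone_piece g (\<phi> ` J) \<longleftrightarrow> monotone_piece f J"
proof -
  have le: "\<phi> x \<le> \<phi> y \<longleftrightarrow> x \<le> y" if "x \<in> {a..b}" "y \<in> {a..b}" for x y
    using \<phi>_less_iff[of y x] that by auto
  have e: "g (\<phi> x) \<le> g (\<phi> y) \<longleftrightarrow> f x \<le> f y" "\<phi> x \<le> \<phi> y \<longleftrightarrow> x \<le> y" if "x \<in> J" "y \<in> J" for x y
  proof -
    have xy: "x \<in> {a..b}" "y \<in> {a..b}" using that assms by auto
    show "g (\<phi> x) \<le> g (\<phi> y) \<longleftrightarrow> f x \<le> f y" using g_\<phi>[of x] g_\<phi>[of y] xy le[of "f x" "f y"] f_in by auto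
    show "\<phi> x \<le> \<phi> y \<longleftrightarrow> x \<le> y" using le xy by blast
  qed
  show ?thesis unfolding monotone_piece_def monotone_on_def by (simp add: e)
qed

lemma \<phi>T: "finite (\<phi> ` T)" "\<phi> ` T \<subseteq> {0..1}" "0 \<in> \<phi> ` T" "1 \<in> \<phi> ` T" "card (\<phi> ` T) = card T"
proof -
  show "finite (\<phi> ` T)" using T_fin by simp
  show "\<phi> ` T \<subseteq> {0..1}" using T_ab \<phi>_image by blast
  show "0 \<in> \<phi> ` T" "1 \<in> \<phi> ` T" using \<phi>_ends aT bT by (metis imageI)+
  show "card (\<phi> ` T) = card T" using card_image inj_on_subset[OF \<phi>_inj T_ab] by blast
qed

lemma g_inj:
  assumes "0 \<le> s" "s < t" "t \<le> 1" "adj (\<phi> ` T) s t"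
  shows "inj_on g {s..t}"
proof -
  define x y where "x = \<psi> s" and "y = \<psi> t"
  have xy: "a \<le> x" "x \<le> b" "a \<le> y" "y \<le> b" "\<phi> x = s" "\<phi> y = t"
    unfolding x_def y_def using \<psi>_in \<phi>_\<psi> assms by auto
  have "x < y" using \<phi>_less_iff[OF xy(1-4)] xy assms by simp
  moreover have "adj T x y" using adj_\<phi>[OF T_ab xy(1-4)] xy(5,6) assms(4) by simp
  ultimately have i: "inj_on f {x..y}" using inj xy by blast
  have im: "{s..t} = \<phi> ` {x..y}" using \<phi>_interval[of x y] xy \<open>x < y\<close> by simp
  show ?thesis unfolding im
  proof (rule inj_onI)
    fix u v assume "u \<in> \<phi> ` {x..y}" "v \<in> \<phi> ` {x..y}" "g u = g v"
    then obtain u' v' where uv: "u = \<phi> u'" "v = \<phi> v'" "u' \<in> {x..y}" "v' \<in> {x..y}" "g (\<phi> u') = g (\<phi> v')" by blast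
    then have "\<phi> (f u') = \<phi> (f v')" using g_\<phi>[of u'] g_\<phi>[of v'] xy by simp
    then have "f u' = f v'" by (rule inj_onD[OF \<phi>_inj]) (use f_in uv xy in auto)
    then have "u' = v'" by (rule inj_onD[OF i]) (use uv in auto)
    then show "u = v" using uv by simp
  qed
qed

lemma g_modality:
  assumes "card T = n + 2" shows "has_modality {0..1} g n"
proof (rule has_modality_turning[of 0 1 "\<phi> ` T"])
  show "monotone_piece g {s..t}" if "0 \<le> s" "s < t" "t \<le> 1" "adj (\<phi> ` T) s t" for s t
    using g_inj[OF that] that by (intro inj_imp_monotone_piece continuous_on_subset[OF g_continuous]) auto
  fix s r t assume st: "0 \<le> s" "s < r" "r < t" "t \<le> 1" "r \<in> \<phi> ` T"
  obtain q where q: "q \<in> T" "r = \<phi> q" using st by blast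
  define x y where "x = \<psi> s" and "y = \<psi> t"
  have xy: "a \<le> x" "x \<le> b" "a \<le> y" "y \<le> b" "\<phi> x = s" "\<phi> y = t"
    unfolding x_def y_def using \<psi>_in \<phi>_\<psi> st by auto
  have qb: "a \<le> q" "q \<le> b" using q T_ab by auto
  have o: "x < q" "q < y"
    using \<phi>_less_iff[OF xy(1,2) qb] \<phi>_less_iff[OF qb xy(3,4)] xy st q by auto
  then have "\<not> monotone_piece f {x..y}" using turn xy q by blast
  then show "\<not> monotone_piece g {s..t}"
    using g_monotone_piece[of "{x..y}"] \<phi>_interval[of x y] xy o by auto
qed (use \<phi>T assms in auto)

lemma g_constant_slope_map: "card T = n + 2 \<Longrightarrow> g \<in> constant_slope_maps n"
  unfolding constant_slope_maps_def using g_constant_slope g_modality by blast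

lemma g_steep:
  assumes "0 \<le> s" "s \<le> t" "t \<le> 1" "adj (\<phi> ` T) s t"
  shows "\<bar>g t - g s\<bar> = \<beta> * (t - s)"
  using constant_slope_inj[OF g_constant_slope assms(1-3)] g_inj[of s t] assms by (cases "s = t") auto

end

text \<open>
  One of \<open>N\<close> equal subintervals has no point of \<open>T\<close> in its interior; there the increments of \<open>g\<close>
  and \<open>h\<close> differ.
\<close>

lemma slope_gap:
  fixes g h :: "real \<Rightarrow> real"
  assumes uv: "u < v" and g: "\<And>s t. u \<le> s \<Longrightarrow> s \<le> t \<Longrightarrow> t \<le> v \<Longrightarrow> \<bar>g t - g s\<bar> = \<beta> * (t - s)"
    and T: "finite T" "card T < N"
    and h: "\<And>s t. u \<le> s \<Longrightarrow> s \<le> t \<Longrightarrow> t \<le> v \<Longrightarrow> adj T s t \<Longrightarrow> \<gamma> * (t - s) \<le> \<bar>h t - h s\<bar>"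
  shows "\<exists>x\<in>{u..v}. (\<gamma> - \<beta>) * ((v - u) / real N) / 2 \<le> \<bar>g x - h x\<bar>"
proof -
  define d where "d = (v - u) / real N"
  have N: "0 < N" using T by simp
  have d: "0 < d" "real N * d = v - u" using uv N by (auto simp: d_def)
  define s where "s j = u + real j * d" for j
  have mono: "s i \<le> s j" if "i \<le> j" for i j using that d by (auto simp: s_def intro!: mult_right_mono)
  have "\<exists>j<N. \<forall>t\<in>T. \<not> (s j < t \<and> t < s (Suc j))"
  proof (rule ccontr)
    assume "\<not> ?thesis"
    then obtain t where t: "\<And>j. j < N \<Longrightarrow> t j \<in> T \<and> s j < t j \<and> t j < s (Suc j)" by metis
    have "t i < t j" if "i < j" "j < N" for i j
      using t[of i] t[of j] mono[of "Suc i" j] that by fastforce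
    then have "inj_on t {..<N}" by (intro linorder_inj_onI) (auto simp: less_le)
    then have "N \<le> card T" using t card_inj_on_le[of t "{..<N}" T] T(1) by auto
    then show False using T(2) by simp
  qed
  then obtain j where j: "j < N" "\<And>t. t \<in> T \<Longrightarrow> \<not> (s j < t \<and> t < s (Suc j))" by blast
  have step: "s (Suc j) - s j = d" by (simp add: s_def algebra_simps)
  then have "adj T (s j) (s (Suc j))" using j(2) d by (force simp: adj_def)
  moreover have b: "u \<le> s j" "s j \<le> s (Suc j)" "s (Suc j) \<le> v"
    using mono[of 0 j] mono[of "Suc j" N] mono[of j "Suc j"] j(1) d by (auto simp: s_def)
  ultimately have "\<gamma> * d \<le> \<bar>h (s (Suc j)) - h (s j)\<bar>" "\<bar>g (s (Suc j)) - g (s j)\<bar> = \<beta> * d"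
    using h g step by metis+
  \<comment> \<open>The two increments differ by at least this much, and the difference is shared by
    the two ends of the subinterval; one end carries at least half.\<close>
  then have "(\<gamma> - \<beta>) * d \<le> \<bar>g (s j) - h (s j)\<bar> + \<bar>g (s (Suc j)) - h (s (Suc j))\<bar>"
    by (simp add: algebra_simps)
  then have "(\<gamma> - \<beta>) * d / 2 \<le> \<bar>g (s j) - h (s j)\<bar> \<or> (\<gamma> - \<beta>) * d / 2 \<le> \<bar>g (s (Suc j)) - h (s (Suc j))\<bar>"
    by linarith
  then show ?thesis using b unfolding d_def by (meson atLeastAtMost_iff order_trans)
qed

section \<open>Affine conjugation from \<open>{0..M}\<close> to \<open>{a..b}\<close>\<close>

definition rescale :: "real \<Rightarrow> real \<Rightarrow> real \<Rightarrow> (real \<Rightarrow> real) \<Rightarrow> real \<Rightarrow> real" where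
  "rescale a b M f x = (if x \<in> {a..b} then a + (b - a) / M * f ((x - a) * (M / (b - a))) else undefined)"

text \<open>All assumptions concern order, continuity and covering only, and \<open>B\<close> is an
  increasing affine conjugacy. So the example can be built on an interval of convenient integer
  length.\<close>

lemma lap_map_rescale:
  assumes ab: "a < b" and M: "lap_map 0 M f P T"
  defines "B \<equiv> \<lambda>y. a + (b - a) / M * y"
  shows "lap_map a b (rescale a b M f) (B ` P) (B ` T)"
proof -
  interpret M: lap_map 0 M f P T by (rule M)
  let ?F = "rescale a b M f"
  define k where "k = (b - a) / M"
  have k: "0 < k" "k * M = b - a" using ab M.ab by (auto simp: k_def)
  have B: "B y = a + k * y" for y by (simp add: B_def k_def)
  have less: "B x < B y \<longleftrightarrow> x < y" and le: "B x \<le> B y \<longleftrightarrow> x \<le> y" for x y using k by (auto simp: B)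
  have ends: "B 0 = a" "B M = b" using k by (auto simp: B)
  have surj: "\<exists>y. x = B y" for x using k by (intro exI[of _ "(x - a) / k"]) (simp add: B)
  have in_iff: "B y \<in> {a..b} \<longleftrightarrow> y \<in> {0..M}" for y using le[of 0 y] le[of y M] ends by auto
  have F: "?F (B y) = B (f y)" if "y \<in> {0..M}" for y
  proof -
    have "(B y - a) * (M / (b - a)) = y" using k ab M.ab by (simp add: B_def)
    then show ?thesis using that in_iff[of y] by (simp add: rescale_def B_def)
  qed
  have Fm: "(?F ^^ m) (B y) = B ((f ^^ m) y)" if "y \<in> {0..M}" for m y
    using that M.power_in[of y] F by (induction m) auto
  have im: "B ` {x..y} = {B x..B y}" for x y
  proof -
    have "B ` {x..y} = (+) a ` ((*) k ` {x..y})" by (simp add: image_comp B comp_def)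
    then show ?thesis using k(1) by (simp add: image_mult_atLeastAtMost B)
  qed
  have adjB: "adj (B ` Q) (B x) (B y) \<longleftrightarrow> adj Q x y" for Q x y by (auto simp: adj_def less)
  have mono_piece: "monotone_piece ?F {B x..B y} \<longleftrightarrow> monotone_piece f {x..y}" if "0 \<le> x" "y \<le> M" for x y
  proof -
    have e: "?F (B u) \<le> ?F (B v) \<longleftrightarrow> f u \<le> f v" if "u \<in> {x..y}" "v \<in> {x..y}" for u v
      using F[of u] F[of v] le that \<open>0 \<le> x\<close> \<open>y \<le> M\<close> by auto
    show ?thesis unfolding im[symmetric] monotone_piece_def monotone_on_def by (simp add: le e)
  qed
  show ?thesis
  proof
    show "a < b" by (rule ab)
    show "finite (B ` P)" using M.fin by simp
    show "B ` P \<subseteq> {a..b}" using M.P_sub in_iff by blast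
    show "B ` T \<subseteq> B ` P" using M.T_sub by blast
    show "a \<in> B ` T" "b \<in> B ` T" using ends M.aT M.bT by (metis imageI)+
    have c: "continuous_on {a..b} (\<lambda>x. (x - a) * (M / (b - a)))" by (intro continuous_intros)
    have "(\<lambda>x. (x - a) * (M / (b - a))) ` {a..b} \<subseteq> {0..M}"
    proof (rule image_subsetI)
      fix x assume x: "x \<in> {a..b}"
      obtain y where y: "x = B y" using surj by blast
      have "(x - a) * (M / (b - a)) = y" using k ab M.ab by (simp add: y B_def)
      then show "(x - a) * (M / (b - a)) \<in> {0..M}" using x y in_iff by simp
    qed
    from continuous_on_compose2[OF M.cont c this]
    have "continuous_on {a..b} (\<lambda>x. f ((x - a) * (M / (b - a))))" .
    then have "continuous_on {a..b} (\<lambda>x. a + (b - a) / M * f ((x - a) * (M / (b - a))))"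
      by (intro continuous_intros)
    then show "continuous_on {a..b} ?F" by (rule continuous_on_eq) (simp add: rescale_def)
    show "?F ` {a..b} \<subseteq> {a..b}"
    proof (rule image_subsetI)
      fix x assume x: "x \<in> {a..b}"
      obtain y where y: "x = B y" using surj by blast
      have "y \<in> {0..M}" using x y in_iff by simp
      then have "f y \<in> {0..M}" using M.maps by blast
      then show "?F x \<in> {a..b}" using F[OF \<open>y \<in> {0..M}\<close>] y in_iff by simp
    qed
    show "?F ` B ` P \<subseteq> B ` P"
    proof (clarify)
      fix p assume p: "p \<in> P"
      then have "p \<in> {0..M}" using M.P_sub by blast
      then show "?F (B p) \<in> B ` P" using F M.fP[OF p] by simp
    qed
    show "inj_on ?F {x..y}" if xy: "a \<le> x" "x < y" "y \<le> b" "adj (B ` T) x y" for x y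
    proof -
      obtain x' y' where e: "x = B x'" "y = B y'" using surj by metis
      have xy': "0 \<le> x'" "x' < y'" "y' \<le> M" "adj T x' y'"
        using xy le[of 0 x'] less[of x' y'] le[of y' M] ends adjB e by auto
      show ?thesis unfolding e im[symmetric]
      proof (rule inj_onI)
        fix s t assume "s \<in> B ` {x'..y'}" "t \<in> B ` {x'..y'}" "?F s = ?F t"
        then obtain u v where uv: "s = B u" "t = B v" "u \<in> {x'..y'}" "v \<in> {x'..y'}" "?F (B u) = ?F (B v)" by blast
        then have "B (f u) = B (f v)" using F[of u] F[of v] xy' by simp
        then have "f u = f v" using le[of "f u" "f v"] le[of "f v" "f u"] by simp
        then have "u = v" using inj_onD[OF M.inj[OF xy']] uv by blast
        then show "s = t" using uv by simp
      qed
    qed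
    show "\<not> monotone_piece ?F {x..y}" if xy: "a \<le> x" "x < t" "t < y" "y \<le> b" "t \<in> B ` T" for x t y
    proof -
      obtain x' y' where e: "x = B x'" "y = B y'" using surj by metis
      obtain t' where t: "t' \<in> T" "t = B t'" using xy by blast
      have xy': "0 \<le> x'" "x' < t'" "t' < y'" "y' \<le> M"
        using xy le[of 0 x'] less[of x' t'] less[of t' y'] le[of y' M] ends e t by auto
      then show ?thesis unfolding e using mono_piece[of x' y'] M.turn t by blast
    qed
    show "\<exists>m. {p..q} \<subseteq> (?F ^^ m) ` {x..y}"
      if xy: "a \<le> x" "x < y" "y \<le> b" "p \<in> B ` P" "q \<in> B ` P" "p < q" "adj (B ` P) p q" for x y p q
    proof -
      obtain x' y' where e: "x = B x'" "y = B y'" using surj by metis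
      obtain p' q' where pq: "p' \<in> P" "p = B p'" "q' \<in> P" "q = B q'" using xy by blast
      have xy': "0 \<le> x'" "x' < y'" "y' \<le> M" "p' < q'" "adj P p' q'"
        using xy le[of 0 x'] less[of x' y'] le[of y' M] less[of p' q'] ends adjB e pq by auto
      then obtain m where m: "{p'..q'} \<subseteq> (f ^^ m) ` {x'..y'}" using M.covers pq by blast
      have "(?F ^^ m) ` {x..y} = B ` ((f ^^ m) ` {x'..y'})"
        unfolding e im[symmetric] image_image using xy' by (intro image_cong refl Fm) auto
      then show ?thesis using m pq im by (metis image_mono)
    qed
    obtain p q where pq: "p \<in> P" "q \<in> P" "p < q" "adj P p q" "\<not> adj P (f p) (f q)" using M.branch by blast
    have "p \<in> {0..M}" "q \<in> {0..M}" using pq M.P_sub by blast+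
    then show "\<exists>p\<in>B ` P. \<exists>q\<in>B ` P. p < q \<and> adj (B ` P) p q \<and> \<not> adj (B ` P) (?F p) (?F q)"
      using pq adjB less F by (intro bexI[of _ "B p"] bexI[of _ "B q"]) auto
  qed
qed

lemma power_maps:
  assumes "f ` {a..b} \<subseteq> {a..b}" shows "(f ^^ m) ` {a..b} \<subseteq> {a..b}"
proof (induction m)
  case (Suc m)
  have "(f ^^ Suc m) ` {a..b} = f ` ((f ^^ m) ` {a..b})" by (simp add: image_comp)
  then show ?case using Suc assms by blast
qed simp

lemma power_continuous_on:
  fixes f :: "real \<Rightarrow> real"
  assumes "continuous_on {a..b} f" "f ` {a..b} \<subseteq> {a..b}" shows "continuous_on {a..b} (f ^^ m)"
proof (induction m)
  case (Suc m)
  from continuous_on_compose2[OF assms(1) Suc power_maps[OF assms(2)]] show ?case by (simp add: comp_def)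
qed simp

lemma power_hull:
  fixes f :: "real \<Rightarrow> real"
  assumes "continuous_on {a..b} f" "f ` {a..b} \<subseteq> {a..b}" "a \<le> x" "y \<le> b" "s \<in> {x..y}" "t \<in> {x..y}"
  shows "{(f ^^ m) s..(f ^^ m) t} \<subseteq> (f ^^ m) ` {x..y}"
  by (rule connected_image_interval[OF power_continuous_on[OF assms(1,2)]]) (use assms in auto)

section \<open>Expansion and covering\<close>

text \<open>While the pair stays in common cells its distance doubles in every two steps, which a
  bounded interval does not allow for ever. Two steps are used because a single one may have slope
  1.\<close>

lemma expansion_exit:
  fixes f :: "real \<Rightarrow> real"
  assumes maps: "f ` {a..b} \<subseteq> {a..b}"
    and exp: "\<And>x y. x \<in> {a..b} \<Longrightarrow> y \<in> {a..b} \<Longrightarrow> adj P x y \<Longrightarrow> adj P (f x) (f y)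
      \<Longrightarrow> 2 * \<bar>x - y\<bar> \<le> \<bar>f (f x) - f (f y)\<bar>"
    and xy: "x \<in> {a..b}" "y \<in> {a..b}" "x \<noteq> y"
  shows "\<exists>m. \<not> adj P ((f ^^ m) x) ((f ^^ m) y)"
proof (rule ccontr)
  assume "\<not> ?thesis"
  then have adj: "adj P ((f ^^ m) x) ((f ^^ m) y)" for m by blast
  have pw: "(f ^^ m) z \<in> {a..b}" if "z \<in> {a..b}" for m z using power_maps[OF maps, of m] that by blast
  have "2 ^ m * \<bar>x - y\<bar> \<le> \<bar>(f ^^ (2 * m)) x - (f ^^ (2 * m)) y\<bar>" for m
  proof (induction m)
    case (Suc m)
    have "2 * \<bar>(f ^^ (2 * m)) x - (f ^^ (2 * m)) y\<bar> \<le> \<bar>(f ^^ (2 * Suc m)) x - (f ^^ (2 * Suc m)) y\<bar>"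
      using exp[OF pw[OF xy(1)] pw[OF xy(2)] adj[of "2 * m"]] adj[of "Suc (2 * m)"] by simp
    then show ?case using Suc by simp
  qed simp
  moreover have "\<bar>(f ^^ (2 * m)) x - (f ^^ (2 * m)) y\<bar> \<le> b - a" for m
    using pw[OF xy(1), of "2 * m"] pw[OF xy(2), of "2 * m"] by auto
  ultimately have bound: "2 ^ m * \<bar>x - y\<bar> \<le> b - a" for m by (meson order_trans)
  obtain m where "(b - a) / \<bar>x - y\<bar> < 2 ^ m" using real_arch_pow[of 2] by auto
  then show False using bound[of m] xy(3) by (simp add: field_simps)
qed

text \<open>
  The first exit produces a point of \<open>P\<close> inside the image; the second exit, applied to an interval
  having this point as an end, produces another one.
\<close>

lemma expansion_covers:
  fixes f :: "real \<Rightarrow> real"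
  assumes cont: "continuous_on {a..b} f" and maps: "f ` {a..b} \<subseteq> {a..b}"
    and P: "P \<subseteq> {a..b}" "f ` P \<subseteq> P"
    and exp: "\<And>x y. x \<in> {a..b} \<Longrightarrow> y \<in> {a..b} \<Longrightarrow> adj P x y \<Longrightarrow> adj P (f x) (f y)
      \<Longrightarrow> 2 * \<bar>x - y\<bar> \<le> \<bar>f (f x) - f (f y)\<bar>"
    and xy: "a \<le> x" "x < y" "y \<le> b"
  shows "\<exists>m p q. p \<in> P \<and> q \<in> P \<and> p < q \<and> {p..q} \<subseteq> (f ^^ m) ` {x..y}"
proof -
  have ab: "x \<in> {a..b}" "y \<in> {a..b}" "x \<noteq> y" using xy by auto
  have pw: "(f ^^ m) z \<in> {a..b}" if "z \<in> {a..b}" for m z using power_maps[OF maps, of m] that by blast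
  obtain m where "\<not> adj P ((f ^^ m) x) ((f ^^ m) y)" using expansion_exit[OF maps exp ab] by blast
  then obtain q where q: "q \<in> P" "(f ^^ m) x < q \<and> q < (f ^^ m) y \<or> (f ^^ m) y < q \<and> q < (f ^^ m) x"
    unfolding adj_def by blast
  define z where "z = (f ^^ m) x"
  have z: "z \<in> {a..b}" "q \<in> {a..b}" "q \<noteq> z" using pw[OF ab(1)] q P z_def by auto
  have "{min q z..max q z} \<subseteq> {min z ((f ^^ m) y)..max z ((f ^^ m) y)}" using q(2) by (auto simp: z_def)
  also have "\<dots> \<subseteq> (f ^^ m) ` {x..y}"
    using power_hull[OF cont maps xy(1,3), of x y m] power_hull[OF cont maps xy(1,3), of y x m] xy
    by (auto simp: min_def max_def z_def)
  finally have sub: "{min q z..max q z} \<subseteq> (f ^^ m) ` {x..y}" .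
  obtain k where "\<not> adj P ((f ^^ k) q) ((f ^^ k) z)" using expansion_exit[OF maps exp z(2,1,3)] by blast
  then obtain r where r: "r \<in> P" "(f ^^ k) q < r \<and> r < (f ^^ k) z \<or> (f ^^ k) z < r \<and> r < (f ^^ k) q"
    unfolding adj_def by blast
  have "(f ^^ k) q \<in> P" using q(1) P(2) by (induction k) auto
  define p' q' where "p' = min ((f ^^ k) q) r" and "q' = max ((f ^^ k) q) r"
  have pq: "p' \<in> P" "q' \<in> P" "p' < q'"
    using r \<open>(f ^^ k) q \<in> P\<close> by (auto simp: p'_def q'_def min_def max_def)
  have mm: "a \<le> min q z" "max q z \<le> b" "q \<in> {min q z..max q z}" "z \<in> {min q z..max q z}" using z by auto
  have "{p'..q'} \<subseteq> {(f ^^ k) q..(f ^^ k) z} \<union> {(f ^^ k) z..(f ^^ k) q}" using r(2) by (auto simp: p'_def q'_def)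
  also have "\<dots> \<subseteq> (f ^^ k) ` {min q z..max q z}"
    using power_hull[OF cont maps mm(1,2,3,4), of k] power_hull[OF cont maps mm(1,2,4,3), of k] by simp
  also have "\<dots> \<subseteq> (f ^^ k) ` ((f ^^ m) ` {x..y})" using sub by blast
  also have "\<dots> = (f ^^ (k + m)) ` {x..y}" by (simp add: image_comp funpow_add)
  finally show ?thesis using pq by blast
qed

text \<open>
  The lattice map: \<open>8E\<close> and \<open>20E\<close> are turning points of period two, \<open>14E\<close> is a repelling fixed
  point, and \<open>{0..E}\<close> is a zigzag of unit laps between \<open>14E - 1\<close> and \<open>14E\<close>.
\<close>

definition lattice_map :: "int \<Rightarrow> int \<Rightarrow> int" where
  "lattice_map E i =
    (if i \<le> E then 14 * E - (E - i) mod 2 else if i \<le> 6 * E then 2 * i + 12 * E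
     else if i \<le> 8 * E then 36 * E - 2 * i else if i \<le> 10 * E then i + 12 * E
     else if i \<le> 18 * E then 42 * E - 2 * i else if i \<le> 20 * E then i - 12 * E else 48 * E - 2 * i)"

text \<open>\<open>C i j\<close> stands for: some iterate of a given interval covers
  \<open>[i, j]\<close>. Since \<open>step\<close> speaks only of the lattice values at the two
  ends, the integer argument below applies to the base map and to its perturbations alike.\<close>

locale lattice_cover =
  fixes E :: int and C :: "int \<Rightarrow> int \<Rightarrow> bool"
  assumes E: "1 \<le> E"
    and sub: "\<And>i j k l. C i j \<Longrightarrow> i \<le> k \<Longrightarrow> k < l \<Longrightarrow> l \<le> j \<Longrightarrow> C k l"
    and step: "\<And>i j. C i j \<Longrightarrow> 0 \<le> i \<Longrightarrow> i < j \<Longrightarrow> j \<le> 24 * E \<Longrightarrow>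
      C (min (lattice_map E i) (lattice_map E j)) (max (lattice_map E i) (lattice_map E j))"
begin

text \<open>Both sides of the fixed point \<open>14 * E\<close>, possibly covered by different
  iterates. This suffices for covering cells, each of which lies on one side of that point.\<close>

definition full :: bool where "full \<longleftrightarrow> C 0 (14 * E) \<and> C (14 * E) (24 * E)"

lemma stepI:
  assumes "C i j" "0 \<le> i" "i < j" "j \<le> 24 * E" "lattice_map E i = k \<and> lattice_map E j = l \<or> lattice_map E i = l \<and> lattice_map E j = k"
    "k \<le> l"
  shows "C k l"
  using step[OF assms(1-4)] assms(5,6) by (auto simp: min_def max_def split: if_splits)

lemma full_right: "C (10 * E) (14 * E) \<Longrightarrow> full"
proof -
  assume 1: "C (10 * E) (14 * E)"
  have "C (14 * E) (22 * E)" by (rule stepI[OF 1]) (use E in \<open>auto simp: lattice_map_def\<close>)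
  then have 2: "C (14 * E) (18 * E)" by (rule sub) (use E in auto)
  have 3: "C (6 * E) (14 * E)" by (rule stepI[OF 2]) (use E in \<open>auto simp: lattice_map_def\<close>)
  have 4: "C (14 * E) (24 * E)" by (rule stepI[OF 3]) (use E in \<open>auto simp: lattice_map_def\<close>)
  have "C 0 (14 * E)" by (rule stepI[OF 4]) (use E in \<open>auto simp: lattice_map_def\<close>)
  then show full using 4 by (simp add: full_def)
qed

text \<open>The map has slope -2 at the fixed point: a one-sided neighbourhood changes sides and
  doubles in each step until it yields \<open>[10 * E, 14 * E]\<close>.\<close>

lemma full_fixed: "1 \<le> d \<Longrightarrow> d \<le> 4 * E \<Longrightarrow> C (14 * E - d) (14 * E) \<or> C (14 * E) (14 * E + d) \<Longrightarrow> full"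
proof (induction "nat (4 * E - d)" arbitrary: d rule: less_induct)
  case less
  show ?case
  proof (cases "2 * d \<le> 4 * E")
    case True
    from less(4) have "C (14 * E - 2 * d) (14 * E) \<or> C (14 * E) (14 * E + 2 * d)"
    proof
      assume 1: "C (14 * E - d) (14 * E)"
      have "C (14 * E) (14 * E + 2 * d)" by (rule stepI[OF 1]) (use E less True in \<open>auto simp: lattice_map_def\<close>)
      then show ?thesis ..
    next
      assume 1: "C (14 * E) (14 * E + d)"
      have "C (14 * E - 2 * d) (14 * E)" by (rule stepI[OF 1]) (use E less True in \<open>auto simp: lattice_map_def\<close>)
      then show ?thesis ..
    qed
    then show ?thesis by (intro less(1)[of "2 * d"]) (use less True E in auto)
  next
    case False
    from less(4) show ?thesis
    proof
      assume 1: "C (14 * E - d) (14 * E)"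
      have "C (14 * E) (14 * E + 2 * d)" by (rule stepI[OF 1]) (use E less False in \<open>auto simp: lattice_map_def\<close>)
      then have 2: "C (14 * E) (18 * E)" by (rule sub) (use E False in auto)
      have "C (6 * E) (14 * E)" by (rule stepI[OF 2]) (use E in \<open>auto simp: lattice_map_def\<close>)
      then have "C (10 * E) (14 * E)" by (rule sub) (use E in auto)
      then show ?thesis by (rule full_right)
    next
      assume 1: "C (14 * E) (14 * E + d)"
      have "C (14 * E - 2 * d) (14 * E)" by (rule stepI[OF 1]) (use E less False in \<open>auto simp: lattice_map_def\<close>)
      then have "C (10 * E) (14 * E)" by (rule sub) (use E False in auto)
      then show ?thesis by (rule full_right)
    qed
  qed
qed

text \<open>Each unit lap is mapped onto the lattice cell just left of the fixed point; hence
  nothing can be trapped in the zigzag.\<close>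

lemma full_zigzag: assumes "C k (k + 1)" "0 \<le> k" "k < E" shows full
proof -
  have "lattice_map E k = 14 * E - (E - k) mod 2" "lattice_map E (k + 1) = 14 * E - (E - (k + 1)) mod 2"
    using assms by (auto simp: lattice_map_def)
  then have "lattice_map E k = 14 * E - 1 \<and> lattice_map E (k + 1) = 14 * E
    \<or> lattice_map E k = 14 * E \<and> lattice_map E (k + 1) = 14 * E - 1" by presburger
  then have "C (14 * E - 1) (14 * E)"
    by (intro stepI[OF assms(1)]) (use E assms in auto)
  then show ?thesis by (intro full_fixed[of 1]) (use E in auto)
qed

lemma full_zigzag': "C i j \<Longrightarrow> 0 \<le> i \<Longrightarrow> i < E \<Longrightarrow> i < j \<Longrightarrow> full"
  by (rule full_zigzag[of i]) (auto intro: sub)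

lemma full_periodic_top: assumes 1: "C (6 * E) (8 * E)" shows full
proof -
  have 2: "C (20 * E) (24 * E)" by (rule stepI[OF 1]) (use E in \<open>auto simp: lattice_map_def\<close>)
  have 3: "C 0 (8 * E)" by (rule stepI[OF 2]) (use E in \<open>auto simp: lattice_map_def\<close>)
  show ?thesis by (rule full_zigzag'[OF 3]) (use E in auto)
qed

text \<open>The left side of \<open>8 * E\<close> and the right side of \<open>20 * E\<close> are
  exchanged with slope -2, so a neighbourhood doubles until it contains
  \<open>[6 * E, 8 * E]\<close>, whose second image reaches the zigzag.\<close>

lemma full_periodic:
  "1 \<le> d \<Longrightarrow> d \<le> 2 * E \<Longrightarrow> C (8 * E - d) (8 * E) \<or> C (20 * E) (20 * E + d) \<Longrightarrow> full"
proof (induction "nat (2 * E - d)" arbitrary: d rule: less_induct)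
  case less
  have dbl: "C (8 * E - 2 * d) (8 * E) \<or> C (20 * E) (20 * E + 2 * d)"
    using less(4)
  proof
    assume 1: "C (8 * E - d) (8 * E)"
    have "C (20 * E) (20 * E + 2 * d)" by (rule stepI[OF 1]) (use E less in \<open>auto simp: lattice_map_def\<close>)
    then show ?thesis ..
  next
    assume 1: "C (20 * E) (20 * E + d)"
    have "C (8 * E - 2 * d) (8 * E)" by (rule stepI[OF 1]) (use E less in \<open>auto simp: lattice_map_def\<close>)
    then show ?thesis ..
  qed
  show ?case
  proof (cases "2 * d \<le> 2 * E")
    case True
    then show ?thesis by (intro less(1)[of "2 * d"] dbl) (use less in auto)
  next
    case False
    from dbl show ?thesis
    proof
      assume "C (8 * E - 2 * d) (8 * E)"
      then have "C (6 * E) (8 * E)" by (rule sub) (use False E in auto)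
      then show ?thesis by (rule full_periodic_top)
    next
      assume "C (20 * E) (20 * E + 2 * d)"
      then have 1: "C (20 * E) (22 * E)" by (rule sub) (use False E in auto)
      have "C (4 * E) (8 * E)" by (rule stepI[OF 1]) (use E in \<open>auto simp: lattice_map_def\<close>)
      then have "C (6 * E) (8 * E)" by (rule sub) (use E in auto)
      then show ?thesis by (rule full_periodic_top)
    qed
  qed
qed

lemma full_top: assumes "C (6 * E) (6 * E + 1) \<or> C (6 * E - 1) (6 * E)" shows full
proof -
  have 1: "C (24 * E - 2) (24 * E)"
    using assms by (elim disjE) (erule stepI, use E in \<open>auto simp: lattice_map_def\<close>)+
  have 2: "C 0 4" by (rule stepI[OF 1]) (use E in \<open>auto simp: lattice_map_def\<close>)
  show ?thesis by (rule full_zigzag'[OF 2]) (use E in auto)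
qed

text \<open>The unit cell to the left of each turning point is followed until it meets a known case:
  \<open>6 * E\<close> goes to the right end and then to 0 in the zigzag, \<open>18 * E\<close> goes
  to \<open>6 * E\<close>, and the other three arrive at the cycle.\<close>

lemma full_turning:
  assumes "t \<in> {6 * E, 8 * E, 10 * E, 18 * E, 20 * E}" "C (t - 1) t"
  shows full
proof -
  consider "t = 6 * E" | "t = 8 * E" | "t = 10 * E" | "t = 18 * E" | "t = 20 * E" using assms by auto
  then show ?thesis
  proof cases
    case 1
    then show ?thesis using assms full_top by simp
  next
    case 2
    then show ?thesis using assms E by (intro full_periodic[of 1]) auto
  next
    case 3
    have 4: "C (22 * E - 1) (22 * E)"
      by (rule stepI[OF assms(2)]) (use E 3 in \<open>auto simp: lattice_map_def\<close>)
    have "C (4 * E) (4 * E + 2)" by (rule stepI[OF 4]) (use E in \<open>auto simp: lattice_map_def\<close>)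
    then have 5: "C (4 * E) (4 * E + 1)" by (rule sub) auto
    have 6: "C (20 * E) (20 * E + 2)" by (rule stepI[OF 5]) (use E in \<open>auto simp: lattice_map_def\<close>)
    have "C (20 * E) (20 * E + 1)" by (rule sub[OF 6]) auto
    then show ?thesis using E by (intro full_periodic[of 1]) auto
  next
    case 4
    have "C (6 * E) (6 * E + 2)"
      by (rule stepI[OF assms(2)]) (use E 4 in \<open>auto simp: lattice_map_def\<close>)
    then have "C (6 * E) (6 * E + 1)" by (rule sub) auto
    then show ?thesis using full_top by simp
  next
    case 5
    have "C (8 * E - 1) (8 * E)"
      by (rule stepI[OF assms(2)]) (use E 5 in \<open>auto simp: lattice_map_def\<close>)
    then show ?thesis using E by (intro full_periodic[of 1]) auto
  qed
qed

text \<open>An interval that avoids the zigzag and has no turning point inside doubles in one step,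
  or in two steps on the pieces of slope 1. As its length is bounded, one of the preceding cases
  must occur eventually.\<close>

lemma full: "C i j \<Longrightarrow> 0 \<le> i \<Longrightarrow> i < j \<Longrightarrow> j \<le> 24 * E \<Longrightarrow> full"
proof (induction "nat (24 * E - (j - i))" arbitrary: i j rule: less_induct)
  case less
  note IH = less(1) and C = less(2) and ij = less(3-5)
  have rec: full if "C k l" "0 \<le> k" "l \<le> 24 * E" "l - k = 2 * (j - i)" for k l
    by (rule IH[of l k]) (use that ij in auto)
  show ?case
  proof (cases "i < E \<or> (\<exists>t\<in>{6 * E, 8 * E, 10 * E, 18 * E, 20 * E}. i < t \<and> t < j)")
    case True
    then show ?thesis
    proof
      assume "i < E"
      then show ?thesis using full_zigzag'[OF C] ij by simp
    next
      assume "\<exists>t\<in>{6 * E, 8 * E, 10 * E, 18 * E, 20 * E}. i < t \<and> t < j"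
      then obtain t where t: "t \<in> {6 * E, 8 * E, 10 * E, 18 * E, 20 * E}" "i < t" "t < j" by blast
      have "C (t - 1) t" by (rule sub[OF C]) (use t in auto)
      then show ?thesis by (rule full_turning[OF t(1)])
    qed
  next
    case False
    then have iE: "E \<le> i" and no: "\<And>t. t \<in> {6 * E, 8 * E, 10 * E, 18 * E, 20 * E} \<Longrightarrow> t \<le> i \<or> j \<le> t"
      by (auto simp: not_less)
    consider "j \<le> 6 * E" | "6 * E \<le> i" "j \<le> 8 * E" | "8 * E \<le> i" "j \<le> 10 * E"
      | "10 * E \<le> i" "j \<le> 18 * E" | "18 * E \<le> i" "j \<le> 20 * E" | "20 * E \<le> i"
      using no[of "6 * E"] no[of "8 * E"] no[of "10 * E"] no[of "18 * E"] no[of "20 * E"] by auto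
    then show ?thesis
    proof cases
      case 1
      have "C (2 * i + 12 * E) (2 * j + 12 * E)"
        by (rule stepI[OF C]) (use 1 ij iE E in \<open>auto simp: lattice_map_def\<close>)
      then show ?thesis by (rule rec) (use 1 ij iE E in auto)
    next
      case 2
      have "C (36 * E - 2 * j) (36 * E - 2 * i)"
        by (rule stepI[OF C]) (use 2 ij iE E in \<open>auto simp: lattice_map_def\<close>)
      then show ?thesis by (rule rec) (use 2 ij iE E in auto)
    next
      case 3
      have 4: "C (i + 12 * E) (j + 12 * E)"
        by (rule stepI[OF C]) (use 3 ij iE E in \<open>auto simp: lattice_map_def\<close>)
      have "C (48 * E - 2 * (j + 12 * E)) (48 * E - 2 * (i + 12 * E))"
        by (rule stepI[OF 4]) (use 3 ij iE E in \<open>auto simp: lattice_map_def\<close>)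
      then show ?thesis by (rule rec) (use 3 ij iE E in auto)
    next
      case 4
      have "C (42 * E - 2 * j) (42 * E - 2 * i)"
        by (rule stepI[OF C]) (use 4 ij iE E in \<open>auto simp: lattice_map_def\<close>)
      then show ?thesis by (rule rec) (use 4 ij iE E in auto)
    next
      case 5
      have 6: "C (i - 12 * E) (j - 12 * E)"
        by (rule stepI[OF C]) (use 5 ij iE E in \<open>auto simp: lattice_map_def\<close>)
      have "C (36 * E - 2 * (j - 12 * E)) (36 * E - 2 * (i - 12 * E))"
        by (rule stepI[OF 6]) (use 5 ij iE E in \<open>auto simp: lattice_map_def\<close>)
      then show ?thesis by (rule rec) (use 5 ij iE E in auto)
    next
      case 6
      have "C (48 * E - 2 * j) (48 * E - 2 * i)"
        by (rule stepI[OF C]) (use 6 ij iE E in \<open>auto simp: lattice_map_def\<close>)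
      then show ?thesis by (rule rec) (use 6 ij iE E in auto)
    qed
  qed
qed

end

section \<open>Maps with the shape of the lattice map\<close>

text \<open>With \<open>\<sigma>\<close> equal to 1 or -1 as direction, this is a lower bound
  \<open>c\<close> for the rate of change. Unlike affine formulas, such bounds can be joined across
  break points.\<close>

definition steep :: "real \<Rightarrow> real \<Rightarrow> (real \<Rightarrow> real) \<Rightarrow> real \<Rightarrow> real \<Rightarrow> bool" where
  "steep \<sigma> c f x y \<longleftrightarrow> (\<forall>u v. x \<le> u \<longrightarrow> u \<le> v \<longrightarrow> v \<le> y \<longrightarrow> c * (v - u) \<le> \<sigma> * (f v - f u))"

lemma steepD: "steep \<sigma> c f x y \<Longrightarrow> x \<le> u \<Longrightarrow> u \<le> v \<Longrightarrow> v \<le> y \<Longrightarrow> c * (v - u) \<le> \<sigma> * (f v - f u)"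
  by (simp add: steep_def)

lemma steep_join:
  assumes "steep \<sigma> c f x y" "steep \<sigma> c f y z" shows "steep \<sigma> c f x z"
  unfolding steep_def
proof (intro allI impI)
  fix u v assume uv: "x \<le> u" "u \<le> v" "v \<le> z"
  consider "v \<le> y" | "y \<le> u" | "u \<le> y" "y \<le> v" by linarith
  then show "c * (v - u) \<le> \<sigma> * (f v - f u)"
  proof cases
    case 3
    have "c * (v - y) \<le> \<sigma> * (f v - f y)" "c * (y - u) \<le> \<sigma> * (f y - f u)"
      using steepD[OF assms(1), of u y] steepD[OF assms(2), of y v] uv 3 by auto
    then show ?thesis by (simp add: algebra_simps)
  qed (use uv steepD[OF assms(1)] steepD[OF assms(2)] in auto)
qed

lemma steep_affine:
  assumes "\<And>t. x \<le> t \<Longrightarrow> t \<le> y \<Longrightarrow> f t = m * t + k" "c \<le> \<sigma> * m" shows "steep \<sigma> c f x y"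
  unfolding steep_def
proof (intro allI impI)
  fix u v assume uv: "x \<le> u" "u \<le> v" "v \<le> y"
  then have "f u = m * u + k" "f v = m * v + k" using assms(1) by auto
  then have "f v - f u = m * (v - u)" by (simp add: algebra_simps)
  then show "c * (v - u) \<le> \<sigma> * (f v - f u)"
    using mult_right_mono[OF assms(2), of "v - u"] uv by (simp add: mult.assoc)
qed

lemma steep_sub: "steep \<sigma> c f x y \<Longrightarrow> x \<le> u \<Longrightarrow> v \<le> y \<Longrightarrow> steep \<sigma> c f u v"
  by (simp add: steep_def)

lemma steep_weaken: assumes "steep \<sigma> c f x y" "d \<le> c" shows "steep \<sigma> d f x y"
  unfolding steep_def
proof (intro allI impI)
  fix u v assume "x \<le> u" "u \<le> v" "v \<le> y"
  then have "d * (v - u) \<le> c * (v - u)" "c * (v - u) \<le> \<sigma> * (f v - f u)"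
    using assms by (auto intro: mult_right_mono steepD)
  then show "d * (v - u) \<le> \<sigma> * (f v - f u)" by linarith
qed

lemma steep_abs:
  assumes "steep \<sigma> c f x y" "\<bar>\<sigma>\<bar> = 1" "u \<in> {x..y}" "v \<in> {x..y}"
  shows "c * \<bar>u - v\<bar> \<le> \<bar>f u - f v\<bar>"
proof -
  have *: "c * (v' - u') \<le> \<bar>f v' - f u'\<bar>" if "x \<le> u'" "u' \<le> v'" "v' \<le> y" for u' v'
  proof -
    have "c * (v' - u') \<le> \<sigma> * (f v' - f u')" using steepD[OF assms(1)] that by blast
    also have "\<dots> \<le> \<bar>\<sigma> * (f v' - f u')\<bar>" by (rule abs_ge_self)
    finally show ?thesis using assms(2) by (simp add: abs_mult)
  qed
  show ?thesis using *[of u v] *[of v u] assms(3,4) by (cases "u \<le> v") (auto simp: abs_minus_commute)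
qed

lemma steep_inj: assumes "steep \<sigma> c f x y" "\<bar>\<sigma>\<bar> = 1" "0 < c" shows "inj_on f {x..y}"
proof (rule inj_onI)
  fix u v assume "u \<in> {x..y}" "v \<in> {x..y}" "f u = f v"
  then have "c * \<bar>u - v\<bar> \<le> 0" using steep_abs[OF assms(1,2), of u v] by simp
  then show "u = v" using assms(3) by (simp add: mult_le_0_iff)
qed

lemma steep_turn:
  assumes l: "steep \<sigma> c f p t" and r: "steep (- \<sigma>) c f t q" and c: "0 < c" and p: "p < t" "t < q" and xy: "x < t" "t < y"
  shows "\<not> monotone_piece f {x..y}"
proof -
  \<comment> \<open>Clipping puts both comparison points inside \<open>[x, y]\<close> and inside the
    range of the two bounds; \<open>t\<close> is then a strict extremum between them.\<close>
  define u v where "u = max x p" and "v = min y q"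
  have uv: "p \<le> u" "u < t" "t < v" "v \<le> q" "u \<in> {x..y}" "v \<in> {x..y}" "t \<in> {x..y}"
    using p xy by (auto simp: u_def v_def)
  have "0 < c * (t - u)" "0 < c * (v - t)" using uv c by auto
  then have "0 < \<sigma> * (f t - f u)" "0 < - \<sigma> * (f v - f t)"
    using steepD[OF l, of u t] steepD[OF r, of t v] uv by auto
  then have *: "f u < f t \<and> f v < f t \<or> f t < f u \<and> f t < f v" by (auto simp: zero_less_mult_iff mult_less_0_iff)
  show ?thesis
  proof
    assume "monotone_piece f {x..y}"
    then have "f u \<le> f t \<and> f t \<le> f v \<or> f t \<le> f u \<and> f v \<le> f t"
      unfolding monotone_piece_def using uv by (auto simp: monotone_on_def)
    then show False using * by linarith
  qed
qed

lemma continuous_on_join: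
  fixes f :: "real \<Rightarrow> real"
  assumes "continuous_on {x..y} f" "continuous_on {y..z} f" "x \<le> y" "y \<le> z"
  shows "continuous_on {x..z} f"
proof -
  have "continuous_on ({x..y} \<union> {y..z}) f" using assms by (intro continuous_on_closed_Un) auto
  then show ?thesis using ivl_disj_un_two_touch(4)[OF assms(3,4)] by simp
qed

text \<open>\<open>real E\<close> is absent: the last unit lap increases and continues into the
  increasing piece up to \<open>6 * real E\<close>. This leaves \<open>E + 5\<close> laps, that is
  modality \<open>E + 4\<close>.\<close>

definition turning_points :: "nat \<Rightarrow> real set" where
  "turning_points E = real ` {..<E} \<union> {6 * real E, 8 * real E, 10 * real E, 18 * real E, 20 * real E, 24 * real E}"

lemma card_turning_points:
  assumes "1 \<le> E" shows "card (turning_points E) = E + 6"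
proof -
  have "real E \<ge> 1" using assms by simp
  then have "card {6 * real E, 8 * real E, 10 * real E, 18 * real E, 20 * real E, 24 * real E} = 6" by simp
  moreover have "real ` {..<E} \<inter> {6 * real E, 8 * real E, 10 * real E, 18 * real E, 20 * real E, 24 * real E} = {}"
    by auto
  moreover have "card (real ` {..<E}) = E" by (simp add: card_image)
  ultimately show ?thesis unfolding turning_points_def by (subst card_Un_disjoint) auto
qed

text \<open>What the base map (\<open>d = 0\<close>) and the perturbations have in common;
  \<open>d\<close> is the half-width of the blown-up points. \<open>slow1\<close>,
  \<open>slow2\<close> and \<open>zig_range\<close> place the images of the slope 1 pieces in pieces
  of slope at least 2. \<open>cell\<close> leads from the partition \<open>P\<close>, which may be
  finer, back to the lattice.\<close>

locale shape =
  fixes E :: nat and d :: real and h :: "real \<Rightarrow> real" and P :: "real set"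
  assumes E: "1 \<le> E" and d: "0 \<le> d" "d < 1"
    and fin: "finite P" and P_sub: "P \<subseteq> {0..24 * real E}"
    and ints: "\<And>i. 0 \<le> i \<Longrightarrow> i \<le> 24 * int E \<Longrightarrow> real_of_int i \<in> P"
    and breaks: "8 * real E + d \<in> P" "20 * real E - d \<in> P"
    and cont: "continuous_on {0..24 * real E} h" and maps: "h ` {0..24 * real E} \<subseteq> {0..24 * real E}" and inv: "h ` P \<subseteq> P"
    and zig: "\<And>k. k < E \<Longrightarrow> steep ((- 1) ^ (E - Suc k)) 1 h (real k) (real k + 1)"
    and zig_range: "\<And>x. 0 \<le> x \<Longrightarrow> x \<le> real E \<Longrightarrow> 14 * real E - 1 \<le> h x \<and> h x \<le> 14 * real E"
    and s1: "steep 1 2 h (real E) (6 * real E)" and s2: "steep (- 1) 2 h (6 * real E) (8 * real E)"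
    and s3: "steep 1 2 h (8 * real E) (8 * real E + d)" and s4: "steep 1 1 h (8 * real E + d) (10 * real E)"
    and s5: "steep (- 1) 2 h (10 * real E) (18 * real E)" and s6: "steep 1 1 h (18 * real E) (20 * real E - d)"
    and s7: "steep 1 2 h (20 * real E - d) (20 * real E)" and s8: "steep (- 1) 2 h (20 * real E) (24 * real E)"
    and slow1: "\<And>x. 8 * real E + d \<le> x \<Longrightarrow> x \<le> 10 * real E \<Longrightarrow> 20 * real E \<le> h x"
    and slow2: "\<And>x. 18 * real E \<le> x \<Longrightarrow> x \<le> 20 * real E - d \<Longrightarrow> 6 * real E \<le> h x \<and> h x \<le> 8 * real E"
    and lattice: "\<And>i. 0 \<le> i \<Longrightarrow> i < 24 * int E \<Longrightarrow>
      real_of_int (lattice_map (int E) i) \<in> h ` {real_of_int i..real_of_int i + 1} \<and>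
      real_of_int (lattice_map (int E) (i + 1)) \<in> h ` {real_of_int i..real_of_int i + 1}"
    and cell: "\<And>p q. p \<in> P \<Longrightarrow> q \<in> P \<Longrightarrow> p < q \<Longrightarrow>
      \<exists>m i. 0 \<le> i \<and> i < 24 * int E \<and> {real_of_int i..real_of_int i + 1} \<subseteq> (h ^^ m) ` {p..q}"
    and branch: "\<exists>p\<in>P. \<exists>q\<in>P. p < q \<and> adj P p q \<and> \<not> adj P (h p) (h q)"
begin

abbreviation "e \<equiv> real E"

lemma e: "1 \<le> e" using E by simp

lemma nat_P: "k \<le> 24 * E \<Longrightarrow> real k \<in> P"
  using ints[of "int k"] by simp

lemma mult_P: "k \<le> 24 \<Longrightarrow> real k * e \<in> P"
  using nat_P[of "k * E"] by simp

lemma points_P: "e \<in> P" "6 * e \<in> P" "8 * e \<in> P" "10 * e \<in> P" "14 * e \<in> P" "18 * e \<in> P" "20 * e \<in> P" "24 * e \<in> P"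
  using mult_P[of 1] mult_P[of 6] mult_P[of 8] mult_P[of 10] mult_P[of 14] mult_P[of 18] mult_P[of 20] mult_P[of 24] by auto

lemma s34: "steep 1 1 h (8 * e) (10 * e)"
  by (rule steep_join[OF steep_weaken[OF s3] s4]) simp

lemma s67: "steep 1 1 h (18 * e) (20 * e)"
  by (rule steep_join[OF s6 steep_weaken[OF s7]]) simp

lemma s01: "steep 1 1 h (e - 1) (6 * e)"
proof (rule steep_join[OF _ steep_weaken[OF s1]])
  have "steep 1 1 h (real (E - 1)) (real (E - 1) + 1)" using zig[of "E - 1"] E by simp
  then show "steep 1 1 h (e - 1) e" using E by (simp add: of_nat_diff)
qed simp

lemma floor_cell:
  assumes "0 \<le> x" "x < real E"
  obtains k where "k < E" "real k \<le> x" "x < real k + 1"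
proof
  show "nat \<lfloor>x\<rfloor> < E" "real (nat \<lfloor>x\<rfloor>) \<le> x" "x < real (nat \<lfloor>x\<rfloor>) + 1" using assms by linarith+
qed

text \<open>Adjacent points lie in one piece, because all break points belong to \<open>P\<close>.
  Steep pieces give the first alternative; the zigzag and the two slow pieces give the second, their
  images lying around \<open>14 * e\<close>, right of \<open>20 * e\<close> and in
  \<open>[6 * e, 8 * e]\<close>.\<close>

lemma piece:
  assumes x: "0 \<le> x" "x < y" "y \<le> 24 * e" and adj: "adj P x y"
  shows "2 * \<bar>x - y\<bar> \<le> \<bar>h x - h y\<bar> \<or> \<bar>x - y\<bar> \<le> \<bar>h x - h y\<bar> \<and> 2 * \<bar>h x - h y\<bar> \<le> \<bar>h (h x) - h (h y)\<bar>"
proof -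
  have no: "t \<le> x \<or> y \<le> t" if "t \<in> P" for t using adj that by (auto simp: adj_def not_less)
  note no' = no[OF points_P(1)] no[OF points_P(2)] no[OF points_P(3)] no[OF points_P(4)] no[OF points_P(6)]
    no[OF points_P(7)] no[OF breaks(1)] no[OF breaks(2)]
  have c2: "2 * \<bar>x - y\<bar> \<le> \<bar>h x - h y\<bar>" if "steep \<sigma> 2 h u v" "\<bar>\<sigma>\<bar> = 1" "u \<le> x" "y \<le> v" for \<sigma> u v
    using steep_abs[OF that(1,2), of x y] that x by simp
  have c1: "\<bar>x - y\<bar> \<le> \<bar>h x - h y\<bar>" if "steep \<sigma> 1 h u v" "\<bar>\<sigma>\<bar> = 1" "u \<le> x" "y \<le> v" for \<sigma> u v
    using steep_abs[OF that(1,2), of x y] that x by simp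
  have xab: "h x \<le> 24 * e" "h y \<le> 24 * e" using maps x by (auto simp: image_subset_iff)
  consider "x < e" | "e \<le> x" "y \<le> 6 * e" | "6 * e \<le> x" "y \<le> 8 * e" | "8 * e \<le> x" "y \<le> 8 * e + d"
    | "8 * e + d \<le> x" "y \<le> 10 * e" | "10 * e \<le> x" "y \<le> 18 * e" | "18 * e \<le> x" "y \<le> 20 * e - d"
    | "20 * e - d \<le> x" "y \<le> 20 * e" | "20 * e \<le> x"
    using no' not_less[of x e] by blast
  then show ?thesis
  proof cases
    case 1
    obtain k where k: "k < E" "real k \<le> x" "x < real k + 1" using floor_cell[OF x(1) 1] .
    have "y \<le> real k + 1" using no[of "real (Suc k)"] nat_P[of "Suc k"] k by auto
    then have y: "y \<le> real k + 1" "y \<le> e" using k(1) by linarith+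
    have "\<bar>x - y\<bar> \<le> \<bar>h x - h y\<bar>" by (rule c1[OF zig[OF k(1)] _ k(2) y(1)]) (simp add: power_abs)
    moreover have "2 * \<bar>h x - h y\<bar> \<le> \<bar>h (h x) - h (h y)\<bar>"
    proof (rule steep_abs[OF s5])
      have "14 * e - 1 \<le> h x \<and> h x \<le> 14 * e" "14 * e - 1 \<le> h y \<and> h y \<le> 14 * e"
        using zig_range x y by auto
      then show "h x \<in> {10 * e..18 * e}" "h y \<in> {10 * e..18 * e}" using e unfolding atLeastAtMost_iff by linarith+
    qed simp
    ultimately show ?thesis by blast
  next
    case 5
    have "2 * \<bar>h x - h y\<bar> \<le> \<bar>h (h x) - h (h y)\<bar>"
      using steep_abs[OF s8, of "h x" "h y"] slow1[of x] slow1[of y] x 5 xab by simp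
    then show ?thesis using c1[OF s4] 5 by simp
  next
    case 7
    have "2 * \<bar>h x - h y\<bar> \<le> \<bar>h (h x) - h (h y)\<bar>"
      using steep_abs[OF s2, of "h x" "h y"] slow2[of x] slow2[of y] x 7 by simp
    then show ?thesis using c1[OF s6] 7 by simp
  qed (use c2[OF s1] c2[OF s2] c2[OF s3] c2[OF s5] c2[OF s7] c2[OF s8] x in simp_all)
qed

lemma expansion:
  assumes xy: "x \<in> {0..24 * e}" "y \<in> {0..24 * e}" and adj: "adj P x y" "adj P (h x) (h y)"
  shows "2 * \<bar>x - y\<bar> \<le> \<bar>h (h x) - h (h y)\<bar>"
proof -
  have weak: "\<bar>u - v\<bar> \<le> \<bar>h u - h v\<bar>" if uv: "u \<in> {0..24 * e}" "v \<in> {0..24 * e}" "adj P u v" for u v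
    using piece[of u v] piece[of v u] uv adj_sym[OF uv(3)]
    by (cases u v rule: linorder_cases) (auto simp: abs_minus_commute)
  have h: "h x \<in> {0..24 * e}" "h y \<in> {0..24 * e}" using maps xy by blast+
  have *: "2 * \<bar>x - y\<bar> \<le> \<bar>h x - h y\<bar> \<or> \<bar>x - y\<bar> \<le> \<bar>h x - h y\<bar> \<and> 2 * \<bar>h x - h y\<bar> \<le> \<bar>h (h x) - h (h y)\<bar>"
    using piece[of x y] piece[of y x] xy adj(1) adj_sym[OF adj(1)]
    by (cases x y rule: linorder_cases) (auto simp: abs_minus_commute)
  then show ?thesis
  proof
    assume "2 * \<bar>x - y\<bar> \<le> \<bar>h x - h y\<bar>"
    then show ?thesis using weak[OF h adj(2)] by (rule order_trans)
  next
    assume a: "\<bar>x - y\<bar> \<le> \<bar>h x - h y\<bar> \<and> 2 * \<bar>h x - h y\<bar> \<le> \<bar>h (h x) - h (h y)\<bar>"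
    then have "2 * \<bar>x - y\<bar> \<le> 2 * \<bar>h x - h y\<bar>" by simp
    then show ?thesis using a by (meson order_trans)
  qed
qed

text \<open>Expansion produces an interval between two points of \<open>P\<close>,
  \<open>cell\<close> turns it into a lattice cell, and \<open>lattice_cover\<close> spreads this
  cell over both sides of the fixed point.\<close>

lemma covers:
  assumes xy: "0 \<le> x" "x < y" "y \<le> 24 * e" and pq: "p \<in> P" "q \<in> P" "p < q" "adj P p q"
  shows "\<exists>m. {p..q} \<subseteq> (h ^^ m) ` {x..y}"
proof -
  obtain m r s where rs: "r \<in> P" "s \<in> P" "r < s" "{r..s} \<subseteq> (h ^^ m) ` {x..y}"
    using expansion_covers[OF cont maps P_sub inv expansion xy] by blast
  obtain k i where i: "0 \<le> i" "i < 24 * int E" "{real_of_int i..real_of_int i + 1} \<subseteq> (h ^^ k) ` {r..s}"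
    using cell[OF rs(1-3)] by blast
  define C where "C i j \<longleftrightarrow> (\<exists>m. {real_of_int i..real_of_int j} \<subseteq> (h ^^ m) ` {x..y})" for i j
  interpret lattice_cover "int E" C
  proof
    show "1 \<le> int E" using E by simp
    show "C k l" if C: "C i j" and kl: "i \<le> k" "k < l" "l \<le> j" for i j k l
    proof -
      have "{real_of_int k..real_of_int l} \<subseteq> {real_of_int i..real_of_int j}" using kl by auto
      then show ?thesis using C unfolding C_def by (meson subset_trans)
    qed
    fix i j assume C: "C i j" and ij: "0 \<le> i" "i < j" "j \<le> 24 * int E"
    let ?F = "lattice_map (int E)"
    have "{real_of_int i..real_of_int i + 1} \<subseteq> {real_of_int i..real_of_int j}"
      "{real_of_int (j - 1)..real_of_int (j - 1) + 1} \<subseteq> {real_of_int i..real_of_int j}"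
      using ij by auto
    then have F: "real_of_int (?F i) \<in> h ` {real_of_int i..real_of_int j}" "real_of_int (?F j) \<in> h ` {real_of_int i..real_of_int j}"
      using lattice[of i] lattice[of "j - 1"] ij by auto
    have "{real_of_int i..real_of_int j} \<subseteq> {0..24 * e}"
    proof -
      have "real_of_int j \<le> real_of_int (24 * int E)" using ij by (simp only: of_int_le_iff)
      then show ?thesis using ij by auto
    qed
    then have "{real_of_int (?F i)..real_of_int (?F j)} \<subseteq> h ` {real_of_int i..real_of_int j}"
      "{real_of_int (?F j)..real_of_int (?F i)} \<subseteq> h ` {real_of_int i..real_of_int j}"
      using connected_image_interval[OF cont _ _ F(1,2)] connected_image_interval[OF cont _ _ F(2,1)] by simp_all
    then have "{real_of_int (min (?F i) (?F j))..real_of_int (max (?F i) (?F j))} \<subseteq> h ` {real_of_int i..real_of_int j}"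
      by (simp add: min_def max_def)
    moreover obtain m where "{real_of_int i..real_of_int j} \<subseteq> (h ^^ m) ` {x..y}" using C by (auto simp: C_def)
    ultimately have "{real_of_int (min (?F i) (?F j))..real_of_int (max (?F i) (?F j))} \<subseteq> h ` (h ^^ m) ` {x..y}"
      by (meson image_mono subset_trans)
    then show "C (min (?F i) (?F j)) (max (?F i) (?F j))"
      unfolding C_def by (intro exI[of _ "Suc m"]) (simp add: image_comp)
  qed
  have "{real_of_int i..real_of_int i + 1} \<subseteq> (h ^^ k) ` (h ^^ m) ` {x..y}" using i(3) rs(4) by (meson image_mono subset_trans)
  then have "C i (i + 1)" unfolding C_def by (intro exI[of _ "k + m"]) (simp add: image_comp funpow_add)
  then have "full" using i by (intro full[of i "i + 1"]) auto
  then have f: "C 0 (14 * int E)" "C (14 * int E) (24 * int E)" by (auto simp: full_def)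
  \<comment> \<open>The fixed point is a partition point, so the target cell lies on one side of
    it.\<close>
  have "q \<le> 14 * e \<or> 14 * e \<le> p" using pq(4) points_P(5) by (auto simp: adj_def not_less)
  moreover have "0 \<le> p" "q \<le> 24 * e" using pq P_sub by auto
  ultimately have "{p..q} \<subseteq> {real_of_int 0..real_of_int (14 * int E)} \<or> {p..q} \<subseteq> {real_of_int (14 * int E)..real_of_int (24 * int E)}"
    by auto
  then show ?thesis using f unfolding C_def by (meson subset_trans)
qed

lemma turning_inj:
  assumes xy: "0 \<le> x" "x < y" "y \<le> 24 * e" and adj: "adj (turning_points E) x y"
  shows "inj_on h {x..y}"
proof -
  have no: "t \<le> x \<or> y \<le> t" if "t \<in> turning_points E" for t using adj that by (auto simp: adj_def not_less)
  have i: "inj_on h {x..y}" if "steep \<sigma> c h u v" "\<bar>\<sigma>\<bar> = 1" "0 < c" "u \<le> x" "y \<le> v" for \<sigma> c u v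
    using inj_on_subset[OF steep_inj[OF that(1-3)]] that by auto
  have "6 * e \<le> x \<or> y \<le> 6 * e" "8 * e \<le> x \<or> y \<le> 8 * e" "10 * e \<le> x \<or> y \<le> 10 * e" "18 * e \<le> x \<or> y \<le> 18 * e"
    "20 * e \<le> x \<or> y \<le> 20 * e" by (rule no, simp add: turning_points_def)+
  then consider "x < e - 1" | "e - 1 \<le> x" "y \<le> 6 * e" | "6 * e \<le> x" "y \<le> 8 * e"
    | "8 * e \<le> x" "y \<le> 10 * e" | "10 * e \<le> x" "y \<le> 18 * e" | "18 * e \<le> x" "y \<le> 20 * e" | "20 * e \<le> x"
    using not_less[of x "e - 1"] by blast
  then show ?thesis
  proof cases
    case 1
    then have "x < e" by simp
    obtain k where k: "k < E" "real k \<le> x" "x < real k + 1" using floor_cell[OF xy(1) \<open>x < e\<close>] .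
    then have "Suc k < E" using 1 by linarith
    then have "real (Suc k) \<in> turning_points E" unfolding turning_points_def by blast
    then have "y \<le> real k + 1" using no[of "real (Suc k)"] k by simp
    then show ?thesis by (intro i[OF zig[OF k(1)]]) (use k in \<open>auto simp: power_abs\<close>)
  next
    case 2 then show ?thesis by (intro i[OF s01]) auto
  next
    case 3 then show ?thesis by (intro i[OF s2]) auto
  next
    case 4 then show ?thesis by (intro i[OF s34]) auto
  next
    case 5 then show ?thesis by (intro i[OF s5]) auto
  next
    case 6 then show ?thesis by (intro i[OF s67]) auto
  next
    case 7 then show ?thesis using xy by (intro i[OF s8]) auto
  qed
qed

lemma turning_turn:
  assumes xy: "0 \<le> x" "x < t" "t < y" "y \<le> 24 * e" and t: "t \<in> turning_points E"
  shows "\<not> monotone_piece h {x..y}"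
proof -
  have w: "steep \<sigma> 1 h u v" if "steep \<sigma> 2 h u v" for \<sigma> u v by (rule steep_weaken[OF that]) simp
  consider k where "k < E" "t = real k" "0 < k" | "t = 6 * e" | "t = 8 * e" | "t = 10 * e" | "t = 18 * e" | "t = 20 * e"
    using t xy by (auto simp: turning_points_def)
  then show ?thesis
  proof cases
    case 1
    obtain j where j: "k = Suc j" using 1 by (cases k) auto
    have e1: "E - Suc j = Suc (E - Suc (Suc j))" using 1 j by simp
    have "steep ((- 1) ^ (E - Suc j)) 1 h (real j) t" using zig[of j] 1 j by (simp add: add.commute)
    moreover have "steep (- ((- 1) ^ (E - Suc j))) 1 h t (t + 1)" using zig[of k] 1 unfolding e1 by (simp add: j)
    ultimately show ?thesis by (rule steep_turn) (use xy 1 j in auto)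
  next
    case 2
    show ?thesis by (rule steep_turn[of 1 1 h e t "8 * e"]) (use w[OF s1] w[OF s2] 2 e xy in auto)
  next
    case 3
    show ?thesis by (rule steep_turn[of "- 1" 1 h "6 * e" t "10 * e"]) (use w[OF s2] s34 3 e xy in auto)
  next
    case 4
    show ?thesis by (rule steep_turn[of 1 1 h "8 * e" t "18 * e"]) (use w[OF s5] s34 4 e xy in auto)
  next
    case 5
    show ?thesis by (rule steep_turn[of "- 1" 1 h "10 * e" t "20 * e"]) (use w[OF s5] s67 5 e xy in auto)
  next
    case 6
    show ?thesis by (rule steep_turn[of 1 1 h "18 * e" t "24 * e"]) (use w[OF s8] s67 6 e xy in auto)
  qed
qed

lemma lap_map: "lap_map 0 (24 * e) h P (turning_points E)"
proof
  show "turning_points E \<subseteq> P" using points_P nat_P by (auto simp: turning_points_def)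
  show "0 \<in> turning_points E" using E by (auto simp: turning_points_def intro!: image_eqI[of _ _ 0])
  show "24 * e \<in> turning_points E" by (simp add: turning_points_def)
qed (use e fin P_sub cont maps inv turning_inj turning_turn covers branch in auto)

end

section \<open>The base map\<close>

text \<open>The triangle wave of period 2, which is the distance to the nearest even integer. In
  this closed form its continuity is immediate.\<close>

definition zigzag :: "real \<Rightarrow> real" where
  "zigzag z = arccos (cos (pi * z)) / pi"

lemma zigzag_shift:
  assumes "real k \<le> z" "z \<le> real k + 1"
  shows "zigzag z = (if even k then z - real k else real k + 1 - z)"
proof -
  define r where "r = z - real k"
  have r: "0 \<le> r" "r \<le> 1" using assms by (auto simp: r_def)
  have "cos (pi * z) = cos (pi * r + real k * pi)" by (simp add: r_def algebra_simps)
  also have "\<dots> = (- 1) ^ k * cos (pi * r)" by (simp add: cos_add)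
  finally have c: "cos (pi * z) = (- 1) ^ k * cos (pi * r)" .
  show ?thesis
  proof (cases "even k")
    case True
    then have "arccos (cos (pi * z)) = pi * r" unfolding c using r by (simp add: arccos_cos mult_left_le)
    then show ?thesis using True by (simp add: zigzag_def r_def)
  next
    case False
    then have "cos (pi * z) = cos (pi * (1 - r))" unfolding c by (simp add: algebra_simps cos_diff)
    then have "arccos (cos (pi * z)) = pi * (1 - r)" using r by (simp add: arccos_cos mult_left_le)
    then show ?thesis using False by (simp add: zigzag_def r_def)
  qed
qed

lemma zigzag_range: "0 \<le> zigzag z" "zigzag z \<le> 1"
  using arccos_lbound[of "cos (pi * z)"] arccos_ubound[of "cos (pi * z)"] by (auto simp: zigzag_def)

lemma zigzag_continuous: "continuous_on A zigzag"
  unfolding zigzag_def by (intro continuous_intros) auto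

lemma steep_point: "steep \<sigma> c f x x"
proof -
  have "u = v" if "x \<le> u" "u \<le> v" "v \<le> x" for u v using that by linarith
  then show ?thesis unfolding steep_def by (metis diff_self mult_zero_right order_refl)
qed

text \<open>Interpolates \<open>lattice_map\<close>. The wave is counted from \<open>real E\<close>
  leftwards, so that the value there is \<open>14 * real E\<close> and the adjacent lap increases,
  whatever the parity of \<open>E\<close>.\<close>

definition base :: "nat \<Rightarrow> real \<Rightarrow> real" where
  "base E x =
    (if x \<le> real E then 14 * real E - zigzag (real E - x) else if x \<le> 6 * real E then 2 * x + 12 * real E
     else if x \<le> 8 * real E then 36 * real E - 2 * x else if x \<le> 10 * real E then x + 12 * real E
     else if x \<le> 18 * real E then 42 * real E - 2 * x else if x \<le> 20 * real E then x - 12 * real E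
     else 48 * real E - 2 * x)"

definition lattice_points :: "nat \<Rightarrow> real set" where
  "lattice_points E = real_of_int ` {0..24 * int E}"

lemma continuous_on_affine_piece:
  fixes f :: "real \<Rightarrow> real"
  assumes "\<And>t. x \<le> t \<Longrightarrow> t \<le> y \<Longrightarrow> f t = m * t + k" shows "continuous_on {x..y} f"
proof -
  have "continuous_on {x..y} (\<lambda>t. m * t + k)" by (intro continuous_intros)
  then show ?thesis by (rule continuous_on_eq) (use assms in simp)
qed

context
  fixes E :: nat
  assumes E: "1 \<le> E"
begin

private abbreviation "e \<equiv> real E"

lemma E_ge: "1 \<le> e" using E by simp

lemma base_pieces:
  "x \<le> e \<Longrightarrow> base E x = 14 * e - zigzag (e - x)"
  "e \<le> x \<Longrightarrow> x \<le> 6 * e \<Longrightarrow> base E x = 2 * x + 12 * e"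
  "6 * e \<le> x \<Longrightarrow> x \<le> 8 * e \<Longrightarrow> base E x = - 2 * x + 36 * e"
  "8 * e \<le> x \<Longrightarrow> x \<le> 10 * e \<Longrightarrow> base E x = 1 * x + 12 * e"
  "10 * e \<le> x \<Longrightarrow> x \<le> 18 * e \<Longrightarrow> base E x = - 2 * x + 42 * e"
  "18 * e \<le> x \<Longrightarrow> x \<le> 20 * e \<Longrightarrow> base E x = 1 * x + - 12 * e"
  "20 * e \<le> x \<Longrightarrow> base E x = - 2 * x + 48 * e"
proof -
  have z: "zigzag 0 = 0" using zigzag_shift[of 0 0] by simp
  show "x \<le> e \<Longrightarrow> base E x = 14 * e - zigzag (e - x)" by (simp add: base_def)
  show "e \<le> x \<Longrightarrow> x \<le> 6 * e \<Longrightarrow> base E x = 2 * x + 12 * e"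
    using E_ge z by (cases "x = e") (simp_all add: base_def)
  show "6 * e \<le> x \<Longrightarrow> x \<le> 8 * e \<Longrightarrow> base E x = - 2 * x + 36 * e"
    using E_ge by (cases "x = 6 * e") (simp_all add: base_def)
  show "8 * e \<le> x \<Longrightarrow> x \<le> 10 * e \<Longrightarrow> base E x = 1 * x + 12 * e"
    using E_ge by (cases "x = 8 * e") (simp_all add: base_def)
  show "10 * e \<le> x \<Longrightarrow> x \<le> 18 * e \<Longrightarrow> base E x = - 2 * x + 42 * e"
    using E_ge by (cases "x = 10 * e") (simp_all add: base_def)
  show "18 * e \<le> x \<Longrightarrow> x \<le> 20 * e \<Longrightarrow> base E x = 1 * x + - 12 * e"
    using E_ge by (cases "x = 18 * e") (simp_all add: base_def)
  show "20 * e \<le> x \<Longrightarrow> base E x = - 2 * x + 48 * e"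
    using E_ge by (cases "x = 20 * e") (simp_all add: base_def)
qed

lemma base_zig:
  assumes "k < E" shows "steep ((- 1) ^ (E - Suc k)) 1 (base E) (real k) (real k + 1)"
proof -
  \<comment> \<open>The number of unit laps between this one and \<open>real E\<close>; directions
    alternate starting from there, which gives the sign.\<close>
  define j where "j = E - Suc k"
  have j: "e = real k + real j + 1" using assms by (simp add: j_def of_nat_diff)
  have *: "base E t = 14 * e - (if even j then e - t - real j else real j + 1 - (e - t))"
    if "real k \<le> t" "t \<le> real k + 1" for t
  proof -
    have "real j \<le> e - t" "e - t \<le> real j + 1" "t \<le> e" using that j by auto
    then show ?thesis using zigzag_shift[of j "e - t"] base_pieces(1)[of t] by simp
  qed
  show ?thesis unfolding j_def[symmetric]
  proof (rule steep_affine)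
    show "base E t = (- 1) ^ j * t + (if even j then 13 * e + real j else 15 * e - real j - 1)"
      if "real k \<le> t" "t \<le> real k + 1" for t using *[OF that] by simp
  qed (simp flip: power_mult_distrib)
qed

lemma base_lattice:
  assumes "0 \<le> i" "i \<le> 24 * int E"
  shows "base E (real_of_int i) = real_of_int (lattice_map (int E) i)"
proof -
  have e': "e = real_of_int (int E)" by simp
  have mono: "real_of_int i \<le> c * e \<longleftrightarrow> i \<le> c' * int E" if "c = real_of_int c'" for c c'
    unfolding that e' of_int_mult[symmetric] of_int_le_iff ..
  show ?thesis
  proof (cases "i \<le> int E")
    case True
    define m where "m = nat (int E - i)"
    have m: "e - real_of_int i = real m" "int m = int E - i" using True by (auto simp: m_def)
    have "zigzag (real m) = (if even m then 0 else 1)" using zigzag_shift[of m "real m"] by simp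
    also have "\<dots> = real_of_int ((int E - i) mod 2)"
      unfolding m(2)[symmetric] by (cases "even m") (simp_all add: mod2_eq_if)
    finally show ?thesis using True base_pieces(1)[of "real_of_int i"] m(1) by (simp add: lattice_map_def)
  next
    case False
    then show ?thesis using mono[of 6 6] mono[of 8 8] mono[of 10 10] mono[of 18 18] mono[of 20 20] mono[of 1 1]
      by (simp add: base_def lattice_map_def)
  qed
qed

lemma lattice_range:
  assumes "0 \<le> i" "i \<le> 24 * int E"
  shows "0 \<le> lattice_map (int E) i" "lattice_map (int E) i \<le> 24 * int E"
  using assms E pos_mod_bound[of 2 "int E - i"] pos_mod_sign[of 2 "int E - i"] by (auto simp: lattice_map_def)

lemma base_continuous: "continuous_on {0..24 * e} (base E)"
proof -
  have "continuous_on {0..e} (\<lambda>x. 14 * e - zigzag (e - x))"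
    by (intro continuous_intros continuous_on_compose2[OF zigzag_continuous[of UNIV]]) auto
  then have c0: "continuous_on {0..e} (base E)"
    by (rule continuous_on_eq) (use base_pieces(1) in simp)
  have c: "continuous_on {e..6 * e} (base E)" "continuous_on {6 * e..8 * e} (base E)" "continuous_on {8 * e..10 * e} (base E)"
    "continuous_on {10 * e..18 * e} (base E)" "continuous_on {18 * e..20 * e} (base E)" "continuous_on {20 * e..24 * e} (base E)"
    by (rule continuous_on_affine_piece, erule (1) base_pieces)+ (rule continuous_on_affine_piece, erule base_pieces)
  show ?thesis
    using continuous_on_join[OF continuous_on_join[OF continuous_on_join[OF continuous_on_join[OF
      continuous_on_join[OF continuous_on_join[OF c0 c(1)] c(2)] c(3)] c(4)] c(5)] c(6)] E_ge by simp
qed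

lemma base_maps: "base E ` {0..24 * e} \<subseteq> {0..24 * e}"
proof (rule image_subsetI)
  fix x assume x: "x \<in> {0..24 * e}"
  then show "base E x \<in> {0..24 * e}"
    using zigzag_range[of "e - x"] E_ge by (auto simp: base_def)
qed

lemma base_zig_range: "x \<le> e \<Longrightarrow> 14 * e - 1 \<le> base E x \<and> base E x \<le> 14 * e"
  using base_pieces(1)[of x] zigzag_range[of "e - x"] by simp

lemma lattice_points_sub: "(lattice_points E) \<subseteq> {0..24 * e}"
proof
  fix x assume "x \<in> (lattice_points E)"
  then obtain i where i: "x = real_of_int i" "0 \<le> i" "i \<le> 24 * int E" by (auto simp: lattice_points_def)
  have "real_of_int i \<le> real_of_int (24 * int E)" using i(3) by (simp only: of_int_le_iff)
  then show "x \<in> {0..24 * e}" using i by simp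
qed

lemma nat_mult_lattice: "k \<le> 24 \<Longrightarrow> real k * e \<in> (lattice_points E)"
  unfolding lattice_points_def by (intro image_eqI[of _ _ "int k * int E"]) (auto intro: mult_right_mono)

lemma lattice_cell:
  assumes "p \<in> (lattice_points E)" "q \<in> (lattice_points E)" "p < q"
  obtains i where "0 \<le> i" "i < 24 * int E" "{real_of_int i..real_of_int i + 1} \<subseteq> {p..q}"
proof -
  obtain i j where ij: "p = real_of_int i" "q = real_of_int j" "0 \<le> i" "j \<le> 24 * int E"
    using assms by (auto simp: lattice_points_def)
  have "i < j" using assms(3) ij by simp
  moreover from this have "real_of_int i + 1 \<le> real_of_int j" by linarith
  ultimately show ?thesis using that[of i] ij by auto
qed

lemma base_steep:
  "steep 1 2 (base E) e (6 * e)" "steep (- 1) 2 (base E) (6 * e) (8 * e)" "steep 1 1 (base E) (8 * e) (10 * e)"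
  "steep (- 1) 2 (base E) (10 * e) (18 * e)" "steep 1 1 (base E) (18 * e) (20 * e)" "steep (- 1) 2 (base E) (20 * e) (24 * e)"
  by (rule steep_affine, erule (1) base_pieces, simp)+ (rule steep_affine, erule base_pieces, simp)

text \<open>The case \<open>d = 0\<close>, in which the steep inner pieces next to
  \<open>8 * e\<close> and \<open>20 * e\<close> shrink to points.\<close>

lemma base_shape: "shape E 0 (base E) (lattice_points E)"
proof
  show "\<exists>m i. 0 \<le> i \<and> i < 24 * int E \<and> {real_of_int i..real_of_int i + 1} \<subseteq> (base E ^^ m) ` {p..q}"
    if pq: "p \<in> (lattice_points E)" "q \<in> (lattice_points E)" "p < q" for p q
  proof -
    obtain i where "0 \<le> i" "i < 24 * int E" "{real_of_int i..real_of_int i + 1} \<subseteq> {p..q}"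
      using lattice_cell[OF pq] .
    then show ?thesis by (intro exI[of _ 0] exI[of _ i]) simp
  qed
  show "base E ` (lattice_points E) \<subseteq> (lattice_points E)"
  proof (rule image_subsetI)
    fix x assume "x \<in> (lattice_points E)"
    then obtain i where i: "x = real_of_int i" "0 \<le> i" "i \<le> 24 * int E" by (auto simp: lattice_points_def)
    then show "base E x \<in> (lattice_points E)"
      using base_lattice[OF i(2,3)] lattice_range[OF i(2,3)] by (simp add: lattice_points_def)
  qed
  show "real_of_int (lattice_map (int E) i) \<in> base E ` {real_of_int i..real_of_int i + 1} \<and>
      real_of_int (lattice_map (int E) (i + 1)) \<in> base E ` {real_of_int i..real_of_int i + 1}"
    if i: "0 \<le> i" "i < 24 * int E" for i
  proof
    show "real_of_int (lattice_map (int E) i) \<in> base E ` {real_of_int i..real_of_int i + 1}"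
      using base_lattice[of i] i by (intro image_eqI[of _ _ "real_of_int i"]) auto
    show "real_of_int (lattice_map (int E) (i + 1)) \<in> base E ` {real_of_int i..real_of_int i + 1}"
      using base_lattice[of "i + 1"] i by (intro image_eqI[of _ _ "real_of_int i + 1"]) auto
  qed
  show "\<exists>p\<in>(lattice_points E). \<exists>q\<in>(lattice_points E). p < q \<and> adj (lattice_points E) p q \<and> \<not> adj (lattice_points E) (base E p) (base E q)"
  proof (intro bexI conjI)
    show "e < e + 1" by simp
    show "adj (lattice_points E) e (e + 1)"
    proof -
      have "\<not> (e < real_of_int i \<and> real_of_int i < e + 1) \<and> \<not> (e + 1 < real_of_int i \<and> real_of_int i < e)" for i
      proof -
        have "e < real_of_int i \<longleftrightarrow> int E < i" by linarith
        moreover have "real_of_int i < e + 1 \<longleftrightarrow> i < int E + 1" by linarith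
        ultimately show ?thesis by auto
      qed
      then show ?thesis unfolding adj_def lattice_points_def by simp
    qed
    have v: "base E e = 14 * e" "base E (e + 1) = 14 * e + 2"
      using base_pieces(2)[of e] base_pieces(2)[of "e + 1"] E_ge by auto
    have "14 * e + 1 \<in> (lattice_points E)"
      unfolding lattice_points_def using E by (intro image_eqI[of _ _ "14 * int E + 1"]) auto
    then show "\<not> adj (lattice_points E) (base E e) (base E (e + 1))"
      unfolding v adj_def by force
    show "e \<in> (lattice_points E)" using nat_mult_lattice[of 1] by simp
    show "e + 1 \<in> (lattice_points E)"
      unfolding lattice_points_def using E by (intro image_eqI[of _ _ "int E + 1"]) auto
  qed
  show "finite (lattice_points E)" by (simp add: lattice_points_def)
  show "real_of_int i \<in> (lattice_points E)" if "0 \<le> i" "i \<le> 24 * int E" for i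
    using that by (simp add: lattice_points_def)
  show "8 * e + 0 \<in> (lattice_points E)" "20 * e - 0 \<in> (lattice_points E)"
    using nat_mult_lattice[of 8] nat_mult_lattice[of 20] by auto
  show "steep 1 2 (base E) (8 * e) (8 * e + 0)" "steep 1 2 (base E) (20 * e - 0) (20 * e)"
    by (auto intro: steep_point)
  show "20 * e \<le> base E x" if "8 * e + 0 \<le> x" "x \<le> 10 * e" for x
    using base_pieces(4)[of x] that by simp
  show "6 * e \<le> base E x \<and> base E x \<le> 8 * e" if "18 * e \<le> x" "x \<le> 20 * e - 0" for x
    using base_pieces(6)[of x] that by simp
qed (use E lattice_points_sub base_continuous base_maps base_zig base_zig_range base_steep in simp_all)

end

section \<open>The perturbed maps\<close>

text \<open>
  The slope \<open>s\<close> makes the perturbation agree with the base map at distance 1 from the blown-up orbit,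
  \<open>\<kappa>\<close> makes one fold overshoot by \<open>\<eta>\<close>, and \<open>s ^ N * \<eta> = 1 - d\<close> makes the orbit of the overshoot
  land on the lattice, so that the perturbation is Markov.
\<close>

locale perturbation =
  fixes E N :: nat and d \<eta> s \<kappa> :: real
  assumes E: "1 \<le> E" and N: "1 \<le> N" and d: "0 < d" "d \<le> 1 / 4" and \<eta>: "0 < \<eta>" "\<eta> \<le> d"
    and s: "s * (1 - d) = 2 - d" and \<kappa>: "\<kappa> * d = 2 * d + \<eta>" and sN: "s ^ N * \<eta> = 1 - d"
begin

abbreviation "e \<equiv> real E"

text \<open>On the sides where the base map has slope 1, the fold ends
  \<open>(8 * e + d, 20 * e + d)\<close> and \<open>(20 * e - d, 8 * e - d)\<close> already lie on
  its graph, so the change stops at distance \<open>d\<close>. On the sides of slope -2 they do not,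
  and the branch of slope \<open>-s\<close> leads back to the graph at distance 1.\<close>

definition pert :: "real \<Rightarrow> real" where
  "pert x =
    (if x \<le> 8 * e - 1 then base E x
     else if x \<le> 8 * e - d then 20 * e + d + s * (8 * e - d - x)
     else if x \<le> 8 * e then 20 * e + d - 2 * (x - (8 * e - d))
     else if x \<le> 8 * e + d then 20 * e - d + 2 * (x - 8 * e)
     else if x \<le> 20 * e - d then base E x
     else if x \<le> 20 * e then 8 * e - d + \<kappa> * (x - (20 * e - d))
     else if x \<le> 20 * e + d then 8 * e - d + \<kappa> * (20 * e + d - x)
     else if x \<le> 20 * e + 1 then 8 * e - d - s * (x - (20 * e + d))
     else base E x)"

lemma e: "1 \<le> e" using E by simp

lemma s_ge: "2 \<le> s"
proof (rule ccontr)
  assume "\<not> 2 \<le> s"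
  then have "s * (1 - d) < 2 * (1 - d)" using d by (intro mult_strict_right_mono) auto
  then show False using s d by simp
qed

lemma \<kappa>_ge: "2 \<le> \<kappa>"
proof (rule ccontr)
  assume "\<not> 2 \<le> \<kappa>"
  then have "\<kappa> * d < 2 * d" using d by (intro mult_strict_right_mono) auto
  then show False using \<kappa> \<eta> by simp
qed

lemma pert_pieces:
  "x \<le> 8 * e - 1 \<Longrightarrow> pert x = base E x"
  "8 * e - 1 \<le> x \<Longrightarrow> x \<le> 8 * e - d \<Longrightarrow> pert x = 20 * e + d + s * (8 * e - d - x)"
  "8 * e - d \<le> x \<Longrightarrow> x \<le> 8 * e \<Longrightarrow> pert x = 20 * e + d - 2 * (x - (8 * e - d))"
  "8 * e \<le> x \<Longrightarrow> x \<le> 8 * e + d \<Longrightarrow> pert x = 20 * e - d + 2 * (x - 8 * e)"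
  "8 * e + d \<le> x \<Longrightarrow> x \<le> 20 * e - d \<Longrightarrow> pert x = base E x"
  "20 * e - d \<le> x \<Longrightarrow> x \<le> 20 * e \<Longrightarrow> pert x = 8 * e - d + \<kappa> * (x - (20 * e - d))"
  "20 * e \<le> x \<Longrightarrow> x \<le> 20 * e + d \<Longrightarrow> pert x = 8 * e - d + \<kappa> * (20 * e + d - x)"
  "20 * e + d \<le> x \<Longrightarrow> x \<le> 20 * e + 1 \<Longrightarrow> pert x = 8 * e - d - s * (x - (20 * e + d))"
  "20 * e + 1 \<le> x \<Longrightarrow> pert x = base E x"
proof -
  note b = base_pieces[OF E]
  show "x \<le> 8 * e - 1 \<Longrightarrow> pert x = base E x" by (simp add: pert_def)
  show "8 * e - 1 \<le> x \<Longrightarrow> x \<le> 8 * e - d \<Longrightarrow> pert x = 20 * e + d + s * (8 * e - d - x)"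
  proof (cases "x = 8 * e - 1")
    assume x: "8 * e - 1 \<le> x" "x \<le> 8 * e - d"
    case True
    have "x \<le> 8 * e - 1" using True by simp
    then have p: "pert x = base E x" by (simp add: pert_def)
    have eq: "8 * e - d - x = 1 - d" "base E x = 20 * e + 2" using True b(3)[of x] e by auto
    show ?thesis unfolding p eq s by simp
  next
    assume x: "8 * e - 1 \<le> x" "x \<le> 8 * e - d"
    case False
    then have "\<not> x \<le> 8 * e - 1" using x d e by linarith+
    then show ?thesis using x by (simp add: pert_def)
  qed
  show "8 * e - d \<le> x \<Longrightarrow> x \<le> 8 * e \<Longrightarrow> pert x = 20 * e + d - 2 * (x - (8 * e - d))"
  proof (cases "x = 8 * e - d")
    assume x: "8 * e - d \<le> x" "x \<le> 8 * e"
    case True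
    have "x \<le> 8 * e - d" "\<not> x \<le> 8 * e - 1" using True d e by linarith+
    then have p: "pert x = 20 * e + d + s * (8 * e - d - x)" by (simp add: pert_def)
    show ?thesis using p unfolding True by simp
  next
    assume x: "8 * e - d \<le> x" "x \<le> 8 * e"
    case False
    then have "\<not> x \<le> 8 * e - 1" "\<not> x \<le> 8 * e - d" using x d e by linarith+
    then show ?thesis using x by (simp add: pert_def)
  qed
  show "8 * e \<le> x \<Longrightarrow> x \<le> 8 * e + d \<Longrightarrow> pert x = 20 * e - d + 2 * (x - 8 * e)"
  proof (cases "x = 8 * e")
    assume x: "8 * e \<le> x" "x \<le> 8 * e + d"
    case True
    have "x \<le> 8 * e" "\<not> x \<le> 8 * e - 1" "\<not> x \<le> 8 * e - d" using True d e by linarith+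
    then have p: "pert x = 20 * e + d - 2 * (x - (8 * e - d))" by (simp add: pert_def)
    show ?thesis using p unfolding True by simp
  next
    assume x: "8 * e \<le> x" "x \<le> 8 * e + d"
    case False
    then have "\<not> x \<le> 8 * e - 1" "\<not> x \<le> 8 * e - d" "\<not> x \<le> 8 * e" using x d e by linarith+
    then show ?thesis using x by (simp add: pert_def)
  qed
  show "8 * e + d \<le> x \<Longrightarrow> x \<le> 20 * e - d \<Longrightarrow> pert x = base E x"
  proof (cases "x = 8 * e + d")
    assume x: "8 * e + d \<le> x" "x \<le> 20 * e - d"
    case True
    have "x \<le> 8 * e + d" "\<not> x \<le> 8 * e - 1" "\<not> x \<le> 8 * e - d" "\<not> x \<le> 8 * e" using True d e by linarith+
    then have p: "pert x = 20 * e - d + 2 * (x - 8 * e)" by (simp add: pert_def)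
    show ?thesis unfolding p using True b(4)[of x] d e by simp
  next
    assume x: "8 * e + d \<le> x" "x \<le> 20 * e - d"
    case False
    then have "\<not> x \<le> 8 * e - 1" "\<not> x \<le> 8 * e - d" "\<not> x \<le> 8 * e" "\<not> x \<le> 8 * e + d" using x d e by linarith+
    then show ?thesis using x by (simp add: pert_def)
  qed
  show "20 * e - d \<le> x \<Longrightarrow> x \<le> 20 * e \<Longrightarrow> pert x = 8 * e - d + \<kappa> * (x - (20 * e - d))"
  proof (cases "x = 20 * e - d")
    assume x: "20 * e - d \<le> x" "x \<le> 20 * e"
    case True
    have "x \<le> 20 * e - d" "\<not> x \<le> 8 * e - 1" "\<not> x \<le> 8 * e - d" "\<not> x \<le> 8 * e" "\<not> x \<le> 8 * e + d" using True d e by linarith+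
    then have p: "pert x = base E x" by (simp add: pert_def)
    show ?thesis unfolding p using True b(6)[of x] d e by simp
  next
    assume x: "20 * e - d \<le> x" "x \<le> 20 * e"
    case False
    then have "\<not> x \<le> 8 * e - 1" "\<not> x \<le> 8 * e - d" "\<not> x \<le> 8 * e" "\<not> x \<le> 8 * e + d" "\<not> x \<le> 20 * e - d" using x d e by linarith+
    then show ?thesis using x by (simp add: pert_def)
  qed
  show "20 * e \<le> x \<Longrightarrow> x \<le> 20 * e + d \<Longrightarrow> pert x = 8 * e - d + \<kappa> * (20 * e + d - x)"
  proof (cases "x = 20 * e")
    assume x: "20 * e \<le> x" "x \<le> 20 * e + d"
    case True
    have "x \<le> 20 * e" "\<not> x \<le> 8 * e - 1" "\<not> x \<le> 8 * e - d" "\<not> x \<le> 8 * e" "\<not> x \<le> 8 * e + d" "\<not> x \<le> 20 * e - d" using True d e by linarith+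
    then have p: "pert x = 8 * e - d + \<kappa> * (x - (20 * e - d))" by (simp add: pert_def)
    show ?thesis using p unfolding True by simp
  next
    assume x: "20 * e \<le> x" "x \<le> 20 * e + d"
    case False
    then have "\<not> x \<le> 8 * e - 1" "\<not> x \<le> 8 * e - d" "\<not> x \<le> 8 * e" "\<not> x \<le> 8 * e + d" "\<not> x \<le> 20 * e - d" "\<not> x \<le> 20 * e" using x d e by linarith+
    then show ?thesis using x by (simp add: pert_def)
  qed
  show "20 * e + d \<le> x \<Longrightarrow> x \<le> 20 * e + 1 \<Longrightarrow> pert x = 8 * e - d - s * (x - (20 * e + d))"
  proof (cases "x = 20 * e + d")
    assume x: "20 * e + d \<le> x" "x \<le> 20 * e + 1"
    case True
    have "x \<le> 20 * e + d" "\<not> x \<le> 8 * e - 1" "\<not> x \<le> 8 * e - d" "\<not> x \<le> 8 * e" "\<not> x \<le> 8 * e + d" "\<not> x \<le> 20 * e - d" "\<not> x \<le> 20 * e" using True d e by linarith+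
    then have p: "pert x = 8 * e - d + \<kappa> * (20 * e + d - x)" by (simp add: pert_def)
    show ?thesis using p unfolding True by simp
  next
    assume x: "20 * e + d \<le> x" "x \<le> 20 * e + 1"
    case False
    then have "\<not> x \<le> 8 * e - 1" "\<not> x \<le> 8 * e - d" "\<not> x \<le> 8 * e" "\<not> x \<le> 8 * e + d" "\<not> x \<le> 20 * e - d" "\<not> x \<le> 20 * e" "\<not> x \<le> 20 * e + d" using x d e by linarith+
    then show ?thesis using x by (simp add: pert_def)
  qed
  show "20 * e + 1 \<le> x \<Longrightarrow> pert x = base E x"
  proof (cases "x = 20 * e + 1")
    assume x: "20 * e + 1 \<le> x"
    case True
    have "x \<le> 20 * e + 1" "\<not> x \<le> 8 * e - 1" "\<not> x \<le> 8 * e - d" "\<not> x \<le> 8 * e" "\<not> x \<le> 8 * e + d" "\<not> x \<le> 20 * e - d" "\<not> x \<le> 20 * e" "\<not> x \<le> 20 * e + d" using True d e by linarith+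
    then have p: "pert x = 8 * e - d - s * (x - (20 * e + d))" by (simp add: pert_def)
    have eq: "x - (20 * e + d) = 1 - d" "base E x = 8 * e - 2" using True b(7)[of x] e by auto
    show ?thesis unfolding p eq s by simp
  next
    assume x: "20 * e + 1 \<le> x"
    case False
    then have "\<not> x \<le> 8 * e - 1" "\<not> x \<le> 8 * e - d" "\<not> x \<le> 8 * e" "\<not> x \<le> 8 * e + d" "\<not> x \<le> 20 * e - d" "\<not> x \<le> 20 * e" "\<not> x \<le> 20 * e + d" "\<not> x \<le> 20 * e + 1" using x d e by linarith+
    then show ?thesis using x by (simp add: pert_def)
  qed
qed

lemma pert_affine:
  "8 * e - 1 \<le> x \<Longrightarrow> x \<le> 8 * e - d \<Longrightarrow> pert x = - s * x + (20 * e + d + s * (8 * e - d))"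
  "8 * e - d \<le> x \<Longrightarrow> x \<le> 8 * e \<Longrightarrow> pert x = - 2 * x + (20 * e + d + 2 * (8 * e - d))"
  "8 * e \<le> x \<Longrightarrow> x \<le> 8 * e + d \<Longrightarrow> pert x = 2 * x + (20 * e - d - 16 * e)"
  "20 * e - d \<le> x \<Longrightarrow> x \<le> 20 * e \<Longrightarrow> pert x = \<kappa> * x + (8 * e - d - \<kappa> * (20 * e - d))"
  "20 * e \<le> x \<Longrightarrow> x \<le> 20 * e + d \<Longrightarrow> pert x = - \<kappa> * x + (8 * e - d + \<kappa> * (20 * e + d))"
  "20 * e + d \<le> x \<Longrightarrow> x \<le> 20 * e + 1 \<Longrightarrow> pert x = - s * x + (8 * e - d + s * (20 * e + d))"
  by (subst pert_pieces, assumption, assumption, simp add: algebra_simps)+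

text \<open>The extreme case is the overshooting peak at \<open>20 * e\<close>, which is raised by
  \<open>d + \<eta>\<close>, and \<open>\<eta>\<close> is at most \<open>d\<close>.\<close>

lemma pert_near_base: "\<bar>base E x - pert x\<bar> \<le> 2 * d"
proof -
  note b = base_pieces[OF E]
  have sm: "(s - 2) * t \<le> d" "0 \<le> (s - 2) * t" if "0 \<le> t" "t \<le> 1 - d" for t
  proof -
    have "(s - 2) * t \<le> (s - 2) * (1 - d)" using that s_ge by (intro mult_left_mono) auto
    then show "(s - 2) * t \<le> d" using s by (simp add: algebra_simps)
    show "0 \<le> (s - 2) * t" using that s_ge by simp
  qed
  have km: "(\<kappa> - 2) * t \<le> \<eta>" "0 \<le> (\<kappa> - 2) * t" if "0 \<le> t" "t \<le> d" for t
  proof -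
    have "(\<kappa> - 2) * t \<le> (\<kappa> - 2) * d" using that \<kappa>_ge by (intro mult_left_mono) auto
    then show "(\<kappa> - 2) * t \<le> \<eta>" using \<kappa> by (simp add: algebra_simps)
    show "0 \<le> (\<kappa> - 2) * t" using that \<kappa>_ge by simp
  qed
  consider "x \<le> 8 * e - 1 \<or> 8 * e + d \<le> x \<and> x \<le> 20 * e - d \<or> 20 * e + 1 \<le> x"
    | "8 * e - 1 \<le> x" "x \<le> 8 * e - d" | "8 * e - d \<le> x" "x \<le> 8 * e" | "8 * e \<le> x" "x \<le> 8 * e + d"
    | "20 * e - d \<le> x" "x \<le> 20 * e" | "20 * e \<le> x" "x \<le> 20 * e + d" | "20 * e + d \<le> x" "x \<le> 20 * e + 1"
    by linarith
  then show ?thesis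
  proof cases
    case 1
    then have "pert x = base E x" using pert_pieces(1,5,9) by blast
    then show ?thesis using d by simp
  next
    case 2
    have "base E x = - 2 * x + 36 * e" using 2 d e by (intro b(3)) auto
    moreover have "s * (8 * e - d - x) = (s - 2) * (8 * e - d - x) + 2 * (8 * e - d - x)" by (simp add: algebra_simps)
    ultimately show ?thesis using pert_pieces(2)[OF 2] sm[of "8 * e - d - x"] 2 d by simp
  next
    case 3
    have "base E x = - 2 * x + 36 * e" using 3 d e by (intro b(3)) auto
    then show ?thesis using pert_pieces(3)[OF 3] 3 d by simp
  next
    case 4
    have "base E x = 1 * x + 12 * e" using 4 d e by (intro b(4)) auto
    then show ?thesis using pert_pieces(4)[OF 4] 4 d by simp
  next
    case 5
    have "base E x = 1 * x + - 12 * e" using 5 d e by (intro b(6)) auto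
    moreover have "\<kappa> * (x - (20 * e - d)) = (\<kappa> - 2) * (x - (20 * e - d)) + 2 * (x - (20 * e - d))" by (simp add: algebra_simps)
    ultimately show ?thesis using pert_pieces(6)[OF 5] km[of "x - (20 * e - d)"] 5 d \<eta> by simp
  next
    case 6
    have "base E x = - 2 * x + 48 * e" using 6 by (intro b(7)) auto
    moreover have "\<kappa> * (20 * e + d - x) = (\<kappa> - 2) * (20 * e + d - x) + 2 * (20 * e + d - x)" by (simp add: algebra_simps)
    ultimately show ?thesis using pert_pieces(7)[OF 6] km[of "20 * e + d - x"] 6 d \<eta> by simp
  next
    case 7
    have "base E x = - 2 * x + 48 * e" using 7 d by (intro b(7)) auto
    moreover have "s * (x - (20 * e + d)) = (s - 2) * (x - (20 * e + d)) + 2 * (x - (20 * e + d))" by (simp add: algebra_simps)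
    ultimately show ?thesis using pert_pieces(8)[OF 7] sm[of "x - (20 * e + d)"] 7 d by simp
  qed
qed

lemma pert_continuous: "continuous_on {0..24 * e} pert"
proof -
  have cb: "continuous_on {x..y} pert" if "0 \<le> x" "y \<le> 24 * e" "\<And>t. x \<le> t \<Longrightarrow> t \<le> y \<Longrightarrow> pert t = base E t" for x y
    by (rule continuous_on_eq[OF continuous_on_subset[OF base_continuous[OF E]]]) (use that in auto)
  have c: "continuous_on {0..8 * e - 1} pert" "continuous_on {8 * e + d..20 * e - d} pert" "continuous_on {20 * e + 1..24 * e} pert"
    by (rule cb, use e d in \<open>simp_all add: pert_pieces(1,5,9)\<close>)+
  have a: "continuous_on {8 * e - 1..8 * e - d} pert" "continuous_on {8 * e - d..8 * e} pert" "continuous_on {8 * e..8 * e + d} pert"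
    "continuous_on {20 * e - d..20 * e} pert" "continuous_on {20 * e..20 * e + d} pert" "continuous_on {20 * e + d..20 * e + 1} pert"
    by (rule continuous_on_affine_piece, erule (1) pert_affine)+
  show ?thesis
    using continuous_on_join[OF continuous_on_join[OF continuous_on_join[OF continuous_on_join[OF continuous_on_join[OF
      continuous_on_join[OF continuous_on_join[OF continuous_on_join[OF c(1) a(1)] a(2)] a(3)] c(2)] a(4)] a(5)] a(6)] c(3)] e d
    by simp
qed

lemma steep_base_eq:
  assumes "steep \<sigma> c (base E) x y" "\<And>t. x \<le> t \<Longrightarrow> t \<le> y \<Longrightarrow> pert t = base E t"
  shows "steep \<sigma> c pert x y"
  using assms by (simp add: steep_def)

lemma pert_steep:
  "steep 1 2 pert e (6 * e)" "steep (- 1) 2 pert (6 * e) (8 * e)" "steep 1 2 pert (8 * e) (8 * e + d)"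
  "steep 1 1 pert (8 * e + d) (10 * e)" "steep (- 1) 2 pert (10 * e) (18 * e)" "steep 1 1 pert (18 * e) (20 * e - d)"
  "steep 1 2 pert (20 * e - d) (20 * e)" "steep (- 1) 2 pert (20 * e) (24 * e)"
proof -
  note b = base_steep[OF E]
  have a: "steep (- 1) 2 pert (8 * e - 1) (8 * e - d)" "steep (- 1) 2 pert (8 * e - d) (8 * e)" "steep 1 2 pert (8 * e) (8 * e + d)"
    "steep 1 2 pert (20 * e - d) (20 * e)" "steep (- 1) 2 pert (20 * e) (20 * e + d)" "steep (- 1) 2 pert (20 * e + d) (20 * e + 1)"
    by (rule steep_affine, erule (1) pert_affine, use s_ge \<kappa>_ge in simp)+
  show "steep 1 2 pert e (6 * e)"
    by (rule steep_base_eq[OF b(1)]) (use e in \<open>auto intro!: pert_pieces(1)\<close>)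
  have "steep (- 1) 2 pert (6 * e) (8 * e - 1)"
    by (rule steep_base_eq[OF steep_sub[OF b(2)]]) (use e in \<open>auto intro!: pert_pieces(1)\<close>)
  from steep_join[OF steep_join[OF this a(1)] a(2)] show "steep (- 1) 2 pert (6 * e) (8 * e)" .
  show "steep 1 2 pert (8 * e) (8 * e + d)" by (rule a)
  show "steep 1 1 pert (8 * e + d) (10 * e)"
    by (rule steep_base_eq[OF steep_sub[OF b(3)]]) (use e d in \<open>auto intro!: pert_pieces(5)\<close>)
  show "steep (- 1) 2 pert (10 * e) (18 * e)"
    by (rule steep_base_eq[OF b(4)]) (use e d in \<open>auto intro!: pert_pieces(5)\<close>)
  show "steep 1 1 pert (18 * e) (20 * e - d)"
    by (rule steep_base_eq[OF steep_sub[OF b(5)]]) (use e d in \<open>auto intro!: pert_pieces(5)\<close>)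
  show "steep 1 2 pert (20 * e - d) (20 * e)" by (rule a)
  have "steep (- 1) 2 pert (20 * e + 1) (24 * e)"
    by (rule steep_base_eq[OF steep_sub[OF b(6)]]) (use e in \<open>auto intro!: pert_pieces(9)\<close>)
  from steep_join[OF steep_join[OF a(5) a(6)] this] show "steep (- 1) 2 pert (20 * e) (24 * e)" .
qed

section \<open>The Markov partition of the perturbation\<close>

definition u where "u = 8 * e - d"
definition w where "w = 8 * e + d"
definition u' where "u' = 20 * e - d"
definition w' where "w' = 20 * e + d"
text \<open>These contain the orbit of the overshoot: \<open>20 * e\<close>,
  \<open>w + \<eta>\<close>, \<open>B 0\<close>, \<open>A 1\<close>, \<open>B 2\<close> and so on,
  alternately right of \<open>w'\<close> and left of \<open>u\<close> at distances growing by the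
  factor \<open>s\<close>. The map exchanges the two families and raises the index, and at index
  \<open>N\<close> both reach lattice points.\<close>

definition A where "A i = u - s ^ i * \<eta>" for i :: nat
definition B where "B i = w' + s ^ i * \<eta>" for i :: nat

definition Q where
  "Q = lattice_points E \<union> {u, w, u', w', w + \<eta>} \<union> A ` {..N} \<union> B ` {..N}"

lemma pow_mono: "i \<le> j \<Longrightarrow> s ^ i * \<eta> \<le> s ^ j * \<eta>"
  using s_ge \<eta> by (intro mult_right_mono power_increasing) auto

lemma pow_bounds: "i \<le> N \<Longrightarrow> \<eta> \<le> s ^ i * \<eta> \<and> s ^ i * \<eta> \<le> 1 - d"
  using pow_mono[of 0 i] pow_mono[of i N] sN by simp

lemma A_bounds: "i \<le> N \<Longrightarrow> 8 * e - 1 \<le> A i \<and> A i < u"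
  and B_bounds: "i \<le> N \<Longrightarrow> w' < B i \<and> B i \<le> 20 * e + 1"
  using pow_bounds[of i] \<eta> by (auto simp: A_def B_def u_def w'_def)

lemma A_N: "A N = 8 * e - 1" and B_N: "B N = 20 * e + 1" and B_0: "B 0 = w' + \<eta>"
  using sN by (auto simp: A_def B_def u_def w'_def)

lemma pert_left: "0 \<le> t \<Longrightarrow> t \<le> 1 - d \<Longrightarrow> pert (u - t) = w' + s * t"
  using pert_pieces(2)[of "u - t"] d by (simp add: u_def w'_def)

lemma pert_right: "0 \<le> t \<Longrightarrow> t \<le> 1 - d \<Longrightarrow> pert (w' + t) = u - s * t"
  using pert_pieces(8)[of "w' + t"] d by (simp add: u_def w'_def)

lemma pert_A: "i < N \<Longrightarrow> pert (A i) = B (Suc i)" and pert_B: "i < N \<Longrightarrow> pert (B i) = A (Suc i)"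
  using pert_left[of "s ^ i * \<eta>"] pert_right[of "s ^ i * \<eta>"] pow_bounds[of i] \<eta> s_ge
  by (auto simp: A_def B_def)

lemma pert_values:
  "pert u = w'" "pert w = w'" "pert (8 * e) = u'" "pert u' = u" "pert w' = u" "pert (20 * e) = w + \<eta>"
  "pert (8 * e - 1) = 20 * e + 2" "pert (20 * e + 1) = 8 * e - 2"
  using pert_pieces(2)[of u] pert_pieces(4)[of w] pert_pieces(3)[of "8 * e"] pert_pieces(6)[of u'] pert_pieces(7)[of w']
    pert_pieces(6)[of "20 * e"] pert_pieces(2)[of "8 * e - 1"] pert_pieces(8)[of "20 * e + 1"] d e \<kappa> s
  by (simp_all add: u_def w_def u'_def w'_def algebra_simps)

lemma pert_w: "0 \<le> t \<Longrightarrow> t \<le> 1 - d \<Longrightarrow> pert (w + t) = w' + t"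
  using pert_pieces(5)[of "w + t"] base_pieces(4)[OF E, of "w + t"] d e by (simp add: w_def w'_def)

lemma pert_u': "0 \<le> t \<Longrightarrow> t \<le> 1 - d \<Longrightarrow> pert (u' - t) = u - t"
  using pert_pieces(5)[of "u' - t"] base_pieces(6)[OF E, of "u' - t"] d e by (simp add: u_def u'_def)

lemma pert_lattice:
  assumes "0 \<le> i" "i \<le> 24 * int E" "i \<noteq> 8 * int E" "i \<noteq> 20 * int E"
  shows "pert (real_of_int i) = real_of_int (lattice_map (int E) i)"
proof -
  have r: "real_of_int i \<le> real_of_int (8 * int E - 1) \<or> real_of_int (8 * int E + 1) \<le> real_of_int i"
    "real_of_int i \<le> real_of_int (20 * int E - 1) \<or> real_of_int (20 * int E + 1) \<le> real_of_int i"
    using assms(3,4) unfolding of_int_le_iff by auto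
  have "real_of_int i \<le> 8 * e - 1 \<or> 8 * e + d \<le> real_of_int i \<and> real_of_int i \<le> 20 * e - d \<or> 20 * e + 1 \<le> real_of_int i"
    using r d by (auto simp del: of_int_le_iff)
  then have "pert (real_of_int i) = base E (real_of_int i)" using pert_pieces(1,5,9) by blast
  then show ?thesis using base_lattice[OF E assms(1,2)] by simp
qed

lemma pert_maps: "pert ` {0..24 * e} \<subseteq> {0..24 * e}"
proof (rule image_subsetI)
  fix x assume x: "x \<in> {0..24 * e}"
  have h: "base E x \<in> {0..24 * e}" using base_maps[OF E] x by blast
  consider "x \<le> 8 * e - 1 \<or> 8 * e + d \<le> x \<and> x \<le> 20 * e - d \<or> 20 * e + 1 \<le> x"
    | "8 * e - 1 \<le> x" "x \<le> 8 * e + d" | "20 * e - d \<le> x" "x \<le> 20 * e + 1"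
    by linarith
  then show "pert x \<in> {0..24 * e}"
  proof cases
    case 1
    then have "pert x = base E x" using pert_pieces(1,5,9) by blast
    then show ?thesis using h by simp
  next
    case 2
    have "20 * e - 2 \<le> base E x \<and> base E x \<le> 20 * e + 2"
      using base_pieces(3)[OF E, of x] base_pieces(4)[OF E, of x] 2 d e by (cases "x \<le> 8 * e") auto
    then show ?thesis using pert_near_base[of x] d e by (auto simp: abs_le_iff)
  next
    case 3
    have "8 * e - 2 \<le> base E x \<and> base E x \<le> 8 * e"
      using base_pieces(6)[OF E, of x] base_pieces(7)[OF E, of x] 3 d e by (cases "x \<le> 20 * e") auto
    then show ?thesis using pert_near_base[of x] d e by (auto simp: abs_le_iff)
  qed
qed

lemma Q_I: "x \<in> lattice_points E \<Longrightarrow> x \<in> Q" "u \<in> Q" "w \<in> Q" "u' \<in> Q" "w' \<in> Q" "w + \<eta> \<in> Q"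
  "i \<le> N \<Longrightarrow> A i \<in> Q" "i \<le> N \<Longrightarrow> B i \<in> Q"
  by (auto simp: Q_def)

lemma lattice_shift:
  assumes "k \<le> 24" "0 \<le> real k * e + real_of_int j" "real k * e + real_of_int j \<le> 24 * e"
  shows "real k * e + real_of_int j \<in> lattice_points E"
proof -
  have eq: "real k * e + real_of_int j = real_of_int (int k * int E + j)" by simp
  have e24: "24 * e = real_of_int (24 * int E)" by simp
  show ?thesis unfolding lattice_points_def
    by (rule image_eqI[where f = real_of_int, OF eq]) (use assms(2,3) in \<open>simp only: eq e24 of_int_le_iff of_int_0_le_iff atLeastAtMost_iff\<close>)
qed

lemma lattice_special: "8 * e \<in> lattice_points E" "20 * e + 2 \<in> lattice_points E" "8 * e - 2 \<in> lattice_points E"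
  "8 * e - 1 \<in> lattice_points E" "20 * e + 1 \<in> lattice_points E" "20 * e \<in> lattice_points E"
  using lattice_shift[of 8 0] lattice_shift[of 20 2] lattice_shift[of 8 "-2"] lattice_shift[of 8 "-1"]
    lattice_shift[of 20 1] lattice_shift[of 20 0] e by auto

lemma Q_inv: "pert ` Q \<subseteq> Q"
proof (rule image_subsetI)
  fix x assume "x \<in> Q"
  then consider i where "x = real_of_int i" "0 \<le> i" "i \<le> 24 * int E" | "x \<in> {u, w}" | "x \<in> {u', w'}" | "x = w + \<eta>"
    | i where "x = A i" "i \<le> N" | i where "x = B i" "i \<le> N"
    unfolding Q_def lattice_points_def by auto
  then show "pert x \<in> Q"
  proof cases
    case 1
    show ?thesis
    proof (cases "i = 8 * int E \<or> i = 20 * int E")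
      case True
      then have "x = 8 * e \<or> x = 20 * e" using 1(1) by auto
      then show ?thesis using pert_values Q_I by auto
    next
      case False
      then have "pert x = real_of_int (lattice_map (int E) i)" using pert_lattice 1 by blast
      then show ?thesis using lattice_range[OF E 1(2,3)] by (intro Q_I(1)) (auto simp: lattice_points_def)
    qed
  next
    case 4
    then have "pert x = B 0" using pert_w[of \<eta>] \<eta> d B_0 by simp
    then show ?thesis using Q_I(8)[of 0] by simp
  next
    case (5 i)
    then show ?thesis
      using pert_A[of i] Q_I(8)[of "Suc i"] A_N pert_values(7) Q_I(1)[OF lattice_special(2)] by (cases "i = N") auto
  next
    case (6 i)
    then show ?thesis
      using pert_B[of i] Q_I(7)[of "Suc i"] B_N pert_values(8) Q_I(1)[OF lattice_special(3)] by (cases "i = N") auto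
  qed (use pert_values Q_I in auto)
qed

lemma Q_fin: "finite Q" and Q_sub: "Q \<subseteq> {0..24 * e}"
proof -
  show "finite Q" unfolding Q_def lattice_points_def by simp
  have "A i \<in> {0..24 * e}" "B i \<in> {0..24 * e}" if "i \<le> N" for i
    using A_bounds[OF that] B_bounds[OF that] d e by (auto simp: u_def w'_def)
  moreover have "{u, w, u', w', w + \<eta>} \<subseteq> {0..24 * e}"
    using d e \<eta> by (auto simp: u_def w_def u'_def w'_def)
  ultimately show "Q \<subseteq> {0..24 * e}" using lattice_points_sub[OF E] unfolding Q_def by blast
qed

section \<open>Intervals between partition points eventually cover a lattice cell\<close>

definition good :: "real \<Rightarrow> real \<Rightarrow> bool" where
  "good l r \<longleftrightarrow> (\<exists>m i. 0 \<le> i \<and> i < 24 * int E \<and> {real_of_int i..real_of_int i + 1} \<subseteq> (pert ^^ m) ` {l..r})"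

lemma good_sub: "good l' r' \<Longrightarrow> l \<le> l' \<Longrightarrow> r' \<le> r \<Longrightarrow> good l r"
proof -
  assume g: "good l' r'" and lr: "l \<le> l'" "r' \<le> r"
  have "{l'..r'} \<subseteq> {l..r}" using lr by auto
  then have "(pert ^^ m) ` {l'..r'} \<subseteq> (pert ^^ m) ` {l..r}" for m by (rule image_mono)
  then show "good l r" using g unfolding good_def by (meson subset_trans)
qed

text \<open>Goodness is pulled back along one step; by the intermediate value theorem it is enough
  to exhibit two points whose images lie beyond the ends of the good interval.\<close>

lemma good_step:
  assumes g: "good l' r'" and lr: "0 \<le> l" "r \<le> 24 * e" and xy: "x \<in> {l..r}" "y \<in> {l..r}" "pert x \<le> l'" "r' \<le> pert y"
  shows "good l r"
proof -
  have "{l'..r'} \<subseteq> {pert x..pert y}" using xy by auto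
  also have "\<dots> \<subseteq> pert ` {l..r}"
    by (rule connected_image_interval[OF pert_continuous]) (use lr xy in auto)
  finally have sub: "{l'..r'} \<subseteq> pert ` {l..r}" .
  obtain m i where mi: "0 \<le> i" "i < 24 * int E" "{real_of_int i..real_of_int i + 1} \<subseteq> (pert ^^ m) ` {l'..r'}"
    using g by (auto simp: good_def)
  have "(pert ^^ m) ` {l'..r'} \<subseteq> (pert ^^ m) ` pert ` {l..r}" using sub by (rule image_mono)
  also have "\<dots> = (pert ^^ Suc m) ` {l..r}" by (simp add: image_comp funpow_Suc_right del: funpow.simps)
  finally show ?thesis using mi unfolding good_def by (meson subset_trans)
qed

lemma good_lattice: "p \<in> lattice_points E \<Longrightarrow> q \<in> lattice_points E \<Longrightarrow> p < q \<Longrightarrow> good p q"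
proof -
  assume pq: "p \<in> lattice_points E" "q \<in> lattice_points E" "p < q"
  obtain i where "0 \<le> i" "i < 24 * int E" "{real_of_int i..real_of_int i + 1} \<subseteq> {p..q}"
    using lattice_cell[OF E pq] .
  then show "good p q" unfolding good_def by (intro exI[of _ 0] exI[of _ i]) simp
qed

lemma order: "0 \<le> 8 * e - 2" "8 * e - 1 < u" "u < 8 * e" "8 * e < w" "w + \<eta> < 8 * e + 1" "8 * e + 1 < u'" "u' < 20 * e" "20 * e < w'"
  "w' < 20 * e + 1" "20 * e + 2 \<le> 24 * e"
  using d e \<eta> by (auto simp: u_def w_def u'_def w'_def)

lemma good_outer: "good (8 * e - 1) u" "good w' (20 * e + 1)"
proof -
  show "good (8 * e - 1) u"
    by (rule good_step[OF good_lattice[OF lattice_special(5,2)], of _ _ u "8 * e - 1"]) (use order pert_values in auto)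
  show "good w' (20 * e + 1)"
    by (rule good_step[OF good_lattice[OF lattice_special(3,4)], of _ _ "20 * e + 1" w']) (use order pert_values in auto)
qed

text \<open>\<open>u\<close> and \<open>w'\<close> form a cycle of period two that repels outwards
  with factor \<open>s\<close>. A germ at least doubles in each step until it ends at distance
  \<open>1 - d\<close>, at a lattice point.\<close>

lemma good_outer_germ:
  "0 < t \<Longrightarrow> t \<le> 1 - d \<Longrightarrow> 1 - d \<le> 2 ^ n * t \<Longrightarrow> good (u - t) u \<and> good w' (w' + t)"
proof (induction n arbitrary: t)
  case 0
  then have "t = 1 - d" by simp
  then have "u - t = 8 * e - 1" "w' + t = 20 * e + 1" by (auto simp: u_def w'_def)
  then show ?case using good_outer by simp
next
  case (Suc n)
  define t' where "t' = min (s * t) (1 - d)"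
  have st: "2 * t \<le> s * t" using s_ge Suc.prems by (intro mult_right_mono) auto
  have "1 - d \<le> 2 ^ n * t'"
  proof (cases "s * t \<le> 1 - d")
    case True
    have "1 - d \<le> 2 ^ n * (2 * t)" using Suc.prems by simp
    also have "\<dots> \<le> 2 ^ n * (s * t)" using st by (intro mult_left_mono) auto
    finally show ?thesis using True by (simp add: t'_def)
  next
    case False
    have "1 * (1 - d) \<le> 2 ^ n * (1 - d)" using d by (intro mult_right_mono) auto
    then show ?thesis using False by (simp add: t'_def)
  qed
  moreover have t': "0 < t'" "t' \<le> 1 - d" "t' \<le> s * t" using st Suc.prems d by (auto simp: t'_def)
  ultimately have IH: "good (u - t') u" "good w' (w' + t')" using Suc.IH[of t'] by auto
  have v: "pert (u - t) = w' + s * t" "pert (w' + t) = u - s * t" "pert (u - 0) = w' + s * 0" "pert (w' + 0) = u - s * 0"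
    using pert_left[of t] pert_right[of t] pert_left[of 0] pert_right[of 0] Suc.prems d by auto
  have b: "8 * e - 1 \<le> u - t" "w' + t \<le> 20 * e + 1" using Suc.prems by (auto simp: u_def w'_def)
  show ?case
  proof
    show "good (u - t) u"
      by (rule good_step[OF IH(2), of _ _ u "u - t"]) (use order v t' b Suc.prems in auto)
    show "good w' (w' + t)"
      by (rule good_step[OF IH(1), of _ _ "w' + t" w']) (use order v t' b Suc.prems in auto)
  qed
qed

lemma good_outer':
  assumes "0 < t" "t \<le> 1 - d" shows "good (u - t) u" "good w' (w' + t)"
proof -
  obtain n where "(1 - d) / t < 2 ^ n" using real_arch_pow[of 2 "(1 - d) / t"] by auto
  then have "1 - d \<le> 2 ^ n * t" using assms by (simp add: field_simps)
  then show "good (u - t) u" "good w' (w' + t)" using good_outer_germ[OF assms] by auto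
qed

lemma good_w_right: assumes "0 < t" "t \<le> 1 - d" shows "good w (w + t)"
  by (rule good_step[OF good_outer'(2)[OF assms], of _ _ w "w + t"])
    (use order pert_values(2) pert_w[of t] assms d in \<open>auto simp: w_def u'_def\<close>)

text \<open>Here the overshoot does its work: the image of \<open>[20 * e, w']\<close> contains
  \<open>[w, w + \<eta>]\<close>, which lies outside the folded pair. The image of
  \<open>[u, 8 * e]\<close> contains \<open>[20 * e, w']\<close>, so the other fold escapes one step
  later.\<close>

lemma good_inner: "good u (8 * e)" "good (20 * e) w'"
proof -
  show 1: "good (20 * e) w'"
    by (rule good_step[OF good_w_right[OF \<eta>(1)], of _ _ w' "20 * e"]) (use order pert_values \<eta> d in auto)
  show "good u (8 * e)"
    by (rule good_step[OF 1, of _ _ "8 * e" u]) (use order pert_values in auto)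
qed

lemma pert_u_right: "0 \<le> t \<Longrightarrow> t \<le> d \<Longrightarrow> pert (u + t) = w' - 2 * t"
  using pert_pieces(3)[of "u + t"] by (simp add: u_def w'_def)

lemma pert_w'_left: "0 \<le> t \<Longrightarrow> t \<le> d \<Longrightarrow> pert (w' - t) = u + \<kappa> * t"
  using pert_pieces(7)[of "w' - t"] by (simp add: u_def w'_def)

lemma pert_w_left: "0 \<le> t \<Longrightarrow> t \<le> d \<Longrightarrow> pert (w - t) = w' - 2 * t"
  using pert_pieces(4)[of "w - t"] by (simp add: w_def w'_def)

lemma pert_u'_right: "0 \<le> t \<Longrightarrow> t \<le> d \<Longrightarrow> pert (u' + t) = u + \<kappa> * t"
  using pert_pieces(6)[of "u' + t"] by (simp add: u_def u'_def)

lemma pert_c: "0 \<le> t \<Longrightarrow> t \<le> d \<Longrightarrow> pert (8 * e - t) = u' + 2 * t"  "0 \<le> t \<Longrightarrow> t \<le> d \<Longrightarrow> pert (8 * e + t) = u' + 2 * t"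
  using pert_pieces(3)[of "8 * e - t"] pert_pieces(4)[of "8 * e + t"] by (simp_all add: u'_def)

text \<open>The cycle of \<open>u\<close> and \<open>w'\<close> repels inwards too, with factors 2
  and \<open>\<kappa>\<close>, until a germ has grown to one half of a fold.\<close>

lemma good_inner_germ:
  "0 < t \<Longrightarrow> t \<le> d \<Longrightarrow> d \<le> 2 ^ n * t \<Longrightarrow> good u (u + t) \<and> good (w' - t) w'"
proof (induction n arbitrary: t)
  case 0
  then have "t = d" by simp
  then have "u + t = 8 * e" "w' - t = 20 * e" by (auto simp: u_def w'_def)
  then show ?case using good_inner by simp
next
  case (Suc n)
  define t' where "t' = min (2 * t) d"
  have "d \<le> 2 ^ n * t'"
  proof (cases "2 * t \<le> d")
    case True
    then show ?thesis using Suc.prems by (simp add: t'_def)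
  next
    case False
    have "1 * d \<le> 2 ^ n * d" using d by (intro mult_right_mono) auto
    then show ?thesis using False by (simp add: t'_def)
  qed
  moreover have kt: "2 * t \<le> \<kappa> * t" using \<kappa>_ge Suc.prems by (intro mult_right_mono) auto
  moreover have t': "0 < t'" "t' \<le> d" "t' \<le> 2 * t" using Suc.prems d by (auto simp: t'_def)
  ultimately have IH: "good u (u + t')" "good (w' - t') w'" using Suc.IH[of t'] by auto
  have kt': "t' \<le> \<kappa> * t" using kt t'(3) by (rule order_trans[rotated])
  have v: "pert (u + t) = w' - 2 * t" "pert (w' - t) = u + \<kappa> * t"
    using pert_u_right[of t] pert_w'_left[of t] Suc.prems by auto
  have b: "u + t \<le> 8 * e" "20 * e \<le> w' - t" using Suc.prems by (auto simp: u_def w'_def)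
  show ?case
  proof
    show "good u (u + t)"
      by (rule good_step[OF IH(2), of _ _ "u + t" u]) (use order v t' b Suc.prems pert_values in auto)
    show "good (w' - t) w'"
      by (rule good_step[OF IH(1), of _ _ w' "w' - t"]) (use order v t' b kt' Suc.prems pert_values in auto)
  qed
qed

lemma good_inner':
  assumes "0 < t" "t \<le> d" shows "good u (u + t)" "good (w' - t) w'"
proof -
  obtain n where "d / t < 2 ^ n" using real_arch_pow[of 2 "d / t"] by auto
  then have "d \<le> 2 ^ n * t" using assms by (simp add: field_simps)
  then show "good u (u + t)" "good (w' - t) w'" using good_inner_germ[OF assms] by auto
qed

text \<open>The remaining points fall onto the cycle: \<open>w\<close> goes to \<open>w'\<close>,
  \<open>u'\<close> goes to \<open>u\<close>, and \<open>8 * e\<close> goes to \<open>u'\<close>.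
  The bound \<open>2 * t \<le> d\<close> leaves room for the slope 2 on the left of
  \<open>w\<close>.\<close>

lemma good_germs:
  assumes t: "0 < t" "2 * t \<le> d" and z: "z \<in> {u, w, u', w', 8 * e}"
  shows "good (z - t) z" "good z (z + t)"
proof -
  have k: "t \<le> \<kappa> * t" using \<kappa>_ge mult_right_mono[of 1 \<kappa> t] t by simp
  have tt: "t \<le> d" "t \<le> 1 - d" "2 * t \<le> 1 - d" using t d by auto
  have u: "good u (u + t)" "good (u - t) u" and w': "good (w' - 2 * t) w'" "good w' (w' + t)" "good (w' - t) w'"
    using good_inner'[of t] good_inner'[of "2 * t"] good_outer'[of t] t tt by auto
  have small: "u + t \<le> 8 * e" "20 * e \<le> w' - t" "8 * e - 1 \<le> u - t" "w' + t \<le> 20 * e + 1" "8 * e + 1 < u' - t"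
    "8 * e \<le> w - t" "w + t \<le> 8 * e + 1" "u' + t \<le> 20 * e" "u \<le> 8 * e - t" "8 * e + t \<le> w"
    using t tt d e by (auto simp: u_def w_def u'_def w'_def)
  have wl: "good (w - t) w"
    by (rule good_step[OF w'(1), of _ _ "w - t" w]) (use order small t tt pert_values pert_w_left[of t] in auto)
  have wr: "good w (w + t)" using good_w_right t tt by simp
  have u'l: "good (u' - t) u'"
    by (rule good_step[OF u(2), of _ _ "u' - t" u']) (use order small t tt pert_values pert_u'[of t] in auto)
  have u'r: "good u' (u' + t)"
    by (rule good_step[OF u(1), of _ _ u' "u' + t"]) (use order small t tt k pert_values pert_u'_right[of t] in auto)
  have cl: "good (8 * e - t) (8 * e)"
    by (rule good_step[OF u'r, of _ _ "8 * e" "8 * e - t"]) (use order small t tt pert_values pert_c[of t] in auto)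
  have cr: "good (8 * e) (8 * e + t)"
    by (rule good_step[OF u'r, of _ _ "8 * e" "8 * e + t"]) (use order small t tt pert_values pert_c[of t] in auto)
  show "good (z - t) z" using z u w' wl u'l cl by auto
  show "good z (z + t)" using z u w' wr u'r cr by auto
qed

lemma good_special:
  assumes "p < q" "z \<in> {u, w, u', w', 8 * e}" "p \<le> z" "z \<le> q"
  shows "good p q"
proof (cases "z < q")
  case True
  define t where "t = min (q - z) (d / 2)"
  have t: "0 < t" "2 * t \<le> d" using True d by (auto simp: t_def min_def)
  have "good z (z + t)" by (rule good_germs(2)[OF t assms(2)])
  then show ?thesis by (rule good_sub) (use assms in \<open>auto simp: t_def\<close>)
next
  case False
  then have "p < z" "z = q" using assms by auto
  define t where "t = min (z - p) (d / 2)"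
  have t: "0 < t" "2 * t \<le> d" using \<open>p < z\<close> d by (auto simp: t_def min_def)
  have "good (z - t) z" by (rule good_germs(1)[OF t assms(2)])
  then show ?thesis by (rule good_sub) (use \<open>z = q\<close> in \<open>auto simp: t_def\<close>)
qed

lemma A_mono: "i \<le> j \<Longrightarrow> A j \<le> A i" and B_mono: "i \<le> j \<Longrightarrow> B i \<le> B j"
  using pow_mono[of i j] by (auto simp: A_def B_def)

text \<open>Downward induction from \<open>N\<close>: the intervals between consecutive points of
  one family are mapped onto those of the other with higher index, and the last ones onto the
  lattice cells \<open>[20 * e + 1, 20 * e + 2]\<close> and
  \<open>[8 * e - 2, 8 * e - 1]\<close>.\<close>

lemma good_chain: "i < N \<Longrightarrow> good (A (Suc i)) (A i) \<and> good (B i) (B (Suc i))"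
proof (induction "N - i" arbitrary: i)
  case (Suc n)
  have r: "8 * e - 1 \<le> A (Suc i)" "A (Suc i) \<le> A i" "A i < u" "w' < B i" "B i \<le> B (Suc i)" "B (Suc i) \<le> 20 * e + 1"
    using A_bounds[of "Suc i"] A_bounds[of i] B_bounds[of "Suc i"] B_bounds[of i] A_mono[of i "Suc i"] B_mono[of i "Suc i"] Suc.prems by auto
  show ?case
  proof (cases "Suc i = N")
    case True
    then have v: "pert (A i) = 20 * e + 1" "pert (B i) = 8 * e - 1" "A (Suc i) = 8 * e - 1" "B (Suc i) = 20 * e + 1"
      using pert_A[of i] pert_B[of i] A_N B_N by auto
    have "good (A (Suc i)) (A i)"
      by (rule good_step[OF good_lattice[OF lattice_special(5,2)], of _ _ "A i" "A (Suc i)"])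
        (use r order v pert_values in auto)
    moreover have "good (B i) (B (Suc i))"
      by (rule good_step[OF good_lattice[OF lattice_special(3,4)], of _ _ "B (Suc i)" "B i"])
        (use r order v pert_values in auto)
    ultimately show ?thesis ..
  next
    case False
    then have "Suc i < N" using Suc.prems by simp
    then have IH: "good (A (Suc (Suc i))) (A (Suc i))" "good (B (Suc i)) (B (Suc (Suc i)))"
      using Suc.hyps(1)[of "Suc i"] Suc.hyps(2) by auto
    have v: "pert (A i) = B (Suc i)" "pert (A (Suc i)) = B (Suc (Suc i))" "pert (B i) = A (Suc i)" "pert (B (Suc i)) = A (Suc (Suc i))"
      using pert_A pert_B \<open>Suc i < N\<close> Suc.prems by auto
    have "good (A (Suc i)) (A i)"
      by (rule good_step[OF IH(2), of _ _ "A i" "A (Suc i)"]) (use r order v in auto)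
    moreover have "good (B i) (B (Suc i))"
      by (rule good_step[OF IH(1), of _ _ "B (Suc i)" "B i"]) (use r order v in auto)
    ultimately show ?thesis ..
  qed
qed simp

text \<open>Slope 1 carries this interval onto \<open>[B 0, B N]\<close>, which contains the first
  link of the chain.\<close>

lemma good_right_end: "good (w + \<eta>) (8 * e + 1)"
proof -
  have eq: "w + (1 - d) = 8 * e + 1" by (simp add: w_def)
  have "pert (8 * e + 1) = B N" using pert_w[of "1 - d"] d B_N unfolding eq by (simp add: w'_def)
  moreover have "pert (w + \<eta>) = B 0" using pert_w[of \<eta>] \<eta> d B_0 by simp
  moreover have "good (B 0) (B 1)" using good_chain[of 0] N by simp
  moreover have "0 \<le> w + \<eta>" using d \<eta> e by (simp add: w_def)
  ultimately show ?thesis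
    using good_step[of "B 0" "B 1" "w + \<eta>" "8 * e + 1" "w + \<eta>" "8 * e + 1"] order B_mono[of 1 N] N by auto
qed

lemma lattice_gap: "x \<in> lattice_points E \<Longrightarrow> real k * e + real_of_int j < x \<Longrightarrow> real k * e + real_of_int j + 1 \<le> x"
  "x \<in> lattice_points E \<Longrightarrow> x < real k * e + real_of_int j \<Longrightarrow> x \<le> real k * e + real_of_int j - 1"
proof -
  have eq: "real k * e + real_of_int j = real_of_int (int k * int E + j)" by simp
  have r: "real_of_int m + 1 \<le> real_of_int i" if "real_of_int m < real_of_int i" for m i
  proof -
    have "real_of_int (m + 1) \<le> real_of_int i" using that by (simp only: of_int_less_iff of_int_le_iff)
    then show ?thesis by simp
  qed
  show "x \<in> lattice_points E \<Longrightarrow> real k * e + real_of_int j < x \<Longrightarrow> real k * e + real_of_int j + 1 \<le> x"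
    unfolding eq lattice_points_def using r by blast
  show "x \<in> lattice_points E \<Longrightarrow> x < real k * e + real_of_int j \<Longrightarrow> x \<le> real k * e + real_of_int j - 1"
    unfolding eq lattice_points_def le_diff_eq using r by blast
qed

text \<open>An interval meeting one of the five special points contains a good germ there. Otherwise
  both ends lie in the same gap between special points, where \<open>Q\<close> consists only of
  lattice points, a chain \<open>A\<close> or \<open>B\<close>, or \<open>w + \<eta>\<close>, and
  the interval contains a lattice cell, a link of a chain, or the interval of
  \<open>good_right_end\<close>.\<close>

lemma good_Q:
  assumes p: "p \<in> Q" and q: "q \<in> Q" and pq: "p < q"
  shows "good p q"
proof (cases "\<exists>z\<in>{u, w, u', w', 8 * e}. p \<le> z \<and> z \<le> q")
  case True
  then show ?thesis using good_special[OF pq] by blast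
next
  case False
  then have no: "q < u \<or> u < p" "q < w \<or> w < p" "q < u' \<or> u' < p" "q < w' \<or> w' < p" "q < 8 * e \<or> 8 * e < p"
    using pq by auto
  have cases: "x \<in> lattice_points E \<or> x = w + \<eta> \<or> (\<exists>i\<le>N. x = A i) \<or> (\<exists>i\<le>N. x = B i)"
    if "x \<in> Q" "x \<notin> {u, w, u', w'}" for x using that by (auto simp: Q_def)
  have p': "p \<notin> {u, w, u', w'}" "q \<notin> {u, w, u', w'}" using no pq by auto
  have pc: "p \<in> lattice_points E \<or> p = w + \<eta> \<or> (\<exists>i\<le>N. p = A i) \<or> (\<exists>i\<le>N. p = B i)" using cases p p' by blast
  have qc: "q \<in> lattice_points E \<or> q = w + \<eta> \<or> (\<exists>i\<le>N. q = A i) \<or> (\<exists>i\<le>N. q = B i)" using cases q p' by blast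
  have AL: "A i \<notin> lattice_points E \<longrightarrow> i < N" if "i \<le> N" for i
    using that A_N lattice_special(4) by (cases "i = N") auto
  have BL: "B i \<notin> lattice_points E \<longrightarrow> i < N" if "i \<le> N" for i
    using that B_N lattice_special(5) by (cases "i = N") auto
  show ?thesis
  proof (cases "p \<in> lattice_points E \<and> q \<in> lattice_points E")
    case True
    then show ?thesis using good_lattice pq by blast
  next
    case nl: False
    consider i where "i \<le> N" "p = A i" | "p = w + \<eta>" | i where "i \<le> N" "p = B i" | "p \<in> lattice_points E" using pc by blast
    then show ?thesis
    proof cases
      case (1 i)
      then have "q < u" using no A_bounds[of i] by auto
      then have "q \<notin> lattice_points E"
        using lattice_gap(2)[of q 8 0] lattice_gap(1)[of q 8 "- 1"] A_bounds[OF 1(1)] 1 pq order by auto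
      moreover have "q \<noteq> w + \<eta>" using order \<open>q < u\<close> \<eta> by auto
      moreover have "q \<noteq> B j" if "j \<le> N" for j using B_bounds[OF that] order \<open>q < u\<close> by auto
      ultimately obtain j where j: "j \<le> N" "q = A j" using qc by blast
      have "j < i" using pq j 1 A_mono[of i j] by (cases "i \<le> j") auto
      then have "good (A (Suc j)) (A j)" using good_chain[of j] 1 by simp
      then show ?thesis by (rule good_sub) (use A_mono[of "Suc j" i] \<open>j < i\<close> 1 j in auto)
    next
      case 2
      then have "q < u'" using no order by auto
      have "q \<noteq> A j" "q \<noteq> B j" if "j \<le> N" for j
        using A_bounds[OF that] B_bounds[OF that] order \<open>q < u'\<close> 2 pq \<eta> by auto
      then have "q \<in> lattice_points E" using qc 2 pq by blast
      then have "8 * e + 1 \<le> q" using lattice_gap(1)[of q 8 0] 2 pq order \<eta> by auto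
      then show ?thesis using good_sub[OF good_right_end] 2 by simp
    next
      case (3 i)
      then have pw: "w' < p" "p \<le> 20 * e + 1" using B_bounds[OF 3(1)] by auto
      have "q \<noteq> A j" if "j \<le> N" for j using A_bounds[OF that] order pq pw by auto
      moreover have "q \<noteq> w + \<eta>" using order pq pw by auto
      moreover have "q \<in> lattice_points E \<Longrightarrow> 20 * e + 1 \<le> q" using lattice_gap(1)[of q 20 0] order pq pw by auto
      ultimately have "(q \<in> lattice_points E \<and> 20 * e + 1 \<le> q) \<or> (\<exists>j\<le>N. q = B j)"
        using qc by blast
      then obtain j where j: "j \<le> N" "i < j" "B j \<le> q"
      proof (elim disjE conjE exE)
        assume q: "q \<in> lattice_points E" "20 * e + 1 \<le> q"
        then have "i < N" using nl BL[OF 3(1)] 3 by auto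
        then show ?thesis using that[of N] B_N q by simp
      next
        fix j assume j: "j \<le> N" "q = B j"
        then have "i < j" using pq 3 B_mono[of j i] by (cases "j \<le> i") auto
        then show ?thesis using that[of j] j by simp
      qed
      then have "good (B i) (B (Suc i))" using good_chain[of i] by simp
      then show ?thesis by (rule good_sub) (use B_mono[of "Suc i" j] j 3 in auto)
    next
      case 4
      then have ql: "q \<notin> lattice_points E" using nl by blast
      then consider "q = w + \<eta>" | i where "i \<le> N" "q = A i" | i where "i \<le> N" "q = B i" using qc by blast
      then show ?thesis
      proof cases
        case 1
        then have "8 * e < p" using no order \<eta> by auto
        then have "8 * e + 1 \<le> p" using lattice_gap(1)[OF 4, of 8 0] by auto
        then show ?thesis using pq 1 order by auto
      next
        case (2 i)
        then have "i < N" using AL ql by blast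
        have "p \<le> 8 * e - 1" using lattice_gap(2)[OF 4, of 8 0] A_bounds[OF 2(1)] 2 pq order by auto
        then have "p \<le> A (Suc i)" using A_mono[of "Suc i" N] A_N \<open>i < N\<close> by simp
        then show ?thesis using good_sub[of "A (Suc i)" "A i"] good_chain[OF \<open>i < N\<close>] 2 by simp
      next
        case (3 i)
        then have "w' < p" using no B_bounds[OF 3(1)] by auto
        then have "20 * e + 1 \<le> p" using lattice_gap(1)[OF 4, of 20 0] order by auto
        then show ?thesis using pq 3 B_bounds[OF 3(1)] by auto
      qed
    qed
  qed
qed

end

section \<open>The perturbation has the required shape\<close>

context perturbation begin

text \<open>At \<open>8 * e\<close> and \<open>20 * e\<close> the blow-up moves the value off the
  lattice value of the base map. Both neighbouring unit cells still attain that value, since each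
  fold passes through it on either side.\<close>

lemma pert_image_special:
  "20 * e \<in> pert ` {8 * e - 1..8 * e}" "20 * e \<in> pert ` {8 * e..8 * e + 1}"
  "8 * e \<in> pert ` {20 * e - 1..20 * e}" "8 * e \<in> pert ` {20 * e..20 * e + 1}"
proof -
  have im: "z \<in> pert ` {l..r}" if "0 \<le> l" "r \<le> 24 * e" "x \<in> {l..r}" "y \<in> {l..r}" "pert x \<le> z" "z \<le> pert y" for l r x y z
    using connected_image_interval[OF pert_continuous, of "{l..r}" "pert x" "pert y"] that by auto
  have v: "pert (8 * e + 1) = 20 * e + 1" "pert (20 * e - 1) = 8 * e - 1"
    using pert_lattice[of "8 * int E + 1"] pert_lattice[of "20 * int E - 1"] E by (auto simp: lattice_map_def)
  have b: "0 \<le> 8 * e - 1" "8 * e + 1 \<le> 24 * e" "0 \<le> 20 * e - 1" "20 * e + 1 \<le> 24 * e" "0 \<le> 8 * e" "8 * e \<le> 24 * e" "0 \<le> 20 * e" "20 * e \<le> 24 * e"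
    using e by auto
  show "20 * e \<in> pert ` {8 * e - 1..8 * e}"
    by (rule im[of _ _ "8 * e" "8 * e - 1"]) (use b order pert_values in simp_all)
  show "20 * e \<in> pert ` {8 * e..8 * e + 1}"
    by (rule im[of _ _ "8 * e" "8 * e + 1"]) (use b order pert_values v in simp_all)
  show "8 * e \<in> pert ` {20 * e - 1..20 * e}"
    by (rule im[of _ _ "20 * e - 1" "20 * e"]) (use b order pert_values v \<eta> in simp_all)
  show "8 * e \<in> pert ` {20 * e..20 * e + 1}"
  proof (rule im[of _ _ "20 * e + 1" "20 * e"])
    show "pert (20 * e + 1) \<le> 8 * e" "8 * e \<le> pert (20 * e)" unfolding pert_values using order \<eta> by linarith+
    show "20 * e + 1 \<le> 24 * e" "0 \<le> 20 * e" by (fact b)+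
  qed simp_all
qed

lemma pert_hits_lattice:
  assumes i: "0 \<le> i" "i < 24 * int E" and j: "j = i \<or> j = i + 1"
  shows "real_of_int (lattice_map (int E) j) \<in> pert ` {real_of_int i..real_of_int i + 1}"
proof -
  consider "j \<noteq> 8 * int E" "j \<noteq> 20 * int E" | "j = 8 * int E" | "j = 20 * int E" by blast
  then show ?thesis
  proof cases
    case 1
    then have "real_of_int (lattice_map (int E) j) = pert (real_of_int j)" using pert_lattice[of j] i j by auto
    moreover have "real_of_int j \<in> {real_of_int i..real_of_int i + 1}" using j by auto
    ultimately show ?thesis by (rule image_eqI)
  next
    case 2
    then have "real_of_int (lattice_map (int E) j) = 20 * e" using E by (simp add: lattice_map_def)
    moreover have "real_of_int i = 8 * e \<or> real_of_int i = 8 * e - 1" using j 2 by auto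
    ultimately show ?thesis using pert_image_special(1,2) by auto
  next
    case 3
    then have "real_of_int (lattice_map (int E) j) = 8 * e" using E by (simp add: lattice_map_def)
    moreover have "real_of_int i = 20 * e \<or> real_of_int i = 20 * e - 1" using j 3 by auto
    ultimately show ?thesis using pert_image_special(3,4) by auto
  qed
qed

lemma Q_cases: "x \<in> Q \<Longrightarrow> x \<in> lattice_points E \<or> x \<in> {u, w, u', w', w + \<eta>} \<or> (\<exists>i\<le>N. x = A i) \<or> (\<exists>i\<le>N. x = B i)"
  by (auto simp: Q_def)

lemma Q_less: "x \<in> Q \<Longrightarrow> x < 8 * e - 1 \<Longrightarrow> x \<in> lattice_points E"
proof -
  assume x: "x \<in> Q" "x < 8 * e - 1"
  have "x \<noteq> A i" "x \<noteq> B i" if "i \<le> N" for i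
    using A_bounds[OF that] B_bounds[OF that] order x(2) by auto
  moreover have "x \<notin> {u, w, u', w', w + \<eta>}" using order \<eta> x(2) by auto
  ultimately show "x \<in> lattice_points E" using Q_cases[OF x(1)] by blast
qed

lemma pert_shape: "shape E d pert Q"
proof
  show "real_of_int (lattice_map (int E) i) \<in> pert ` {real_of_int i..real_of_int i + 1} \<and>
      real_of_int (lattice_map (int E) (i + 1)) \<in> pert ` {real_of_int i..real_of_int i + 1}"
    if "0 \<le> i" "i < 24 * int E" for i
    using pert_hits_lattice[OF that] by blast
  show "\<exists>m i. 0 \<le> i \<and> i < 24 * int E \<and> {real_of_int i..real_of_int i + 1} \<subseteq> (pert ^^ m) ` {p..q}"
    if "p \<in> Q" "q \<in> Q" "p < q" for p q
    using good_Q[OF that] by (simp add: good_def)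
  show "steep ((- 1) ^ (E - Suc k)) 1 pert (real k) (real k + 1)" if k: "k < E" for k
  proof (rule steep_base_eq[OF base_zig[OF E k]])
    fix t assume "t \<le> real k + 1"
    then show "pert t = base E t" using k e by (intro pert_pieces(1)) linarith
  qed
  show "14 * e - 1 \<le> pert x \<and> pert x \<le> 14 * e" if "0 \<le> x" "x \<le> e" for x
    using base_zig_range[OF E that(2)] pert_pieces(1)[of x] that e by simp
  show "20 * e \<le> pert x" if "8 * e + d \<le> x" "x \<le> 10 * e" for x
    using pert_pieces(5)[of x] base_pieces(4)[OF E, of x] that d e by simp
  show "6 * e \<le> pert x \<and> pert x \<le> 8 * e" if "18 * e \<le> x" "x \<le> 20 * e - d" for x
    using pert_pieces(5)[of x] base_pieces(6)[OF E, of x] that d e by simp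
  show "\<exists>p\<in>Q. \<exists>q\<in>Q. p < q \<and> adj Q p q \<and> \<not> adj Q (pert p) (pert q)"
  proof (intro bexI conjI)
    show "e < e + 1" by simp
    show "adj Q e (e + 1)"
      unfolding adj_def
    proof (intro ballI conjI notI)
      fix q assume q: "q \<in> Q" "e < q \<and> q < e + 1"
      then have "q \<in> lattice_points E" using Q_less e by auto
      then show False using lattice_gap(1)[of q 1 0] q by auto
    qed linarith
    have v: "pert e = 14 * e" "pert (e + 1) = 14 * e + 2"
      using pert_pieces(1)[of e] pert_pieces(1)[of "e + 1"] base_pieces(2)[OF E, of e] base_pieces(2)[OF E, of "e + 1"] e by auto
    have "14 * e + 1 \<in> Q" using lattice_shift[of 14 1] e Q_I(1) by simp
    then show "\<not> adj Q (pert e) (pert (e + 1))" unfolding v adj_def by force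
    show "e \<in> Q" "e + 1 \<in> Q" using lattice_shift[of 1 0] lattice_shift[of 1 1] e Q_I(1) by auto
  qed
  show "real_of_int i \<in> Q" if "0 \<le> i" "i \<le> 24 * int E" for i
    using that by (intro Q_I(1)) (auto simp: lattice_points_def)
  show "8 * e + d \<in> Q" "20 * e - d \<in> Q" using Q_I(3,4) by (auto simp: w_def u'_def)
  show "0 \<le> d" "d < 1" using d by auto
qed (fact E Q_fin Q_sub pert_continuous pert_maps Q_inv pert_steep)+

text \<open>The halves of the two folds are single cells; this is the adjacency on which the bound
  \<open>2 \<le> \<beta>\<close> rests.\<close>

lemma Q_adj: "adj Q u (8 * e)" "adj Q (8 * e) w" "adj Q u' (20 * e)" "adj Q (20 * e) w'"
proof -
  have *: "q \<le> u \<or> q = 8 * e \<or> w \<le> q \<and> q \<le> u' \<or> q = 20 * e \<or> w' \<le> q" if q: "q \<in> Q" for q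
  proof -
    consider "q \<in> lattice_points E" | "q \<in> {u, w, u', w', w + \<eta>}" | i where "i \<le> N" "q = A i" | i where "i \<le> N" "q = B i"
      using Q_cases[OF q] by blast
    then show ?thesis
    proof cases
      case 1
      have "q \<le> 8 * e - 1 \<or> q = 8 * e \<or> 8 * e + 1 \<le> q"
        using lattice_gap(1)[OF 1, of 8 0] lattice_gap(2)[OF 1, of 8 0]
        by (cases q "8 * e" rule: linorder_cases) simp_all
      moreover have "q \<le> 20 * e - 1 \<or> q = 20 * e \<or> 20 * e + 1 \<le> q"
        using lattice_gap(1)[OF 1, of 20 0] lattice_gap(2)[OF 1, of 20 0]
        by (cases q "20 * e" rule: linorder_cases) simp_all
      moreover have "20 * e - 1 \<le> u'" "w \<le> 8 * e + 1" using d by (auto simp: u'_def w_def)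
      moreover have "8 * e - 1 \<le> u" "20 * e + 1 \<ge> w'" using order by auto
      ultimately show ?thesis by argo
    next
      case 2
      then show ?thesis using order \<eta> by auto
    next
      case (3 i)
      then show ?thesis using A_bounds[of i] by auto
    next
      case (4 i)
      then show ?thesis using B_bounds[of i] by auto
    qed
  qed
  have "\<not> (u < q \<and> q < 8 * e)" "\<not> (8 * e < q \<and> q < w)" "\<not> (u' < q \<and> q < 20 * e)" "\<not> (20 * e < q \<and> q < w')"
    if "q \<in> Q" for q
    using *[OF that] order \<eta> by (elim disjE conjE; simp)+
  moreover have "\<not> (8 * e < q \<and> q < u)" "\<not> (w < q \<and> q < 8 * e)" "\<not> (20 * e < q \<and> q < u')" "\<not> (w' < q \<and> q < 20 * e)" for q
    using order by auto
  ultimately show "adj Q u (8 * e)" "adj Q (8 * e) w" "adj Q u' (20 * e)" "adj Q (20 * e) w'"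
    unfolding adj_def by blast+
qed

end

lemma exists_perturbation:
  assumes "1 \<le> E" "0 < d" "d \<le> 1 / 4"
  obtains N \<eta> s \<kappa> where "perturbation E N d \<eta> s \<kappa>"
proof -
  define s where "s = (2 - d) / (1 - d)"
  have s: "2 \<le> s" using assms by (simp add: s_def field_simps)
  \<comment> \<open>A power of \<open>s\<close> beyond \<open>1 / d\<close> makes
    \<open>\<eta> = (1 - d) / s ^ N\<close> at most \<open>d\<close>; the successor in
    \<open>N\<close> ensures that \<open>N\<close> is positive.\<close>
  obtain N0 where "1 / d < 2 ^ N0" using real_arch_pow[of 2 "1 / d"] by auto
  define N where "N = Suc N0"
  define \<eta> where "\<eta> = (1 - d) / s ^ N"
  have "2 ^ N0 \<le> (2 :: real) ^ N" unfolding N_def by (rule power_increasing) auto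
  moreover have "2 ^ N \<le> s ^ N" using s by (intro power_mono) auto
  ultimately have "1 / d \<le> s ^ N" using \<open>1 / d < 2 ^ N0\<close> by linarith
  then have "1 \<le> s ^ N * d" using assms by (simp add: field_simps)
  then have "\<eta> \<le> d" using assms s by (simp add: \<eta>_def pos_divide_le_eq mult.commute)
  moreover have "0 < \<eta>" using assms s by (simp add: \<eta>_def)
  moreover have "s ^ N * \<eta> = 1 - d" using s by (simp add: \<eta>_def)
  moreover have "s * (1 - d) = 2 - d" using assms by (simp add: s_def)
  moreover have "(2 * d + \<eta>) / d * d = 2 * d + \<eta>" using assms by simp
  ultimately have "perturbation E N d \<eta> s ((2 * d + \<eta>) / d)"
    using assms unfolding perturbation_def N_def by simp
  then show ?thesis by (rule that)
qed

text \<open>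
  \<open>[x1, x3]\<close> and \<open>[y1, y3]\<close> are mapped two-to-one across each other, which gives \<open>\<beta>\<^sup>2 \<ge> 4\<close>.
\<close>

lemma (in markov_map) \<beta>_ge_2:
  assumes x: "a \<le> x1" "x1 < x2" "x2 < x3" "x3 \<le> z" "z \<le> b" "adj P x1 x2" "adj P x2 x3"
    and y: "a \<le> y1" "y1 < y2" "y2 < y3" "y3 \<le> b" "adj P y1 y2" "adj P y2 y3"
    and f: "f x1 = y3" "f x2 = y1" "f x3 = y3" "f y1 = x1" "f y2 = z" "f y3 = x1"
  shows "2 \<le> \<beta>"
proof -
  define X where "X = \<phi> x3 - \<phi> x1"
  define Y where "Y = \<phi> y3 - \<phi> y1"
  have m: "\<phi> x1 < \<phi> x2" "\<phi> x2 < \<phi> x3" "\<phi> y1 < \<phi> y2" "\<phi> y2 < \<phi> y3" "\<phi> x3 \<le> \<phi> z"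
    by (rule \<phi>_strict \<phi>_mono; use x y in linarith)+
  have abs_diff_less: "\<bar>p - q\<bar> = q - p" if "p < q" for p q :: real using that by simp
  have b: "x2 \<le> b" "a \<le> x2" "x3 \<le> b" "y2 \<le> b" "a \<le> y2" using x y by linarith+
  have "\<beta> * (\<phi> x2 - \<phi> x1) = Y" "\<beta> * (\<phi> x3 - \<phi> x2) = Y"
    using scale_less[OF x(1,2) b(1) x(6), unfolded f] scale_less[OF b(2) x(3) b(3) x(7), unfolded f]
    unfolding abs_diff_less[OF m(1)] abs_diff_less[OF m(2)] Y_def using m(3,4) by linarith+
  then have 1: "\<beta> * X = 2 * Y" by (simp add: X_def algebra_simps)
  have "\<beta> * (\<phi> y2 - \<phi> y1) = \<phi> z - \<phi> x1" "\<beta> * (\<phi> y3 - \<phi> y2) = \<phi> z - \<phi> x1"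
    using scale_less[OF y(1,2) b(4) y(5), unfolded f] scale_less[OF b(5) y(3,4,6), unfolded f]
    unfolding abs_diff_less[OF m(3)] abs_diff_less[OF m(4)] using m(1,2,5) by linarith+
  then have "\<beta> * Y = 2 * (\<phi> z - \<phi> x1)" by (simp add: Y_def algebra_simps)
  then have 2: "2 * X \<le> \<beta> * Y" using m by (simp add: X_def)
  have "0 < X" using m by (simp add: X_def)
  have "4 * X \<le> 2 * (\<beta> * Y)" using 2 by linarith
  also have "\<dots> = \<beta> * (2 * Y)" by simp
  also have "\<dots> = \<beta> * \<beta> * X" unfolding 1[symmetric] by simp
  finally have "4 \<le> \<beta> * \<beta>" using \<open>0 < X\<close> by simp
  then have "2 ^ 2 \<le> \<beta> ^ 2" by (simp add: power2_eq_square)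
  then show ?thesis by (rule power2_le_imp_le) (use \<beta>_gt_1 in linarith)
qed

section \<open>Discontinuity\<close>

lemma rescale_apply:
  assumes "a < b" "0 < M" "0 \<le> y" "y \<le> M"
  shows "rescale a b M f (a + (b - a) / M * y) = a + (b - a) / M * f y"
proof -
  have "0 \<le> (b - a) / M * y" "(b - a) / M * y \<le> (b - a) / M * M"
    using assms by (intro mult_nonneg_nonneg mult_left_mono; simp)+
  moreover have "(b - a) / M * M = b - a" using assms by simp
  ultimately have "a + (b - a) / M * y \<in> {a..b}" unfolding atLeastAtMost_iff by linarith
  then show ?thesis using assms by (simp add: rescale_def)
qed

lemma adj_affine:
  assumes "0 < k" shows "adj ((\<lambda>y. a + k * y) ` Q) (a + k * x) (a + k * y) \<longleftrightarrow> adj Q x y"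
  using assms by (simp add: adj_def)

lemma rescale_extensional: "rescale a b M f \<in> extensional {a..b}"
  by (simp add: rescale_def extensional_def)

lemma rescale_close:
  assumes ab: "a < b" "0 < M" and near: "\<And>y. \<bar>f y - h y\<bar> \<le> c" and x: "x \<in> {a..b}"
  shows "\<bar>rescale a b M f x - rescale a b M h x\<bar> \<le> (b - a) / M * c"
proof -
  define y where "y = (x - a) * (M / (b - a))"
  have "\<bar>rescale a b M f x - rescale a b M h x\<bar> = \<bar>(b - a) / M * (f y - h y)\<bar>"
    using x by (simp add: rescale_def y_def right_diff_distrib)
  also have "\<dots> = (b - a) / M * \<bar>f y - h y\<bar>" using ab by (simp add: abs_mult)
  also have "\<dots> \<le> (b - a) / M * c" using near ab by (intro mult_left_mono) auto
  finally show ?thesis .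
qed

lemma lattice_map_step:
  assumes "1 \<le> E" "0 \<le> i" "i < 24 * E"
  shows "\<bar>lattice_map E (i + 1) - lattice_map E i\<bar> \<le> 2"
proof -
  consider "i < E" | "E \<le> i" "i < 6 * E" | "6 * E \<le> i" "i < 8 * E" | "8 * E \<le> i" "i < 10 * E"
    | "10 * E \<le> i" "i < 18 * E" | "18 * E \<le> i" "i < 20 * E" | "20 * E \<le> i" by linarith
  then show ?thesis
  proof cases
    case 1
    then have "i \<le> E" "i + 1 \<le> E" by simp_all
    then have "lattice_map E i = 14 * E - (E - i) mod 2" "lattice_map E (i + 1) = 14 * E - (E - (i + 1)) mod 2"
      by (simp_all only: lattice_map_def if_True)
    then show ?thesis
      using pos_mod_bound[of 2 "E - i"] pos_mod_sign[of 2 "E - i"]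
        pos_mod_bound[of 2 "E - (i + 1)"] pos_mod_sign[of 2 "E - (i + 1)"] by linarith
  next
    case 2
    then have "lattice_map E i = 2 * i + 12 * E" by (cases "i = E") (simp_all add: lattice_map_def)
    then show ?thesis using 2 by (simp add: lattice_map_def)
  qed (use assms in \<open>simp_all add: lattice_map_def\<close>)
qed

lemma lattice_map_first:
  assumes "1 \<le> E" shows "\<bar>lattice_map E 1 - lattice_map E 0\<bar> < 2"
proof -
  have "0 \<le> E" using assms by simp
  then have "lattice_map E 0 = 14 * E - (E - 0) mod 2" "lattice_map E 1 = 14 * E - (E - 1) mod 2"
    using assms by (simp_all only: lattice_map_def if_True)
  then show ?thesis
    using pos_mod_bound[of 2 "E - 0"] pos_mod_sign[of 2 "E - 0"]
      pos_mod_bound[of 2 "E - 1"] pos_mod_sign[of 2 "E - 1"] by linarith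
qed

lemma adj_no_between:
  assumes "adj P x y" "z \<in> P" "x < z" shows "\<not> z < y"
  using bspec[OF assms(1)[unfolded adj_def] assms(2)] assms(3) by simp

theorem corollary8p6:
  fixes a b :: real and n :: nat
  assumes "a < b" and "n \<ge> 5"
  shows "discontinuous_map (transitive_space a b n) (constant_slope_space n) (Phi a b)"
proof -
  \<comment> \<open>The construction has modality \<open>E + 4\<close>, and it requires
    \<open>E\<close> to be positive; this is the only place where the bound on \<open>n\<close>
    enters.\<close>
  define E where "E = n - 4"
  have E: "1 \<le> E" "n = E + 4" using assms(2) by (auto simp: E_def)
  define M where "M = 24 * real E"
  have M: "0 < M" using E by (simp add: M_def)
  define k where "k = (b - a) / M"
  have k: "0 < k" using assms(1) M by (simp add: k_def)
  define B where "B y = a + k * y" for y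
  let ?T = "B ` turning_points E"
  have B_eq: "B = (\<lambda>y. a + (b - a) / M * y)" by (simp add: fun_eq_iff B_def k_def)
  have B_inj: "inj_on B S" for S using k by (auto simp: inj_on_def B_def)
  have T: "card ?T = n + 2" using card_turning_points[OF E(1)] E(2) by (simp add: card_image[OF B_inj])
  have adjB: "adj (B ` S) (B x) (B y) \<longleftrightarrow> adj S x y" for S x y
    using adj_affine[OF k, of a S x y] by (simp add: B_def[abs_def])
  have B_less: "B x < B y \<longleftrightarrow> x < y" and B_le: "B x \<le> B y \<longleftrightarrow> x \<le> y" for x y using k by (auto simp: B_def)
  have B_diff: "B x - B y = k * (x - y)" for x y by (simp add: B_def algebra_simps)
  have B_ends: "B 0 = a" "B M = b" using M by (auto simp: B_def k_def)
  have B_in: "a \<le> B y" "B y \<le> b" if "0 \<le> y" "y \<le> M" for y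
    using B_le[of 0 y] B_le[of y M] B_ends that by auto
  have RB: "rescale a b M f (B y) = B (f y)" if "0 \<le> y" "y \<le> M" for f y
    using rescale_apply[OF assms(1) M that] by (simp add: B_def k_def)
  define f0 where "f0 = rescale a b M (base E)"
  have G: "lap_map a b f0 (B ` lattice_points E) ?T"
    using lap_map_rescale[OF assms(1) shape.lap_map[OF base_shape[OF E(1)]]]
    unfolding f0_def B_eq M_def .
  interpret G: lap_map a b f0 "B ` lattice_points E" ?T by (rule G)
  have f0: "f0 \<in> transitive_maps a b n"
    by (rule G.transitive_map[OF T]) (simp add: f0_def rescale_extensional)
  have f0_lattice: "f0 (B (real_of_int i)) = B (real_of_int (lattice_map (int E) i))" if "0 \<le> i" "i \<le> 24 * int E" for i
  proof -
    have "real_of_int i \<le> real_of_int (24 * int E)" using that by (simp only: of_int_le_iff)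
    then show ?thesis using RB[of "real_of_int i"] base_lattice[OF E(1) that] that by (simp add: f0_def M_def)
  qed
  have \<beta>0: "G.\<beta> < 2"
  proof (rule G.\<beta>_less)
    show "\<bar>f0 q - f0 p\<bar> \<le> 2 * (q - p)"
      if pq: "p \<in> B ` lattice_points E" "q \<in> B ` lattice_points E" "p < q" "adj (B ` lattice_points E) p q" for p q
    proof -
      obtain i j where ij: "p = B (real_of_int i)" "q = B (real_of_int j)" "0 \<le> i" "i \<le> 24 * int E" "0 \<le> j" "j \<le> 24 * int E"
        using pq by (auto simp: lattice_points_def)
      have "i < j" using pq(3) ij B_less by simp
      have "real_of_int (i + 1) \<in> lattice_points E" using ij \<open>i < j\<close>
        unfolding lattice_points_def by (intro imageI) auto
      moreover have "adj (lattice_points E) (real_of_int i) (real_of_int j)" using pq(4) adjB ij by simp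
      ultimately have "\<not> real_of_int (i + 1) < real_of_int j"
        by (intro adj_no_between[of _ _ _ "real_of_int (i + 1)"]) auto
      then have j: "j = i + 1" using \<open>i < j\<close> by simp
      have "\<bar>f0 q - f0 p\<bar> = k * \<bar>real_of_int (lattice_map (int E) j - lattice_map (int E) i)\<bar>"
        using f0_lattice[OF ij(3,4)] f0_lattice[OF ij(5,6)] k by (simp add: ij(1,2) B_diff abs_mult)
      also have "\<dots> \<le> k * 2"
      proof (rule mult_left_mono)
        have "\<bar>lattice_map (int E) j - lattice_map (int E) i\<bar> \<le> 2"
          unfolding j using E ij \<open>i < j\<close> by (intro lattice_map_step) auto
        then show "\<bar>real_of_int (lattice_map (int E) j - lattice_map (int E) i)\<bar> \<le> 2" by linarith
      qed (use k in simp)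
      also have "\<dots> = 2 * (q - p)" by (simp add: ij B_diff j)
      finally show ?thesis .
    qed
    \<comment> \<open>The first lattice cell is a lap of the zigzag, or for \<open>E = 1\<close> its
      only one, and is stretched by 1 instead of 2: the strict inequality that pushes the eigenvalue
      below 2.\<close>
    have L: "real_of_int 0 \<in> lattice_points E" "real_of_int 1 \<in> lattice_points E" using E unfolding lattice_points_def by auto
    then show "B (real_of_int 0) \<in> B ` lattice_points E" "B (real_of_int 1) \<in> B ` lattice_points E" by blast+
    show "B (real_of_int 0) < B (real_of_int 1)" by (simp add: B_less)
    have "\<not> (real_of_int 0 < x \<and> x < real_of_int 1) \<and> \<not> (real_of_int 1 < x \<and> x < real_of_int 0)"
      if "x \<in> lattice_points E" for x using that by (auto simp: lattice_points_def)
    then have "adj (lattice_points E) (real_of_int 0) (real_of_int 1)" unfolding adj_def by (rule ballI)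
    then show "adj (B ` lattice_points E) (B (real_of_int 0)) (B (real_of_int 1))"
      by (simp only: adjB)
    have "\<bar>lattice_map (int E) 1 - lattice_map (int E) 0\<bar> < 2" using E by (intro lattice_map_first) simp
    then have "\<bar>real_of_int (lattice_map (int E) 1 - lattice_map (int E) 0)\<bar> < 2" by linarith
    then have "k * \<bar>real_of_int (lattice_map (int E) 1 - lattice_map (int E) 0)\<bar> < k * 2" using k by simp
    moreover have "\<bar>f0 (B (real_of_int 1)) - f0 (B (real_of_int 0))\<bar> = k * \<bar>real_of_int (lattice_map (int E) 1 - lattice_map (int E) 0)\<bar>"
      using f0_lattice[of 0] f0_lattice[of 1] E k by (simp add: B_diff abs_mult)
    ultimately show "\<bar>f0 (B (real_of_int 1)) - f0 (B (real_of_int 0))\<bar> < 2 * (B (real_of_int 1) - B (real_of_int 0))"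
      by (simp add: B_diff)
  qed
  \<comment> \<open>Any cell will do. Its image \<open>[u, v]\<close> in the model is a window that
    depends on \<open>f0\<close> alone, so the bound obtained in it is independent of
    \<open>\<delta>\<close>.\<close>
  obtain p where p: "p \<in> G.S" using G.S_ne by blast
  define u v where "u = G.\<phi> p" and "v = G.\<phi> (nxt (B ` lattice_points E) p)"
  note np = G.S_nxt[OF p]
  have uv: "u < v" "0 \<le> u" "v \<le> 1"
    unfolding u_def v_def
  proof -
    show "G.\<phi> p < G.\<phi> (nxt (B ` lattice_points E) p)" by (rule G.\<phi>_strict[OF np(5,2,3)])
    have "p \<le> b" "a \<le> nxt (B ` lattice_points E) p" using np(2,3,5) by linarith+
    then show "0 \<le> G.\<phi> p" "G.\<phi> (nxt (B ` lattice_points E) p) \<le> 1"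
      using G.\<phi>_range[OF np(5)] G.\<phi>_range[OF _ np(3)] by blast+
  qed
  have g0: "\<bar>G.g t - G.g s\<bar> = G.\<beta> * (t - s)" if "u \<le> s" "s \<le> t" "t \<le> v" for s t
  proof -
    have "adj (G.\<phi> ` B ` lattice_points E) u v"
    proof -
      have "p \<le> b" "a \<le> nxt (B ` lattice_points E) p" using np(2,3,5) by linarith+
      then show ?thesis unfolding u_def v_def using G.adj_\<phi>[OF G.P_sub np(5) _ _ np(3)] np(4) by blast
    qed
    then have "adj (G.\<phi> ` B ` lattice_points E) t s" by (rule adj_subinterval) (use that in auto)
    moreover have "0 \<le> s" "s \<le> 1" "0 \<le> t" "t \<le> 1" using that uv by auto
    ultimately have "\<bar>G.g t - G.g s\<bar> = G.\<beta> * \<bar>t - s\<bar>" by (intro G.g_scale)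
    then show ?thesis using that by simp
  qed
  \<comment> \<open>\<open>n + 3\<close> subintervals against the \<open>n + 2\<close> points of
    \<open>?T\<close>: one of them is free of turning points of the other model.\<close>
  define \<epsilon> where "\<epsilon> = (2 - G.\<beta>) * ((v - u) / real (n + 3)) / 2"
  have \<epsilon>: "0 < \<epsilon>" using \<beta>0 uv by (simp add: \<epsilon>_def)
  have "\<exists>f\<in>mspace (transitive_space a b n). mdist (transitive_space a b n) f0 f < \<delta> \<and>
      \<epsilon> \<le> mdist (constant_slope_space n) (Phi a b f0) (Phi a b f)" if \<delta>: "0 < \<delta>" for \<delta>
  proof -
    \<comment> \<open>The factor \<open>1 / (4 * k)\<close> turns the distance bound
      \<open>k * (2 * d)\<close> into at most \<open>\<delta> / 2\<close>; the cap
      \<open>1 / 4\<close> is demanded by the perturbation.\<close>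
    define d where "d = min (1 / 4) (\<delta> / (4 * k))"
    have d: "0 < d" "d \<le> 1 / 4" "k * (2 * d) < \<delta>"
    proof -
      have "0 < \<delta> / (4 * k)" using \<delta> k by simp
      then show "0 < d" "d \<le> 1 / 4" unfolding d_def by simp_all
      have "k * (2 * d) \<le> k * (2 * (\<delta> / (4 * k)))" using k by (intro mult_left_mono) (auto simp: d_def)
      also have "\<dots> = \<delta> / 2" using k by simp
      finally show "k * (2 * d) < \<delta>" using \<delta> by simp
    qed
    obtain N \<eta> s \<kappa> where "perturbation E N d \<eta> s \<kappa>" using exists_perturbation[OF E(1) d(1,2)] .
    then interpret Pt: perturbation E N d \<eta> s \<kappa> .
    define f1 where "f1 = rescale a b M Pt.pert"
    have H: "lap_map a b f1 (B ` Pt.Q) ?T"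
      using lap_map_rescale[OF assms(1) shape.lap_map[OF Pt.pert_shape]]
      unfolding f1_def B_eq M_def .
    interpret H: lap_map a b f1 "B ` Pt.Q" ?T by (rule H)
    have f1: "f1 \<in> transitive_maps a b n"
      by (rule H.transitive_map[OF T]) (simp add: f1_def rescale_extensional)
    have "mdist (transitive_space a b n) f0 f1 = (SUP x\<in>{a..b}. \<bar>f0 x - f1 x\<bar>)"
      using mdist_transitive_space[OF less_imp_le[OF assms(1)] f0 f1] .
    also have "\<dots> \<le> k * (2 * d)"
    proof (rule cSUP_least)
      show "\<bar>f0 x - f1 x\<bar> \<le> k * (2 * d)" if "x \<in> {a..b}" for x
        unfolding f0_def f1_def k_def by (rule rescale_close[OF assms(1) M Pt.pert_near_base that])
    qed (use assms in simp)
    finally have near: "mdist (transitive_space a b n) f0 f1 < \<delta>" using d by simp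
    \<comment> \<open>The folded pair is \<open>[u, w]\<close> with centre \<open>8 * e\<close> and
      \<open>[u', w']\<close> with centre \<open>20 * e\<close>; the peak value
      \<open>w + \<eta>\<close> of the second fold lies beyond \<open>w\<close>.\<close>
    have \<beta>1: "2 \<le> H.\<beta>"
    proof (rule H.\<beta>_ge_2[of "B Pt.u" "B (8 * real E)" "B Pt.w" "B (Pt.w + \<eta>)" "B Pt.u'" "B (20 * real E)" "B Pt.w'"])
      have b: "0 \<le> Pt.u" "Pt.w + \<eta> \<le> M" "0 \<le> Pt.u'" "Pt.w' \<le> M" "0 \<le> 8 * real E" "8 * real E \<le> M" "20 * real E \<le> M" "0 \<le> 20 * real E"
        using Pt.order Pt.e Pt.\<eta> unfolding M_def by linarith+
      have o: "Pt.u < 8 * real E" "8 * real E < Pt.w" "Pt.w \<le> Pt.w + \<eta>" "Pt.u' < 20 * real E" "20 * real E < Pt.w'"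
        using Pt.order Pt.\<eta> by auto
      show "a \<le> B Pt.u" "B (Pt.w + \<eta>) \<le> b" "a \<le> B Pt.u'" "B Pt.w' \<le> b"
        using b o Pt.order by (auto intro!: B_in)
      show "f1 (B Pt.u) = B Pt.w'" "f1 (B (8 * real E)) = B Pt.u'" "f1 (B Pt.w) = B Pt.w'" "f1 (B Pt.u') = B Pt.u"
        "f1 (B (20 * real E)) = B (Pt.w + \<eta>)" "f1 (B Pt.w') = B Pt.u"
        unfolding f1_def using b o by (subst RB; simp add: Pt.pert_values)+
    qed (use Pt.order Pt.\<eta> Pt.Q_adj in \<open>simp_all add: B_less B_le adjB\<close>)
    have g1: "2 * (t - s) \<le> \<bar>H.g t - H.g s\<bar>" if "u \<le> s" "s \<le> t" "t \<le> v" "adj (H.\<phi> ` ?T) s t" for s t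
    proof -
      have "\<bar>H.g t - H.g s\<bar> = H.\<beta> * (t - s)" using that uv by (intro H.g_steep) auto
      moreover have "2 * (t - s) \<le> H.\<beta> * (t - s)" using \<beta>1 that by (intro mult_right_mono) auto
      ultimately show ?thesis by simp
    qed
    \<comment> \<open>The turning points of the perturbed model move with \<open>\<delta>\<close>,
      but their number is fixed by the modality, and only their number matters here.\<close>
    have "\<exists>x\<in>{u..v}. (2 - G.\<beta>) * ((v - u) / real (n + 3)) / 2 \<le> \<bar>G.g x - H.g x\<bar>"
      by (rule slope_gap[OF uv(1) g0 H.\<phi>T(1) _ g1]) (simp_all add: H.\<phi>T(5) T)
    then obtain x where x: "x \<in> {u..v}" "\<epsilon> \<le> \<bar>G.g x - H.g x\<bar>" by (auto simp: \<epsilon>_def)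
    have gm: "G.g \<in> constant_slope_maps n" "H.g \<in> constant_slope_maps n"
      using G.g_constant_slope_map[OF T] H.g_constant_slope_map[OF T] by auto
    have rng: "G.g y \<in> {0..1}" "H.g y \<in> {0..1}" if "y \<in> {0..1}" for y
      using G.g_constant_slope H.g_constant_slope that unfolding constant_slope_def by auto
    have "\<epsilon> \<le> (SUP x\<in>{0..1}. \<bar>G.g x - H.g x\<bar>)"
    proof (rule cSUP_upper2)
      show "bdd_above ((\<lambda>x. \<bar>G.g x - H.g x\<bar>) ` {0..1})"
      proof (rule bdd_aboveI2)
        fix y :: real assume "y \<in> {0..1}"
        then show "\<bar>G.g y - H.g y\<bar> \<le> 1" using rng[of y] by (auto simp: abs_le_iff)
      qed
    qed (use x uv in auto)
    then have "\<epsilon> \<le> mdist (constant_slope_space n) (Phi a b f0) (Phi a b f1)"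
      using mdist_constant_slope_space[OF gm] by (simp add: G.Phi_eq H.Phi_eq)
    then show ?thesis using near f1 by (auto simp: mspace_transitive_space)
  qed
  then have main: "\<forall>\<delta>>0. \<exists>f\<in>mspace (transitive_space a b n). mdist (transitive_space a b n) f0 f < \<delta> \<and>
      \<epsilon> \<le> mdist (constant_slope_space n) (Phi a b f0) (Phi a b f)" by blast
  have "f0 \<in> mspace (transitive_space a b n)" using f0 by (simp add: mspace_transitive_space)
  then show ?thesis unfolding discontinuous_map_def using \<epsilon> main by blast
qed

end
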